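(* Let $n\ge 1$, $d\ge 2$, let $J\subseteq\Delta_n^d$ be M-convex, and let $t>0$. Then there exists a constant $q_t(J)>0$ such that $$\mathrm N_t\,\mathrm R_J^{\mathrm w}(\mathbb T_q)\subseteq\mathrm L_J\subseteq\mathrm N_t\,\mathrm R_J^{\mathrm w}(\mathbb T_p)$$ for all $0<q\le q_t(J)$ and all $p(t)\le p\le\infty$, where $p(t):=2\max\{1,t\}$. In particular, for $t=1$ one has $p(1)=2$, and hence $\mathrm N\,\mathrm R_J^{\mathrm w}(\mathbb T_q)\subseteq\mathrm L_J\subseteq\mathrm N\,\mathrm R_J^{\mathrm w}(\mathbb T_2)$ for all sufficiently small $q>0$, where $\mathrm N=\mathrm N_1$.
   Context: **Notation.** $\mathbb N=\{0,1,2,\dots\}$; $e_1,\dots,e_n$ are the standard basis vectors of $\mathbb N^n$; $\Delta_n^d=\{\alpha\in\mathbb N^n:\alpha_1+\cdots+\alpha_n=d\}$; $\alpha!=\alpha_1!\cdots\alpha_n!$; $x^\alpha=x_1^{\alpha_1}\cdots x_n^{\alpha_n}$; inequalities between vectors are coordinatewise. The support of a polynomial or of a function on $\Delta_n^d$ is the set of $\alpha$ at which the coefficient (value) is nonzero. **M-convex sets.** A nonempty $J\subseteq\Delta_n^d$ is M-convex if for all $\alpha,\beta\in J$ and every $i$ with $\alpha_i<\beta_i$ there is $j$ with $\alpha_j>\beta_j$ such that $\alpha+e_i-e_j\in J$ and $\beta-e_i+e_j\in J$. Let $\delta_J^-$ and $\delta_J^+$ be the coordinatewise minimum and maximum of $J$.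 **Lorentzian polynomials.** A homogeneous polynomial $f$ of degree $d$ in $x_1,\dots,x_n$ with nonnegative real coefficients is strictly Lorentzian if for every $\alpha\in\Delta_n^{d-2}$ the Hessian of $\partial^\alpha f$ has exactly one positive and $n-1$ negative eigenvalues. A Lorentzian polynomial is a limit of strictly Lorentzian polynomials. $\mathrm L_J$ is the set of Lorentzian polynomials with support $J$. **Weak representations.** For $0<q<\infty$, nonnegative reals $a,b,c$ satisfy the $\mathbb T_q$-relation if $a^{1/q},b^{1/q},c^{1/q}$ are the side lengths of a (possibly degenerate) Euclidean triangle (each at most the sum of the other two). They satisfy the $\mathbb T_\infty$-relation if they satisfy the $\mathbb T_q$-relation for some $q>0$. For $0<q\le\infty$, a weak $\mathbb T_q$-representation of $J$ is a function $\rho:\Delta_n^d\to\mathbb R_{\ge0}$ with support $J$ such that for every $\alpha\in\Delta_n^{d-2}$ and $1\le i\le j\le k\le\ell\le n$ with $\delta_J^-\le\alpha$ and $\alpha+e_i+e_j+e_k+e_\ell\le\delta_J^+$, the three numbers $\rho(\alpha+e_j+e_k)\rho(\alpha+e_i+e_\ell)$, $\rho(\alpha+e_i+e_k)\rho(\alpha+e_j+e_\ell)$, $\rho(\alpha+e_i+e_j)\rho(\alpha+e_k+e_\ell)$ satisfy the $\mathbb T_q$-relation. $\mathrm R_J^{\mathrm w}(\mathbb T_q)$ is the set of these, each $\rho$ being identified with the polynomial $f_\rho=\sum_{\alpha\in J}\rho(\alpha)x^\alpha/\alpha!$. **Normalization operators.** For $t\ge0$, $\mathrm N_t$ is the linear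 operator on polynomials with $\mathrm N_t(x^\alpha)=x^\alpha/(\alpha!)^t$. *)

theory Defs
  imports
    "HOL-Library.Poly_Mapping"
    "HOL-Library.Extended_Real"
    "Jordan_Normal_Form.Char_Poly"
begin

text \<open>
  Polynomials in \<open>n\<close> variables are finitely supported maps from exponents to coefficients.
  The variables are indexed by \<open>{..<n}\<close> instead of \<open>1, \<dots>, n\<close>.
\<close>

type_synonym expo = "nat \<Rightarrow>\<^sub>0 nat"
type_synonym mpol = "expo \<Rightarrow>\<^sub>0 real"

abbreviation unit_expo :: "nat \<Rightarrow> expo" where
  "unit_expo i \<equiv> Poly_Mapping.single i 1"

definition Simplex :: "nat \<Rightarrow> nat \<Rightarrow> expo set" where
  "Simplex n d = {\<alpha>. Poly_Mapping.keys \<alpha> \<subseteq> {..<n} \<and> (\<Sum>i<n. Poly_Mapping.lookup \<alpha> i) = d}"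

definition expo_fact :: "expo \<Rightarrow> real" where
  "expo_fact \<alpha> = (\<Prod>i\<in>Poly_Mapping.keys \<alpha>. fact (Poly_Mapping.lookup \<alpha> i))"


subsection \<open>M-convex sets\<close>

text \<open>
  The difference of exponents is truncated coordinatewise; below \<open>e\<^sub>j\<close> and \<open>e\<^sub>i\<close> are only
  subtracted from exponents whose corresponding coordinate is positive.
\<close>

definition M_convex :: "nat \<Rightarrow> nat \<Rightarrow> expo set \<Rightarrow> bool" where
  "M_convex n d J \<longleftrightarrow> J \<noteq> {} \<and> J \<subseteq> Simplex n d \<and>
     (\<forall>\<alpha>\<in>J. \<forall>\<beta>\<in>J. \<forall>i<n. Poly_Mapping.lookup \<alpha> i < Poly_Mapping.lookup \<beta> i \<longrightarrow>
        (\<exists>j<n. Poly_Mapping.lookup \<alpha> j > Poly_Mapping.lookup \<beta> j \<and>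
           \<alpha> + unit_expo i - unit_expo j \<in> J \<and> \<beta> - unit_expo i + unit_expo j \<in> J))"

definition delta_min :: "expo set \<Rightarrow> nat \<Rightarrow> nat" where
  "delta_min J i = Min ((\<lambda>\<alpha>. Poly_Mapping.lookup \<alpha> i) ` J)"

definition delta_max :: "expo set \<Rightarrow> nat \<Rightarrow> nat" where
  "delta_max J i = Max ((\<lambda>\<alpha>. Poly_Mapping.lookup \<alpha> i) ` J)"


subsection \<open>Lorentzian polynomials\<close>

definition pd :: "nat \<Rightarrow> mpol \<Rightarrow> mpol" where
  "pd i f = (\<Sum>\<alpha>\<in>Poly_Mapping.keys f.
     Poly_Mapping.single (\<alpha> - unit_expo i) (real (Poly_Mapping.lookup \<alpha> i) * Poly_Mapping.lookup f \<alpha>))"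

text \<open>The iterated derivative \<open>\<partial>\<^sup>\<alpha>\<close>, for \<open>\<alpha>\<close> supported on \<open>{..<n}\<close>.\<close>

definition pd_expo :: "nat \<Rightarrow> expo \<Rightarrow> mpol \<Rightarrow> mpol" where
  "pd_expo n \<alpha> f = fold (\<lambda>i. pd i ^^ Poly_Mapping.lookup \<alpha> i) [0..<n] f"

text \<open>
  The Hessian at the origin, i.e. the matrix of constant coefficients of the second
  partial derivatives. It is only applied to quadratic forms, whose Hessian is constant.
\<close>

definition hessian :: "nat \<Rightarrow> mpol \<Rightarrow> real mat" where
  "hessian n f = mat n n (\<lambda>(i, j). Poly_Mapping.lookup (pd i (pd j f)) 0)"

text \<open>Real eigenvalues, counted with algebraic multiplicity.\<close>

definition eigenvalues_mset :: "real mat \<Rightarrow> real multiset" where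
  "eigenvalues_mset A = proots (char_poly A)"

definition homogeneous :: "nat \<Rightarrow> nat \<Rightarrow> mpol \<Rightarrow> bool" where
  "homogeneous n d f \<longleftrightarrow> Poly_Mapping.keys f \<subseteq> Simplex n d"

definition strictly_Lorentzian :: "nat \<Rightarrow> nat \<Rightarrow> mpol \<Rightarrow> bool" where
  "strictly_Lorentzian n d f \<longleftrightarrow>
     homogeneous n d f \<and> (\<forall>\<alpha>. Poly_Mapping.lookup f \<alpha> \<ge> 0) \<and>
     (d \<ge> 2 \<longrightarrow> (\<forall>\<alpha>\<in>Simplex n (d - 2).
        let E = eigenvalues_mset (hessian n (pd_expo n \<alpha> f)) in
          size (filter_mset (\<lambda>x. x > 0) E) = 1 \<and> size (filter_mset (\<lambda>x. x < 0) E) = n - 1))"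

text \<open>
  Limits are taken in the finite-dimensional space of forms of degree \<open>d\<close> in \<open>n\<close> variables,
  i.e. coefficientwise.
\<close>

definition Lorentzian :: "nat \<Rightarrow> nat \<Rightarrow> mpol \<Rightarrow> bool" where
  "Lorentzian n d f \<longleftrightarrow> homogeneous n d f \<and>
     (\<exists>F. (\<forall>k. strictly_Lorentzian n d (F k)) \<and>
        (\<forall>\<alpha>\<in>Simplex n d.
           (\<lambda>k. Poly_Mapping.lookup (F k) \<alpha>) \<longlonglongrightarrow> Poly_Mapping.lookup f \<alpha>))"

definition Lorentzian_set :: "nat \<Rightarrow> nat \<Rightarrow> expo set \<Rightarrow> mpol set" where
  "Lorentzian_set n d J = {f. Lorentzian n d f \<and> Poly_Mapping.keys f = J}"


subsection \<open>Weak representations\<close>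

definition triangle_rel :: "real \<Rightarrow> real \<Rightarrow> real \<Rightarrow> real \<Rightarrow> bool" where
  "triangle_rel q a b c \<longleftrightarrow>
     a powr (1/q) \<le> b powr (1/q) + c powr (1/q) \<and>
     b powr (1/q) \<le> a powr (1/q) + c powr (1/q) \<and>
     c powr (1/q) \<le> a powr (1/q) + b powr (1/q)"

text \<open>The \<open>T\<^sub>q\<close>-relation, meant for \<open>0 < q \<le> \<infinity>\<close> and nonnegative \<open>a, b, c\<close>.\<close>

definition T_rel :: "ereal \<Rightarrow> real \<Rightarrow> real \<Rightarrow> real \<Rightarrow> bool" where
  "T_rel q a b c \<longleftrightarrow>
     (if q = \<infinity> then \<exists>r>0. triangle_rel r a b c else triangle_rel (real_of_ereal q) a b c)"

text \<open>Only the restriction of \<open>\<rho>\<close> to \<open>Simplex n d\<close> matters.\<close>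

definition weak_rep :: "ereal \<Rightarrow> nat \<Rightarrow> nat \<Rightarrow> expo set \<Rightarrow> (expo \<Rightarrow> real) \<Rightarrow> bool" where
  "weak_rep q n d J \<rho> \<longleftrightarrow>
     (\<forall>\<alpha>\<in>Simplex n d. \<rho> \<alpha> \<ge> 0) \<and> {\<alpha>\<in>Simplex n d. \<rho> \<alpha> \<noteq> 0} = J \<and>
     (\<forall>\<alpha>\<in>Simplex n (d - 2). \<forall>i j k l. i \<le> j \<and> j \<le> k \<and> k \<le> l \<and> l < n \<longrightarrow>
        (\<forall>m<n. delta_min J m \<le> Poly_Mapping.lookup \<alpha> m) \<longrightarrow>
        (\<forall>m<n. Poly_Mapping.lookup (\<alpha> + unit_expo i + unit_expo j + unit_expo k + unit_expo l) m
                 \<le> delta_max J m) \<longrightarrow>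
        T_rel q
          (\<rho> (\<alpha> + unit_expo j + unit_expo k) * \<rho> (\<alpha> + unit_expo i + unit_expo l))
          (\<rho> (\<alpha> + unit_expo i + unit_expo k) * \<rho> (\<alpha> + unit_expo j + unit_expo l))
          (\<rho> (\<alpha> + unit_expo i + unit_expo j) * \<rho> (\<alpha> + unit_expo k + unit_expo l)))"

definition rep_poly :: "expo set \<Rightarrow> (expo \<Rightarrow> real) \<Rightarrow> mpol" where
  "rep_poly J \<rho> = (\<Sum>\<alpha>\<in>J. Poly_Mapping.single \<alpha> (\<rho> \<alpha> / expo_fact \<alpha>))"

definition weak_reps :: "ereal \<Rightarrow> nat \<Rightarrow> nat \<Rightarrow> expo set \<Rightarrow> mpol set" where
  "weak_reps q n d J = {rep_poly J \<rho> | \<rho>. weak_rep q n d J \<rho>}"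


subsection \<open>Normalization operators\<close>

definition normalization :: "real \<Rightarrow> mpol \<Rightarrow> mpol" where
  "normalization t f = (\<Sum>\<alpha>\<in>Poly_Mapping.keys f.
     Poly_Mapping.single \<alpha> (Poly_Mapping.lookup f \<alpha> / expo_fact \<alpha> powr t))"

definition p_exponent :: "real \<Rightarrow> real" where
  "p_exponent t = 2 * max 1 t"

end

theory Submission
  imports Defs "HOL-Computational_Algebra.Fundamental_Theorem_Algebra"
begin

text \<open>
  A form of degree \<open>d\<close> is handled through its normalized coefficients
  \<open>c \<beta> = \<beta>! [x\<^sup>\<beta>] f\<close>: partial derivatives become shifts, and for \<open>\<alpha>\<close> of degree \<open>d - 2\<close> the Hessian
  of \<open>\<partial>\<^sup>\<alpha> f\<close> is the matrix \<open>c (\<alpha> + e\<^sub>i + e\<^sub>j)\<close>. A symmetric matrix is called Lorentz here if its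
  form satisfies the reversed Cauchy-Schwarz inequality, i.e. if it is not positive definite on any
  plane (\<open>lorentz_form\<close>). By the spectral theorem this is what the eigenvalue condition says, up to
  degenerate directions, and unlike the eigenvalue condition it is closed under limits. Write
  \<open>\<rho> \<beta> = c \<beta> (\<beta>!)\<^sup>t\<close> for the function whose image under \<open>N\<^sub>t\<close> is \<open>f\<close>.

  Lorentzian polynomials are weak representations. The Hessians of a limit of strictly Lorentzian
  forms are Lorentz, so a Hessian \<open>C\<close> satisfies \<open>C\<^sub>a\<^sub>a C\<^sub>k\<^sub>k \<le> C\<^sub>a\<^sub>k\<^sup>2\<close>, \<open>C\<^sub>a\<^sub>a C\<^sub>k\<^sub>m \<le> 2 C\<^sub>a\<^sub>k C\<^sub>a\<^sub>m\<close>, and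
  the square roots of the three products \<open>C\<^sub>i\<^sub>j C\<^sub>k\<^sub>m\<close> are the sides of a triangle
  (\<open>lorentz_sqrt_triangle\<close>). Passing from \<open>c\<close> to \<open>\<rho>\<close> multiplies the three products by the same
  factor if the indices are distinct, and otherwise changes the ratio by at most \<open>4\<^sup>t\<close> or \<open>2\<^sup>t\<close>
  respectively. All of this is absorbed by the exponent \<open>2 max {1, t}\<close>.

  Weak representations for small \<open>q\<close> have Lorentz Hessians. The \<open>T\<^sub>q\<close>-relations say that the powers
  \<open>\<sigma>\<^sub>i\<^sub>j = \<rho> (\<alpha> + e\<^sub>i + e\<^sub>j)\<^bsup>1/q\<^esup>\<close> satisfy the Ptolemy inequality. This inequality is linear in the row
  of one index, hence inherited by the row sums \<open>u\<^sub>i\<close>, and it turns \<open>d\<^sub>i\<^sub>j = \<sigma>\<^sub>i\<^sub>j / (u\<^sub>i u\<^sub>j)\<close> into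
  a function that satisfies the triangle inequality. For a metric on at most \<open>n\<close> points and small
  \<open>q\<close>, the matrix \<open>d\<^sub>i\<^sub>j\<^sup>q\<close> is negative definite on vectors of sum zero, with an explicit margin
  (\<open>snowflake_negative_type\<close>: merge a closest pair of points and use induction). The margin
  pays for the diagonal entries, because \<open>N\<^sub>t\<close> with \<open>t > 0\<close> shrinks these by a factor \<open>\<kappa> < 1\<close>
  (\<open>lorentz_form_of_ptolemy\<close>).

  Forms with nonnegative coefficients, Lorentz Hessians and M-convex support are Lorentzian
  (\<open>Lorentzian_of_quadrics\<close>). The key is that the Hessians of the directional derivative of such a
  form along a positive vector \<open>v\<close> are Lorentz again. This reduces to cubics \<open>g\<close>, where
  \<open>G = Hess (D\<^sub>v g)\<close> satisfies
  \<open>x\<^sup>TGx \<le> \<Sum>\<^sub>i v\<^sub>i (Gx)\<^sub>i\<^sup>2 / (Gv)\<^sub>i\<close> by the reversed Cauchy-Schwarz inequality for the derivatives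
  of \<open>g\<close>. So, after rescaling, no eigenvalue of \<open>G\<close> lies strictly between \<open>0\<close> and \<open>1\<close>, while by the
  Perron-Frobenius theorem \<open>1\<close> is the largest one and simple (\<open>lorentz_form_bochner\<close>). M-convexity
  enters only as connectedness of the supports of the derivatives (\<open>conn_support\<close>), which
  directional derivatives inherit. Substituting
  \<open>\<Sum>\<^sub>i x\<^sub>i (e\<^sub>i + \<epsilon> (1, \<dots>, 1))\<close> for the vector of variables therefore gives forms with
  positive coefficients and Lorentz Hessians; applying \<open>N\<^sub>\<epsilon>\<close> in addition makes them strictly
  Lorentzian, and they converge to the original form as \<open>\<epsilon> \<rightarrow> 0\<close>.
\<close>

section \<open>The spectral theorem for real symmetric matrices\<close>

lemma symmetric_real_mat_eigenvalue:
  fixes A :: "real mat"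
  assumes A: "A \<in> carrier_mat n n" and sym: "transpose_mat A = A" and n: "n > 0"
  shows "\<exists>e. eigenvalue A e"
proof -
  let ?C = "map_mat complex_of_real A"
  have C: "?C \<in> carrier_mat n n" using A by simp
  have "degree (char_poly ?C) = n" using degree_monic_char_poly[OF C] by simp
  then have "\<not> constant (poly (char_poly ?C))" using n by (simp add: constant_degree)
  then obtain z where z: "poly (char_poly ?C) z = 0" using fundamental_theorem_of_algebra by blast
  then have "eigenvalue ?C z" using eigenvalue_root_char_poly[OF C] by simp
  then obtain v where v: "v \<in> carrier_vec n" "v \<noteq> 0\<^sub>v n" and ev: "?C *\<^sub>v v = z \<cdot>\<^sub>v v"
    unfolding eigenvalue_def eigenvector_def using C by auto
  have ev': "(\<Sum>j<n. of_real (A $$ (i,j)) * v $ j) = z * v $ i" if "i < n" for i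
  proof -
    have "(?C *\<^sub>v v) $ i = (\<Sum>j<n. of_real (A $$ (i,j)) * v $ j)"
      using that A v by (simp add: scalar_prod_def atLeast0LessThan)
    with ev that v show ?thesis by simp
  qed
  have S: "A $$ (i,j) = A $$ (j,i)" if "i < n" "j < n" for i j
    using that A sym by (metis carrier_matD index_transpose_mat(1))
  define N where "N = (\<Sum>i<n. cnj (v $ i) * v $ i)"
  define Q where "Q = (\<Sum>i<n. \<Sum>j<n. cnj (v $ i) * of_real (A $$ (i,j)) * v $ j)"
  have Nr: "N = of_real (\<Sum>i<n. (cmod (v $ i))\<^sup>2)"
    unfolding N_def of_real_sum by (rule sum.cong) (auto simp: complex_norm_square[symmetric] mult.commute simp del: of_real_power)
  have "N \<noteq> 0"
  proof
    assume "N = 0"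
    then have "(\<Sum>i<n. (cmod (v $ i))\<^sup>2) = 0" using Nr of_real_eq_0_iff by metis
    then have "\<forall>i<n. v $ i = 0" by (subst (asm) sum_nonneg_eq_0_iff) auto
    then show False using v by auto
  qed
  have "Q = (\<Sum>i<n. cnj (v $ i) * (\<Sum>j<n. of_real (A $$ (i,j)) * v $ j))"
    unfolding Q_def by (simp add: sum_distrib_left mult.assoc)
  also have "\<dots> = (\<Sum>i<n. z * (cnj (v $ i) * v $ i))"
    by (rule sum.cong) (auto simp: ev')
  also have "\<dots> = z * N" by (simp add: N_def sum_distrib_left)
  finally have Q: "Q = z * N" .
  have "cnj Q = (\<Sum>i<n. \<Sum>j<n. v $ i * of_real (A $$ (i,j)) * cnj (v $ j))"
    unfolding Q_def by simp
  also have "\<dots> = (\<Sum>j<n. \<Sum>i<n. v $ i * of_real (A $$ (i,j)) * cnj (v $ j))"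
    by (rule sum.swap)
  also have "\<dots> = Q" unfolding Q_def
    by (intro sum.cong) (auto simp: S mult_ac)
  finally have "cnj z * N = z * N" using Q Nr by (metis complex_cnj_mult complex_cnj_complex_of_real)
  then have "cnj z = z" using \<open>N \<noteq> 0\<close> by simp
  then obtain e where e: "z = of_real e" by (metis Reals_cnj_iff Reals_cases)
  have "poly (char_poly ?C) z = of_real (poly (char_poly A) e)"
    unfolding of_real_hom.char_poly_hom[OF A] e by simp
  then have "poly (char_poly A) e = 0" using z by simp
  then show ?thesis using eigenvalue_root_char_poly[OF A] by blast
qed

lemma proots_prod_linear_factors:
  "proots (\<Prod>a\<leftarrow>xs. [:- a, 1:]) = mset (xs :: 'a :: idom list)"
proof (induction xs)
  case (Cons a xs)
  have "(\<Prod>a\<leftarrow>xs. [:- a, 1:]) \<noteq> 0" unfolding prod_list_zero_iff by auto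
  then have "[:- a, 1:] * (\<Prod>a\<leftarrow>xs. [:- a, 1:]) \<noteq> 0" unfolding mult_eq_0_iff by simp
  then have "[:- a, 1:] \<noteq> 0" "(\<Prod>a\<leftarrow>xs. [:- a, 1:]) \<noteq> 0" unfolding mult_eq_0_iff by blast+
  from proots_mult[OF this] Cons show ?case by (simp del: mult_pCons_left)
qed simp

text \<open>
  The reflection in the hyperplane orthogonal to \<open>w\<close>. For \<open>w = 0\<close> the quotient \<open>2 / (w \<bullet> w)\<close> is \<open>0\<close>,
  and the matrix is the identity.
\<close>

definition householder :: "nat \<Rightarrow> real vec \<Rightarrow> real mat" where
  "householder n w = mat n n (\<lambda>(i,j). (if i = j then 1 else 0) - 2 / (w \<bullet> w) * (w $ i * w $ j))"

lemma householder_mult_vec: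
  assumes "w \<in> carrier_vec n" "x \<in> carrier_vec n"
  shows "householder n w *\<^sub>v x = x - (2 / (w \<bullet> w) * (w \<bullet> x)) \<cdot>\<^sub>v w"
proof (rule eq_vecI)
  fix i assume "i < dim_vec (x - (2 / (w \<bullet> w) * (w \<bullet> x)) \<cdot>\<^sub>v w)"
  then have i: "i < n" using assms by simp
  have "(householder n w *\<^sub>v x) $ i
      = (\<Sum>j<n. (if i = j then x $ j else 0) - 2 / (w \<bullet> w) * w $ i * (w $ j * x $ j))"
    using i assms
    by (auto simp: householder_def scalar_prod_def atLeast0LessThan algebra_simps intro!: sum.cong)
  also have "\<dots> = x $ i - (\<Sum>j<n. 2 / (w \<bullet> w) * w $ i * (w $ j * x $ j))"
    using i by (simp only: sum_subtractf) simp
  also have "\<dots> = x $ i - 2 / (w \<bullet> w) * w $ i * (w \<bullet> x)"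
    unfolding sum_distrib_left[symmetric] using assms by (simp add: scalar_prod_def atLeast0LessThan)
  finally show "(householder n w *\<^sub>v x) $ i = (x - (2 / (w \<bullet> w) * (w \<bullet> x)) \<cdot>\<^sub>v w) $ i"
    using i assms by (simp add: algebra_simps)
qed (use assms in \<open>auto simp: householder_def\<close>)

lemma householder_square:
  assumes w: "w \<in> carrier_vec n"
  shows "householder n w * householder n w = 1\<^sub>m n"
proof (rule eq_matI)
  fix i j assume ij: "i < dim_row (1\<^sub>m n :: real mat)" "j < dim_col (1\<^sub>m n :: real mat)"
  define c where "c = 2 / (w \<bullet> w)"
  have c: "c * c * (w \<bullet> w) = 2 * c" by (auto simp: c_def)
  have "(householder n w * householder n w) $$ (i,j)
     = (\<Sum>k<n. ((if i = k then 1 else 0) - c * (w $ i * w $ k)) * ((if k = j then 1 else 0) - c * (w $ k * w $ j)))"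
    using ij by (simp add: householder_def scalar_prod_def atLeast0LessThan c_def)
  also have "\<dots> = (\<Sum>k<n. (if i = k then (if k = j then 1 else 0) else 0)
       - (if i = k then c * (w $ k * w $ j) else 0)
       - (if k = j then c * (w $ i * w $ k) else 0) + c * c * (w $ i * w $ j) * (w $ k * w $ k))"
    by (rule sum.cong) (auto simp: algebra_simps)
  also have "\<dots> = (if i = j then 1 else 0) - 2 * c * (w $ i * w $ j) + c * c * (w $ i * w $ j) * (w \<bullet> w)"
    using ij w by (simp add: sum.distrib sum_subtractf sum_distrib_left[symmetric] scalar_prod_def atLeast0LessThan)
  also have "\<dots> = (if i = j then 1 else 0) - 2 * c * (w $ i * w $ j) + (c * c * (w \<bullet> w)) * (w $ i * w $ j)"
    by simp
  also have "\<dots> = 1\<^sub>m n $$ (i,j)" unfolding c using ij by simp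
  finally show "(householder n w * householder n w) $$ (i,j) = 1\<^sub>m n $$ (i,j)" .
qed (auto simp: householder_def)

text \<open>
  Induction on the dimension: the reflection that exchanges a unit eigenvector \<open>u\<close> with the first unit
  vector splits off a block of size one.
\<close>

theorem symmetric_real_mat_diagonalizable:
  fixes A :: "real mat"
  assumes "A \<in> carrier_mat n n" and "transpose_mat A = A"
  shows "\<exists>P D. P \<in> carrier_mat n n \<and> D \<in> carrier_mat n n \<and> diagonal_mat D \<and>
     transpose_mat P * P = 1\<^sub>m n \<and> A * P = P * D"
  using assms
proof (induction n arbitrary: A)
  case 0
  then show ?case
    by (intro exI[of _ A]) (auto simp: diagonal_mat_def)
next
  case (Suc n)
  note A = Suc.prems(1) and sym = Suc.prems(2)
  let ?N = "Suc n"
  obtain e where "eigenvalue A e" using symmetric_real_mat_eigenvalue[OF A sym] by auto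
  then obtain v where v: "v \<in> carrier_vec ?N" "v \<noteq> 0\<^sub>v ?N" and ev: "A *\<^sub>v v = e \<cdot>\<^sub>v v"
    unfolding eigenvalue_def eigenvector_def using A by auto
  have vv: "v \<bullet> v > 0"
  proof -
    have "v \<bullet> v \<ge> 0" by (simp add: scalar_prod_def sum_nonneg)
    moreover have "v \<bullet> v \<noteq> 0" using v conjugate_square_eq_0_vec[OF v(1)] by auto
    ultimately show ?thesis by simp
  qed
  define u where "u = (1 / sqrt (v \<bullet> v)) \<cdot>\<^sub>v v"
  have u: "u \<in> carrier_vec ?N" using v by (simp add: u_def)
  have uu: "u \<bullet> u = 1" using v vv by (simp add: u_def)
  have eu: "A *\<^sub>v u = e \<cdot>\<^sub>v u" unfolding u_def
    using A v ev by (simp add: mult_mat_vec smult_smult_assoc mult.commute)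
  \<comment> \<open>reflecting along \<open>u - e\<^sub>0\<close> exchanges the two unit vectors
    \<open>u\<close> and \<open>e\<^sub>0\<close>\<close>
  define w where "w = u - unit_vec ?N 0"
  have w: "w \<in> carrier_vec ?N" using u by (simp add: w_def)
  define W where "W = householder ?N w"
  have W: "W \<in> carrier_mat ?N ?N" by (simp add: W_def householder_def)
  have WW: "W * W = 1\<^sub>m ?N" unfolding W_def by (rule householder_square[OF w])
  have WT: "transpose_mat W = W"
    by (rule eq_matI) (auto simp: W_def householder_def)
  have We: "W *\<^sub>v unit_vec ?N 0 = u"
  proof (cases "w = 0\<^sub>v ?N")
    case True
    have eq: "u $ i = unit_vec ?N 0 $ i" if "i < ?N" for i
      using arg_cong[OF True, of "\<lambda>x. x $ i"] that u by (simp add: w_def)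
    have "u = unit_vec ?N 0" using u eq by (intro eq_vecI) auto
    moreover have "W *\<^sub>v unit_vec ?N 0 = unit_vec ?N 0"
      unfolding W_def using householder_mult_vec[OF w, of "unit_vec ?N 0"] True by auto
    ultimately show ?thesis by simp
  next
    case False
    then have w0: "w \<bullet> w \<noteq> 0" using w conjugate_square_eq_0_vec[OF w] by auto
    have we: "w \<bullet> unit_vec ?N 0 = u $ 0 - 1" using u w by (simp add: w_def)
    have "w \<bullet> w = w \<bullet> u - w \<bullet> unit_vec ?N 0"
      using u w by (simp add: w_def scalar_prod_minus_distrib[of _ "?N"])
    also have "w \<bullet> u = 1 - u $ 0" using u uu
      by (simp add: w_def minus_scalar_prod_distrib[of _ "?N"])
    finally have "w \<bullet> w = - 2 * (u $ 0 - 1)" using we by simp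
    then have "2 / (w \<bullet> w) * (w \<bullet> unit_vec ?N 0) = -1" using w0 we by (simp add: field_simps)
    then have "W *\<^sub>v unit_vec ?N 0 = unit_vec ?N 0 - (-1) \<cdot>\<^sub>v w"
      unfolding W_def using householder_mult_vec[OF w, of "unit_vec ?N 0"] by simp
    also have "\<dots> = u" using u by (intro eq_vecI) (auto simp: w_def)
    finally show ?thesis .
  qed
  have Wu: "W *\<^sub>v u = unit_vec ?N 0"
    using We W by (metis WW assoc_mult_mat_vec one_mult_mat_vec unit_vec_carrier)
  define B where "B = W * A * W"
  have B: "B \<in> carrier_mat ?N ?N" using W A by (simp add: B_def)
  have BT: "transpose_mat B = B" unfolding B_def
  proof -
    have "transpose_mat (W * A * W) = transpose_mat W * (transpose_mat A * transpose_mat W)"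
      using W A by (simp add: transpose_mult[of _ ?N ?N _ ?N])
    then show "transpose_mat (W * A * W) = W * A * W" using WT sym W A by simp
  qed
  have "B *\<^sub>v unit_vec ?N 0 = W *\<^sub>v (A *\<^sub>v (W *\<^sub>v unit_vec ?N 0))"
    unfolding B_def using W A by (simp add: assoc_mult_mat_vec[of _ ?N ?N _ ?N])
  also have "\<dots> = e \<cdot>\<^sub>v unit_vec ?N 0"
    unfolding We eu using W u Wu by (simp add: mult_mat_vec[of _ ?N ?N])
  finally have Be: "B *\<^sub>v unit_vec ?N 0 = e \<cdot>\<^sub>v unit_vec ?N 0" .
  have B0: "B $$ (i,0) = (if i = 0 then e else 0)" if "i < ?N" for i
    using arg_cong[OF Be, of "\<lambda>x. x $ i"] that B by simp
  have Bs: "B $$ (i,j) = B $$ (j,i)" if "i < ?N" "j < ?N" for i j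
    using that B BT by (metis carrier_matD index_transpose_mat(1))
  define C where "C = mat n n (\<lambda>(i,j). B $$ (Suc i, Suc j))"
  have C: "C \<in> carrier_mat n n" by (simp add: C_def)
  have Bblock: "B = four_block_mat (mat 1 1 (\<lambda>_. e)) (0\<^sub>m 1 n) (0\<^sub>m n 1) C" (is "_ = four_block_mat ?e _ _ _")
    using B B0 Bs by (intro eq_matI) (auto simp: C_def)
  have "transpose_mat C = C" by (rule eq_matI) (auto simp: C_def Bs)
  from Suc.IH[OF C this] obtain P D where P: "P \<in> carrier_mat n n" and D: "D \<in> carrier_mat n n"
    and dD: "diagonal_mat D" and PP: "transpose_mat P * P = 1\<^sub>m n" and CP: "C * P = P * D" by auto
  define Q where "Q = four_block_mat (1\<^sub>m 1) (0\<^sub>m 1 n) (0\<^sub>m n 1) P"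
  define E where "E = four_block_mat ?e (0\<^sub>m 1 n) (0\<^sub>m n 1) D"
  have Q: "Q \<in> carrier_mat ?N ?N" using P four_block_carrier_mat[of "1\<^sub>m 1" 1 1 P n n]
    by (simp add: Q_def)
  have E: "E \<in> carrier_mat ?N ?N" using D four_block_carrier_mat[of ?e 1 1 D n n]
    by (simp add: E_def)
  have QT: "transpose_mat Q = four_block_mat (1\<^sub>m 1) (0\<^sub>m 1 n) (0\<^sub>m n 1) (transpose_mat P)"
    unfolding Q_def using P by (subst transpose_four_block_mat[of _ 1 1 _ n _ n]) auto
  have QQ: "transpose_mat Q * Q = 1\<^sub>m ?N"
    unfolding QT unfolding Q_def using P PP
    by (subst mult_four_block_mat[of _ 1 1 _ n _ n _ _ 1 _ n]) auto
  have "B * Q = four_block_mat ?e (0\<^sub>m 1 n) (0\<^sub>m n 1) (C * P)"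
    unfolding Bblock Q_def using P C
    by (subst mult_four_block_mat[of _ 1 1 _ n _ n _ _ 1 _ n]) auto
  also have "\<dots> = Q * E" unfolding CP unfolding Q_def E_def using P D
    by (subst mult_four_block_mat[of _ 1 1 _ n _ n _ _ 1 _ n]) auto
  finally have BQ: "B * Q = Q * E" .
  have WB: "W * B = A * W"
  proof -
    have "W * B = (W * W) * (A * W)" unfolding B_def
      using W A by (simp add: assoc_mult_mat[of _ ?N ?N _ ?N _ ?N])
    then show ?thesis using WW W A by simp
  qed
  have "transpose_mat (W * Q) * (W * Q) = transpose_mat Q * ((W * W) * Q)"
    using W Q WT by (simp add: transpose_mult[of _ ?N ?N] assoc_mult_mat[of _ ?N ?N _ ?N _ ?N])
  then have 1: "transpose_mat (W * Q) * (W * Q) = 1\<^sub>m ?N" using WW QQ Q by simp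
  have "A * (W * Q) = (A * W) * Q" using W Q A by simp
  also have "\<dots> = W * (B * Q)" unfolding WB[symmetric] using W B Q by simp
  also have "\<dots> = (W * Q) * E" unfolding BQ using W Q E by simp
  finally have 2: "A * (W * Q) = (W * Q) * E" .
  have "diagonal_mat E" using dD D unfolding E_def diagonal_mat_def by auto
  with 1 2 W Q E show ?case by (intro exI[of _ "W * Q"] exI[of _ E]) auto
qed

text \<open>
  Symmetric matrices indexed by \<open>{..<n}\<close>, as functions; values at other indices are irrelevant.
\<close>

definition sym_mat :: "nat \<Rightarrow> (nat \<Rightarrow> nat \<Rightarrow> real) \<Rightarrow> bool" where
  "sym_mat n A \<longleftrightarrow> (\<forall>i<n. \<forall>j<n. A i j = A j i)"

text \<open>
  Orthonormal eigenvectors \<open>b k\<close> and eigenvalues \<open>e k\<close>; the multiset of the latter consists of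
  the roots of the characteristic polynomial.
\<close>

theorem spectral_theorem:
  assumes s: "sym_mat n A"
  shows "\<exists>b e. (\<forall>k l. k < n \<longrightarrow> l < n \<longrightarrow> (\<Sum>i<n. b k i * b l i) = (if k = l then 1 else 0)) \<and>
    (\<forall>i j. i < n \<longrightarrow> j < n \<longrightarrow> A i j = (\<Sum>k<n. e k * (b k i * b k j))) \<and>
    eigenvalues_mset (mat n n (\<lambda>(i,j). A i j)) = image_mset e (mset_set {..<n})"
proof -
  define M where "M = mat n n (\<lambda>(i,j). A i j)"
  have M: "M \<in> carrier_mat n n" by (simp add: M_def)
  have MT: "transpose_mat M = M" by (rule eq_matI) (use s in \<open>auto simp: M_def sym_mat_def\<close>)
  obtain P D where P: "P \<in> carrier_mat n n" and D: "D \<in> carrier_mat n n" and dD: "diagonal_mat D"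
    and PP: "transpose_mat P * P = 1\<^sub>m n" and MP: "M * P = P * D"
    using symmetric_real_mat_diagonalizable[OF M MT] by blast
  have PT: "transpose_mat P \<in> carrier_mat n n" using P by simp
  have PP': "P * transpose_mat P = 1\<^sub>m n" by (rule mat_mult_left_right_inverse[OF PT P PP])
  have "M = M * (P * transpose_mat P)" using M PP' by simp
  also have "\<dots> = (M * P) * transpose_mat P" using M P by simp
  finally have MD: "M = P * D * transpose_mat P" unfolding MP .
  define b where "b k i = P $$ (i,k)" for k i
  define e where "e k = D $$ (k,k)" for k
  have "similar_mat M D" using M D P PT PP PP' MD
    by (intro similar_matI[of _ _ P "transpose_mat P" n]) auto
  then have "char_poly M = char_poly D" by (rule char_poly_similar)
  also have "\<dots> = (\<Prod>a\<leftarrow>diag_mat D. [:- a, 1:])"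
    using D dD by (intro char_poly_upper_triangular[of _ n]) (auto simp: diagonal_mat_def upper_triangular_def)
  finally have "eigenvalues_mset M = mset (diag_mat D)"
    unfolding eigenvalues_mset_def by (simp add: proots_prod_linear_factors)
  then have ev: "eigenvalues_mset M = image_mset e (mset_set {..<n})"
    using D by (simp add: diag_mat_def e_def[abs_def] atLeast0LessThan)
  have 1: "(\<Sum>i<n. b k i * b l i) = (if k = l then 1 else 0)" if "k < n" "l < n" for k l
    using arg_cong[OF PP, of "\<lambda>X. X $$ (k,l)"] that P
    by (simp add: b_def scalar_prod_def atLeast0LessThan)
  have 2: "A i j = (\<Sum>k<n. e k * (b k i * b k j))" if ij: "i < n" "j < n" for i j
  proof -
    have "A i j = (P * D * transpose_mat P) $$ (i,j)" using MD ij by (simp add: M_def flip: MD)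
    also have "\<dots> = (\<Sum>k<n. (P * D) $$ (i,k) * P $$ (j,k))"
      using ij P D by (subst index_mult_mat) (auto simp: scalar_prod_def atLeast0LessThan simp del: assoc_mult_mat)
    also have "\<dots> = (\<Sum>k<n. (\<Sum>l<n. P $$ (i,l) * D $$ (l,k)) * P $$ (j,k))"
      using ij P D by (simp add: scalar_prod_def atLeast0LessThan)
    also have "\<dots> = (\<Sum>k<n. e k * (b k i * b k j))"
    proof (rule sum.cong)
      fix k assume k: "k \<in> {..<n}"
      have "(\<Sum>l<n. P $$ (i,l) * D $$ (l,k)) = (\<Sum>l<n. if l = k then P $$ (i,l) * D $$ (l,k) else 0)"
        using k D dD by (intro sum.cong) (auto simp: diagonal_mat_def)
      then show "(\<Sum>l<n. P $$ (i,l) * D $$ (l,k)) * P $$ (j,k) = e k * (b k i * b k j)"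
        using k by (simp add: b_def e_def)
    qed simp
    finally show ?thesis .
  qed
  show ?thesis using 1 2 ev[unfolded M_def] by blast
qed

section \<open>Lorentz forms\<close>

text \<open>
  The bilinear form of a matrix, for vectors indexed by \<open>{..<n}\<close>.
\<close>

definition bform :: "nat \<Rightarrow> (nat \<Rightarrow> nat \<Rightarrow> real) \<Rightarrow> (nat \<Rightarrow> real) \<Rightarrow> (nat \<Rightarrow> real) \<Rightarrow> real" where
  "bform n A x y = (\<Sum>i<n. \<Sum>j<n. A i j * x i * y j)"

text \<open>
  The reversed Cauchy-Schwarz inequality. For symmetric \<open>A\<close> it means that the form is not positive
  definite on any plane, i.e. that \<open>A\<close> has at most one positive eigenvalue; in particular negative
  semidefinite forms are included.
\<close>

definition lorentz_form :: "nat \<Rightarrow> (nat \<Rightarrow> nat \<Rightarrow> real) \<Rightarrow> bool" where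
  "lorentz_form n A \<longleftrightarrow> (\<forall>x y. bform n A y y > 0 \<longrightarrow> bform n A x x * bform n A y y \<le> (bform n A x y)\<^sup>2)"

lemma bform_add_left: "bform n A (\<lambda>i. x i + y i) z = bform n A x z + bform n A y z"
  by (simp add: bform_def algebra_simps sum.distrib)

lemma bform_add_right: "bform n A z (\<lambda>i. x i + y i) = bform n A z x + bform n A z y"
  by (simp add: bform_def algebra_simps sum.distrib)

lemma bform_scale_left: "bform n A (\<lambda>i. c * x i) z = c * bform n A x z"
  by (simp add: bform_def sum_distrib_left mult_ac)

lemma bform_scale_right: "bform n A z (\<lambda>i. c * x i) = c * bform n A z x"
  by (simp add: bform_def sum_distrib_left mult_ac)

lemma bform_commute: "sym_mat n A \<Longrightarrow> bform n A x y = bform n A y x"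
proof -
  assume s: "sym_mat n A"
  have "bform n A x y = (\<Sum>j<n. \<Sum>i<n. A i j * x i * y j)"
    unfolding bform_def by (rule sum.swap)
  also have "\<dots> = bform n A y x" unfolding bform_def
    using s by (intro sum.cong) (auto simp: sym_mat_def)
  finally show ?thesis .
qed

lemma bform_cong:
  "(\<And>i j. i < n \<Longrightarrow> j < n \<Longrightarrow> A i j = B i j) \<Longrightarrow> (\<And>i. i < n \<Longrightarrow> x i = x' i) \<Longrightarrow>
   (\<And>i. i < n \<Longrightarrow> y i = y' i) \<Longrightarrow> bform n A x y = bform n B x' y'"
  unfolding bform_def by (intro sum.cong) auto

lemma bform_eq_sum: "bform n A x y = (\<Sum>i<n. x i * (\<Sum>j<n. A i j * y j))"
  unfolding bform_def by (simp add: sum_distrib_left mult_ac)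

lemma lorentz_form_cong:
  assumes "\<And>i j. i < n \<Longrightarrow> j < n \<Longrightarrow> A i j = B i j"
  shows "lorentz_form n A = lorentz_form n B"
proof -
  have "bform n A = bform n B" using assms by (intro ext bform_cong) auto
  then show ?thesis by (simp add: lorentz_form_def)
qed

lemma bform_lincomb:
  assumes "sym_mat n A"
  shows "bform n A (\<lambda>i. a * x i + b * y i) (\<lambda>i. a * x i + b * y i)
    = a\<^sup>2 * bform n A x x + 2 * a * b * bform n A x y + b\<^sup>2 * bform n A y y"
  using bform_commute[OF assms, of x y]
  by (simp add: bform_add_left bform_add_right bform_scale_left bform_scale_right power2_eq_square algebra_simps)

text \<open>
  A form that is nonpositive on a hyperplane is Lorentz, since every plane meets the hyperplane.
\<close>

lemma lorentz_formI:
  assumes s: "sym_mat n A"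
    and neg: "\<And>x. (\<Sum>i<n. u i * x i) = 0 \<Longrightarrow> bform n A x x \<le> 0"
  shows "lorentz_form n A"
  unfolding lorentz_form_def
proof (intro allI impI)
  fix x y assume y: "bform n A y y > 0"
  \<comment> \<open>\<open>b x - a y\<close> lies in the hyperplane\<close>
  define b where "b = (\<Sum>i<n. u i * y i)"
  define a where "a = (\<Sum>i<n. u i * x i)"
  have b0: "b \<noteq> 0" using neg[of y] y by (auto simp: b_def)
  have "(\<Sum>i<n. u i * (b * x i + (-a) * y i)) = b * a + (-a) * b"
  proof -
    have "(\<Sum>i<n. u i * (b * x i + (-a) * y i)) = (\<Sum>i<n. b * (u i * x i) + (-a) * (u i * y i))"
      by (intro sum.cong) (auto simp: algebra_simps)
    also have "\<dots> = b * (\<Sum>i<n. u i * x i) + (-a) * (\<Sum>i<n. u i * y i)"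
      unfolding sum.distrib sum_distrib_left ..
    finally show ?thesis unfolding a_def b_def .
  qed
  then have "bform n A (\<lambda>i. b * x i + (-a) * y i) (\<lambda>i. b * x i + (-a) * y i) \<le> 0"
    by (intro neg) simp
  then have "b\<^sup>2 * bform n A x x - 2 * b * a * bform n A x y + a\<^sup>2 * bform n A y y \<le> 0"
    by (subst (asm) bform_lincomb[OF s]) simp
  then have "bform n A y y * (b\<^sup>2 * bform n A x x - 2 * b * a * bform n A x y + a\<^sup>2 * bform n A y y) \<le> 0"
    using y by (simp add: mult_nonneg_nonpos)
  moreover have "bform n A y y * (b\<^sup>2 * bform n A x x - 2 * b * a * bform n A x y + a\<^sup>2 * bform n A y y)
     = (a * bform n A y y - b * bform n A x y)\<^sup>2 + b\<^sup>2 * (bform n A x x * bform n A y y - (bform n A x y)\<^sup>2)"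
    by (simp add: power2_eq_square algebra_simps)
  ultimately have "b\<^sup>2 * (bform n A x x * bform n A y y - (bform n A x y)\<^sup>2) \<le> 0"
    using zero_le_power2[of "a * bform n A y y - b * bform n A x y"] by linarith
  then show "bform n A x x * bform n A y y \<le> (bform n A x y)\<^sup>2"
    using b0 by (simp add: mult_le_0_iff)
qed

lemma lorentz_formD:
  assumes "lorentz_form n A" "bform n A y y > 0" "bform n A x y = 0"
  shows "bform n A x x \<le> 0"
proof -
  have "bform n A x x * bform n A y y \<le> (bform n A x y)\<^sup>2"
    using assms unfolding lorentz_form_def by blast
  then have "bform n A x x * bform n A y y \<le> 0" using assms(3) by simp
  then show ?thesis using assms(2) by (simp add: mult_le_0_iff)
qed

lemma lorentz_form_minus_diag:
  assumes s: "sym_mat n A" and l: "lorentz_form n A" and D: "\<And>i. i < n \<Longrightarrow> D i \<ge> 0"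
    and B: "\<And>i j. i < n \<Longrightarrow> j < n \<Longrightarrow> B i j = A i j - (if i = j then D i else 0)"
  shows "lorentz_form n B"
proof -
  have Bf: "bform n B x x = bform n A x x - (\<Sum>i<n. D i * (x i)\<^sup>2)" for x
  proof -
    have "bform n B x x = (\<Sum>i<n. \<Sum>j<n. A i j * x i * x j - (if i = j then D i * (x i)\<^sup>2 else 0))"
      unfolding bform_def by (intro sum.cong) (auto simp: B algebra_simps power2_eq_square)
    also have "\<dots> = bform n A x x - (\<Sum>i<n. D i * (x i)\<^sup>2)"
      unfolding bform_def by (simp add: sum_subtractf)
    finally show ?thesis .
  qed
  have le: "bform n B x x \<le> bform n A x x" for x
    unfolding Bf using D sum_nonneg[of "{..<n}" "\<lambda>i. D i * (x i)\<^sup>2"] by simp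
  have sB: "sym_mat n B" using s B unfolding sym_mat_def by auto
  show ?thesis
  proof (cases "\<exists>y. bform n A y y > 0")
    case True
    then obtain y where y: "bform n A y y > 0" by auto
    show ?thesis
    proof (rule lorentz_formI[OF sB, of "\<lambda>i. \<Sum>j<n. A i j * y j"])
      fix x assume "(\<Sum>i<n. (\<Sum>j<n. A i j * y j) * x i) = 0"
      then have "bform n A x y = 0" by (simp add: bform_eq_sum mult.commute)
      from lorentz_formD[OF l y this] show "bform n B x x \<le> 0" using le[of x] by simp
    qed
  next
    case False
    then have "bform n B x x \<le> 0" for x using le[of x] by (meson not_le order_trans)
    then show ?thesis unfolding lorentz_form_def by (meson not_le)
  qed
qed

lemma bform_congruence:
  "bform n (\<lambda>i j. \<Sum>k<m. \<Sum>l<m. V i k * V j l * H k l) x y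
   = bform m H (\<lambda>k. \<Sum>i<n. V i k * x i) (\<lambda>l. \<Sum>j<n. V j l * y j)"
proof -
  have "bform m H (\<lambda>k. \<Sum>i<n. V i k * x i) (\<lambda>l. \<Sum>j<n. V j l * y j)
     = (\<Sum>k<m. \<Sum>l<m. \<Sum>i<n. \<Sum>j<n. V i k * V j l * H k l * x i * y j)"
    unfolding bform_def
    by (intro sum.cong refl) (simp add: sum_distrib_left sum_distrib_right mult_ac)
  also have "\<dots> = (\<Sum>k<m. \<Sum>i<n. \<Sum>l<m. \<Sum>j<n. V i k * V j l * H k l * x i * y j)"
    by (intro sum.cong refl sum.swap)
  also have "\<dots> = (\<Sum>i<n. \<Sum>k<m. \<Sum>l<m. \<Sum>j<n. V i k * V j l * H k l * x i * y j)"
    by (rule sum.swap)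
  also have "\<dots> = (\<Sum>i<n. \<Sum>k<m. \<Sum>j<n. \<Sum>l<m. V i k * V j l * H k l * x i * y j)"
    by (intro sum.cong refl sum.swap)
  also have "\<dots> = (\<Sum>i<n. \<Sum>j<n. \<Sum>k<m. \<Sum>l<m. V i k * V j l * H k l * x i * y j)"
    by (intro sum.cong refl sum.swap)
  also have "\<dots> = bform n (\<lambda>i j. \<Sum>k<m. \<Sum>l<m. V i k * V j l * H k l) x y"
    unfolding bform_def by (simp add: sum_distrib_right)
  finally show ?thesis by simp
qed

text \<open>
  Linear substitutions preserve Lorentz forms; \<open>V i\<close> is the image of the \<open>i\<close>-th unit vector.
\<close>

lemma lorentz_form_congruence:
  assumes "lorentz_form m H"
  shows "lorentz_form n (\<lambda>i j. \<Sum>k<m. \<Sum>l<m. V i k * V j l * H k l)"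
  using assms unfolding lorentz_form_def bform_congruence by blast

lemma lorentz_form_limit:
  assumes l: "\<And>k. lorentz_form n (A k)"
    and lim: "\<And>i j. i < n \<Longrightarrow> j < n \<Longrightarrow> (\<lambda>k. A k i j) \<longlonglongrightarrow> B i j"
  shows "lorentz_form n B"
  unfolding lorentz_form_def
proof (intro allI impI)
  fix x y assume y: "bform n B y y > 0"
  have lim': "(\<lambda>k. bform n (A k) x y) \<longlonglongrightarrow> bform n B x y" for x y
    unfolding bform_def using lim by (intro tendsto_intros) auto
  have ev: "\<forall>\<^sub>F k in sequentially. bform n (A k) y y > 0"
    using order_tendstoD(1)[OF lim' y] .
  show "bform n B x x * bform n B y y \<le> (bform n B x y)\<^sup>2"
  proof (rule tendsto_le[OF _ _ _ eventually_mono[OF ev]])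
    show "(\<lambda>k. bform n (A k) x x * bform n (A k) y y) \<longlonglongrightarrow> bform n B x x * bform n B y y"
      by (intro tendsto_intros lim')
    show "(\<lambda>k. (bform n (A k) x y)\<^sup>2) \<longlonglongrightarrow> (bform n B x y)\<^sup>2"
      by (intro tendsto_intros lim')
  qed (use l in \<open>auto simp: lorentz_form_def\<close>)
qed

section \<open>Eigenvalue counts and Hessians of cubic forms\<close>

lemma bform_spectral:
  assumes "\<And>i j. i < n \<Longrightarrow> j < n \<Longrightarrow> A i j = (\<Sum>k<n. e k * (b k i * b k j))"
  shows "bform n A x y = (\<Sum>k<n. e k * ((\<Sum>i<n. b k i * x i) * (\<Sum>i<n. b k i * y i)))"
proof -
  have "bform n A x y = (\<Sum>i<n. \<Sum>j<n. \<Sum>k<n. e k * (b k i * x i) * (b k j * y j))"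
    unfolding bform_def by (intro sum.cong) (auto simp: assms sum_distrib_right sum_distrib_left mult_ac)
  also have "\<dots> = (\<Sum>i<n. \<Sum>k<n. \<Sum>j<n. e k * (b k i * x i) * (b k j * y j))"
    by (intro sum.cong refl sum.swap)
  also have "\<dots> = (\<Sum>k<n. \<Sum>i<n. \<Sum>j<n. e k * (b k i * x i) * (b k j * y j))"
    by (rule sum.swap)
  also have "\<dots> = (\<Sum>k<n. e k * ((\<Sum>i<n. b k i * x i) * (\<Sum>i<n. b k i * y i)))"
    unfolding sum_product by (simp add: sum_distrib_left mult_ac)
  finally show ?thesis .
qed

lemma size_filter_image_mset_set:
  "size (filter_mset P (image_mset e (mset_set {..<n::nat}))) = card {k. k < n \<and> P (e k)}"
proof -
  have "{k. k < n \<and> P (e k)} = {x \<in> {..<n}. P (e x)}" by auto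
  then show ?thesis by (simp add: filter_mset_image_mset)
qed

lemma eigenvalue_count_imp_lorentz_form:
  assumes s: "sym_mat n A"
    and c: "size (filter_mset (\<lambda>x. x > 0) (eigenvalues_mset (mat n n (\<lambda>(i,j). A i j)))) = 1"
  shows "lorentz_form n A"
proof -
  obtain b e where
        o: "\<And>k l. k < n \<Longrightarrow> l < n \<Longrightarrow> (\<Sum>i<n. b k i * b l i) = (if k = l then 1 else 0)"
    and A: "\<And>i j. i < n \<Longrightarrow> j < n \<Longrightarrow> A i j = (\<Sum>k<n. e k * (b k i * b k j))"
    and ev: "eigenvalues_mset (mat n n (\<lambda>(i,j). A i j)) = image_mset e (mset_set {..<n})"
    using spectral_theorem[OF s] by blast
  have sp: "bform n A x y = (\<Sum>k<n. e k * ((\<Sum>i<n. b k i * x i) * (\<Sum>i<n. b k i * y i)))" for x y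
    by (rule bform_spectral) (rule A)
  have "card {k. k < n \<and> e k > 0} = 1" using c unfolding ev size_filter_image_mset_set .
  then obtain p where p: "{k. k < n \<and> e k > 0} = {p}" using card_1_singletonE by blast
  show ?thesis
  proof (rule lorentz_formI[OF s, of "b p"])
    fix x assume x: "(\<Sum>i<n. b p i * x i) = 0"
    have "e k * ((\<Sum>i<n. b k i * x i) * (\<Sum>i<n. b k i * x i)) \<le> 0" if "k < n" for k
    proof (cases "k = p")
      case False
      then have "e k \<le> 0" using p that by (metis (mono_tags, lifting) mem_Collect_eq not_le singletonD)
      then show ?thesis by (simp add: mult_nonpos_nonneg)
    qed (use x in simp)
    then show "bform n A x x \<le> 0" unfolding sp by (intro sum_nonpos) auto
  qed
qed

text \<open>
  The converse direction needs strictness: the form is negative definite on a hyperplane and takes a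
  positive value.
\<close>

lemma negative_definite_imp_eigenvalue_count:
  assumes s: "sym_mat n A"
    and neg: "\<And>x. (\<Sum>i<n. u i * x i) = 0 \<Longrightarrow> \<exists>i<n. x i \<noteq> 0 \<Longrightarrow> bform n A x x < 0"
    and pos: "bform n A y y > 0"
  shows "size (filter_mset (\<lambda>x. x > 0) (eigenvalues_mset (mat n n (\<lambda>(i,j). A i j)))) = 1"
    and "size (filter_mset (\<lambda>x. x < 0) (eigenvalues_mset (mat n n (\<lambda>(i,j). A i j)))) = n - 1"
proof -
  obtain b e where
        o: "\<And>k l. k < n \<Longrightarrow> l < n \<Longrightarrow> (\<Sum>i<n. b k i * b l i) = (if k = l then 1 else 0)"
    and A: "\<And>i j. i < n \<Longrightarrow> j < n \<Longrightarrow> A i j = (\<Sum>k<n. e k * (b k i * b k j))"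
    and ev: "eigenvalues_mset (mat n n (\<lambda>(i,j). A i j)) = image_mset e (mset_set {..<n})"
    using spectral_theorem[OF s] by blast
  have sp: "bform n A x y = (\<Sum>k<n. e k * ((\<Sum>i<n. b k i * x i) * (\<Sum>i<n. b k i * y i)))" for x y
    by (rule bform_spectral) (rule A)
  have bb: "bform n A (b k) (b l) = (if k = l then e k else 0)" if "k < n" "l < n" for k l
  proof -
    have "bform n A (b k) (b l) = (\<Sum>j<n. if j = k then (if k = l then e k else 0) else 0)"
      unfolding sp using that by (intro sum.cong) (auto simp: o)
    then show ?thesis using that by simp
  qed
  have "\<exists>p<n. e p > 0"
  proof (rule ccontr)
    assume "\<not> (\<exists>p<n. e p > 0)"
    then have "e k \<le> 0" if "k < n" for k using that by (meson not_le)
    then have "bform n A y y \<le> 0" unfolding sp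
      by (intro sum_nonpos) (auto simp: mult_nonpos_nonneg)
    then show False using pos by simp
  qed
  then obtain p where p: "p < n" "e p > 0" by blast
  have le: "e k < 0" if k: "k < n" "k \<noteq> p" for k
  proof (rule ccontr)
    assume "\<not> e k < 0"
    then have ek: "e k \<ge> 0" by simp
    define c where "c = (\<Sum>i<n. u i * b k i)"
    define d where "d = (\<Sum>i<n. u i * b p i)"
    have nz: "\<exists>i<n. x i \<noteq> 0" if "(\<Sum>i<n. b l i * x i) \<noteq> 0" for x l
      using that by (metis (no_types, lifting) lessThan_iff mult_zero_right sum.neutral)
    have d0: "d \<noteq> 0"
    proof
      assume "d = 0"
      moreover have "\<exists>i<n. b p i \<noteq> 0" using nz[of p "b p"] o[of p p] p by simp
      ultimately show False using neg[of "b p"] bb[of p p] p by (simp add: d_def)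
    qed
    \<comment> \<open>a vector of the hyperplane on which two nonnegative eigenvalues would make the form
      nonnegative\<close>
    let ?z = "\<lambda>i. c * b p i + (-d) * b k i"
    have "(\<Sum>i<n. u i * ?z i) = (\<Sum>i<n. c * (u i * b p i) + (-d) * (u i * b k i))"
      by (intro sum.cong) (auto simp: algebra_simps)
    also have "\<dots> = c * (\<Sum>i<n. u i * b p i) + (-d) * (\<Sum>i<n. u i * b k i)"
      unfolding sum.distrib sum_distrib_left ..
    finally have 1: "(\<Sum>i<n. u i * ?z i) = 0" by (simp add: c_def d_def)
    have "(\<Sum>i<n. b k i * ?z i) = (\<Sum>i<n. c * (b k i * b p i) + (-d) * (b k i * b k i))"
      by (intro sum.cong) (auto simp: algebra_simps)
    also have "\<dots> = c * (\<Sum>i<n. b k i * b p i) + (-d) * (\<Sum>i<n. b k i * b k i)"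
      unfolding sum.distrib sum_distrib_left ..
    also have "\<dots> = - d" using k p by (simp add: o)
    finally have "\<exists>i<n. ?z i \<noteq> 0" using d0 by (intro nz[of k]) simp
    from neg[OF 1 this] have "c\<^sup>2 * e p + d\<^sup>2 * e k < 0"
      by (subst (asm) bform_lincomb[OF s]) (use k p in \<open>simp add: bb\<close>)
    moreover have "c\<^sup>2 * e p + d\<^sup>2 * e k \<ge> 0" using p ek by simp
    ultimately show False by simp
  qed
  have "{k. k < n \<and> e k > 0} = {p}" using p le by force
  then show "size (filter_mset (\<lambda>x. x > 0) (eigenvalues_mset (mat n n (\<lambda>(i,j). A i j)))) = 1"
    unfolding ev size_filter_image_mset_set by simp
  have "{k. k < n \<and> e k < 0} = {..<n} - {p}" using p le by auto
  then show "size (filter_mset (\<lambda>x. x < 0) (eigenvalues_mset (mat n n (\<lambda>(i,j). A i j)))) = n - 1"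
    unfolding ev size_filter_image_mset_set using p by simp
qed

lemma laplacian_identity:
  assumes "sym_mat n G"
  shows "(\<Sum>i<n. \<Sum>j<n. G i j * (v i * v j) * (z i - z j)\<^sup>2)
    = 2 * (\<Sum>i<n. (\<Sum>j<n. G i j * v j) * v i * (z i)\<^sup>2)
      - 2 * bform n G (\<lambda>i. v i * z i) (\<lambda>i. v i * z i)"
proof -
  have "(\<Sum>i<n. \<Sum>j<n. G i j * (v i * v j) * (z i - z j)\<^sup>2)
     = (\<Sum>i<n. \<Sum>j<n. G i j * v j * v i * (z i)\<^sup>2 + G i j * v i * v j * (z j)\<^sup>2
          - 2 * (G i j * (v i * z i) * (v j * z j)))"
    by (intro sum.cong) (auto simp: power2_eq_square algebra_simps)
  also have "\<dots> = (\<Sum>i<n. \<Sum>j<n. G i j * v j * v i * (z i)\<^sup>2)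
      + (\<Sum>i<n. \<Sum>j<n. G i j * v i * v j * (z j)\<^sup>2) - 2 * bform n G (\<lambda>i. v i * z i) (\<lambda>i. v i * z i)"
    by (simp add: sum.distrib sum_subtractf bform_def sum_distrib_left)
  also have "(\<Sum>i<n. \<Sum>j<n. G i j * v i * v j * (z j)\<^sup>2) = (\<Sum>j<n. \<Sum>i<n. G i j * v i * v j * (z j)\<^sup>2)"
    by (rule sum.swap)
  also have "\<dots> = (\<Sum>i<n. \<Sum>j<n. G i j * v j * v i * (z i)\<^sup>2)"
    using assms by (intro sum.cong) (auto simp: sym_mat_def)
  finally show ?thesis by (simp add: sum_distrib_right)
qed

text \<open>
  With \<open>r\<^sub>i = (Gv)\<^sub>i\<close>, conjugating \<open>G\<close> by the diagonal matrix \<open>\<sigma>\<^sub>i = sqrt (v\<^sub>i / r\<^sub>i)\<close> gives a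
  symmetric matrix \<open>S\<close> with \<open>S u = u\<close>, where \<open>u\<^sub>i = sqrt (v\<^sub>i r\<^sub>i)\<close>. The hypothesis on \<open>bform\<close> says
  \<open>y\<^sup>TSy \<le> |Sy|\<^sup>2\<close>, so an eigenvalue is nonpositive or at least \<open>1\<close>. The Laplacian identity and
  connectedness show that an eigenvector for an eigenvalue at least \<open>1\<close> is a multiple of \<open>u\<close>. Hence
  \<open>S\<close> is nonpositive on the orthogonal complement of \<open>u\<close>. Indices with \<open>r\<^sub>i = 0\<close> have zero rows; there
  \<open>\<sigma>\<^sub>i = u\<^sub>i = 0\<close>.
\<close>

lemma lorentz_form_bochner:
  assumes s: "sym_mat n G" and nn: "\<And>i j. i < n \<Longrightarrow> j < n \<Longrightarrow> G i j \<ge> 0"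
    and v: "\<And>i. i < n \<Longrightarrow> v i > 0"
    and bo: "\<And>x. bform n G x x \<le> (\<Sum>i<n. v i * ((\<Sum>j<n. G i j * x j)\<^sup>2 / (\<Sum>j<n. G i j * v j)))"
    and conn: "\<And>S i0 i1 j0 j1. \<lbrakk>i0 < n; i1 < n; j0 < n; j1 < n; G i0 j0 > 0; G i1 j1 > 0; i0 \<in> S; i1 \<notin> S\<rbrakk>
       \<Longrightarrow> \<exists>i<n. \<exists>j<n. i \<in> S \<and> j \<notin> S \<and> G i j > 0"
  shows "lorentz_form n G"
proof -
  define r where "r i = (\<Sum>j<n. G i j * v j)" for i
  have r0: "r i \<ge> 0" if "i < n" for i
    unfolding r_def using nn v that by (intro sum_nonneg) (auto simp: less_imp_le)
  have Gr: "G i j = 0" if "i < n" "j < n" "r i = 0" for i j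
  proof -
    have "\<forall>j\<in>{..<n}. G i j * v j = 0"
      using that(3) unfolding r_def using nn v that
      by (subst (asm) sum_nonneg_eq_0_iff) (auto simp: less_imp_le)
    then show ?thesis using v[of j] that by fastforce
  qed
  define \<sigma> where "\<sigma> i = sqrt (v i / r i)" for i
  define u where "u i = sqrt (v i * r i)" for i
  define S where "S i j = \<sigma> i * G i j * \<sigma> j" for i j
  have \<sigma>pos: "\<sigma> i > 0" if "i < n" "r i \<noteq> 0" for i
    using that r0[of i] v[of i] by (simp add: \<sigma>_def)
  have sS: "sym_mat n S" using s by (auto simp: sym_mat_def S_def)
  have bS: "bform n S y y = bform n G (\<lambda>i. \<sigma> i * y i) (\<lambda>i. \<sigma> i * y i)" for y
    unfolding bform_def S_def by (intro sum.cong) (auto simp: mult_ac)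
  have Sy: "(\<Sum>j<n. S i j * y j) = \<sigma> i * (\<Sum>j<n. G i j * (\<sigma> j * y j))" for i y
    unfolding S_def by (simp add: sum_distrib_left mult_ac)
  have up1: "bform n S y y \<le> (\<Sum>i<n. (\<Sum>j<n. S i j * y j)\<^sup>2)" for y
  proof -
    have "bform n S y y \<le> (\<Sum>i<n. v i * ((\<Sum>j<n. G i j * (\<sigma> j * y j))\<^sup>2 / r i))"
      unfolding bS r_def by (rule bo)
    also have "\<dots> = (\<Sum>i<n. (\<Sum>j<n. S i j * y j)\<^sup>2)"
      unfolding Sy using r0 v
      by (intro sum.cong) (auto simp: power_mult_distrib \<sigma>_def less_imp_le)
    finally show ?thesis .
  qed
  obtain b e where
        o: "\<And>k l. k < n \<Longrightarrow> l < n \<Longrightarrow> (\<Sum>i<n. b k i * b l i) = (if k = l then 1 else 0)"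
    and A: "\<And>i j. i < n \<Longrightarrow> j < n \<Longrightarrow> S i j = (\<Sum>k<n. e k * (b k i * b k j))"
    and "eigenvalues_mset (mat n n (\<lambda>(i,j). S i j)) = image_mset e (mset_set {..<n})"
    using spectral_theorem[OF sS] by blast
  have sp: "bform n S x y = (\<Sum>k<n. e k * ((\<Sum>i<n. b k i * x i) * (\<Sum>i<n. b k i * y i)))" for x y
    by (rule bform_spectral) (rule A)
  have eig: "(\<Sum>j<n. S i j * b k j) = e k * b k i" if "i < n" "k < n" for i k
  proof -
    have "(\<Sum>j<n. S i j * b k j) = (\<Sum>j<n. \<Sum>l<n. e l * b l i * (b l j * b k j))"
      by (intro sum.cong refl) (use that in \<open>auto simp: A sum_distrib_right sum_distrib_left mult_ac\<close>)
    also have "\<dots> = (\<Sum>l<n. e l * b l i * (\<Sum>j<n. b l j * b k j))"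
      by (subst sum.swap) (simp add: sum_distrib_left)
    also have "\<dots> = (\<Sum>l<n. if l = k then e k * b k i else 0)"
      using that by (intro sum.cong) (auto simp: o)
    finally show ?thesis using that by simp
  qed
  have key: "\<exists>c. \<forall>i<n. b k i = c * u i" if k: "k < n" and ek: "e k > 0" for k
  proof -
    let ?y = "b k"
    have yy: "(\<Sum>i<n. (?y i)\<^sup>2) = 1" using o[OF k k] by (simp add: power2_eq_square)
    have byy: "bform n S ?y ?y = e k"
    proof -
      have "bform n S ?y ?y = (\<Sum>i<n. e k * (?y i)\<^sup>2)" unfolding bform_eq_sum
        using k by (intro sum.cong) (auto simp: eig power2_eq_square)
      also have "\<dots> = e k" unfolding sum_distrib_left[symmetric] yy by simp
      finally show ?thesis .
    qed
    have "(\<Sum>i<n. (\<Sum>j<n. S i j * ?y j)\<^sup>2) = (\<Sum>i<n. (e k)\<^sup>2 * (?y i)\<^sup>2)"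
      using k by (intro sum.cong) (auto simp: eig power_mult_distrib)
    also have "\<dots> = (e k)\<^sup>2" unfolding sum_distrib_left[symmetric] yy by simp
    finally have "e k \<le> (e k)\<^sup>2" using up1[of ?y] byy by simp
    then have e1: "e k \<ge> 1" using ek by (simp add: power2_eq_square)
    have y0: "?y i = 0" if "i < n" "r i = 0" for i
    proof -
      have "(\<Sum>j<n. S i j * ?y j) = 0" unfolding Sy using Gr that by simp
      then show ?thesis using eig[OF that(1) k] ek by simp
    qed
    define z where "z i = \<sigma> i * ?y i / v i" for i
    have xz: "v i * z i = \<sigma> i * ?y i" if "i < n" for i using v[OF that] by (simp add: z_def)
    have "(\<Sum>i<n. r i * v i * (z i)\<^sup>2) = (\<Sum>i<n. (?y i)\<^sup>2)"
    proof (rule sum.cong)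
      fix i assume "i \<in> {..<n}"
      then have i: "i < n" by simp
      show "r i * v i * (z i)\<^sup>2 = (?y i)\<^sup>2"
      proof (cases "r i = 0")
        case False
        then have "(\<sigma> i)\<^sup>2 = v i / r i" using v[OF i] r0[OF i] by (simp add: \<sigma>_def)
        then show ?thesis using False v[OF i]
          by (simp add: z_def power_divide power_mult_distrib power2_eq_square field_simps)
      qed (use y0[OF i] in simp)
    qed simp
    then have eq1: "(\<Sum>i<n. (\<Sum>j<n. G i j * v j) * v i * (z i)\<^sup>2) = 1" using yy by (simp add: r_def)
    have "bform n G (\<lambda>i. v i * z i) (\<lambda>i. v i * z i) = e k"
      unfolding byy[symmetric] bS by (rule bform_cong) (auto simp: xz)
    then have L: "(\<Sum>i<n. \<Sum>j<n. G i j * (v i * v j) * (z i - z j)\<^sup>2) = 2 - 2 * e k"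
      unfolding laplacian_identity[OF s] eq1 by simp
    have t0: "G i j * (v i * v j) * (z i - z j)\<^sup>2 \<ge> 0" if "i < n" "j < n" for i j
      using nn[OF that] v[OF that(1)] v[OF that(2)] by simp
    have "(\<Sum>i<n. \<Sum>j<n. G i j * (v i * v j) * (z i - z j)\<^sup>2) \<ge> 0"
      using t0 by (intro sum_nonneg) auto
    then have "(\<Sum>i<n. \<Sum>j<n. G i j * (v i * v j) * (z i - z j)\<^sup>2) = 0" using L e1 by simp
    then have "\<forall>i\<in>{..<n}. (\<Sum>j<n. G i j * (v i * v j) * (z i - z j)\<^sup>2) = 0"
      using t0 by (subst (asm) sum_nonneg_eq_0_iff) (auto intro!: sum_nonneg)
    then have row: "(\<Sum>j<n. G i j * (v i * v j) * (z i - z j)\<^sup>2) = 0" if "i < n" for i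
      using that by simp
    have "G i j * (v i * v j) * (z i - z j)\<^sup>2 = 0" if "i < n" "j < n" for i j
      using row[OF that(1)] t0[OF that(1)] that(2) by (subst (asm) sum_nonneg_eq_0_iff) auto
    then have zz: "z i = z j" if "i < n" "j < n" "G i j > 0" for i j
      using v that by (fastforce simp: less_le)
    have act: "\<exists>j<n. G i j > 0" if "i < n" "r i \<noteq> 0" for i
    proof (rule ccontr)
      assume "\<not> (\<exists>j<n. G i j > 0)"
      then have "\<forall>j<n. G i j = 0" using nn[OF that(1)] by (force simp: less_eq_real_def)
      then have "r i = 0" by (simp add: r_def)
      then show False using that by simp
    qed
    have zc: "z i0 = z i1" if i: "i0 < n" "r i0 \<noteq> 0" "i1 < n" "r i1 \<noteq> 0" for i0 i1
    proof (rule ccontr)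
      assume ne: "z i0 \<noteq> z i1"
      obtain j0 where j0: "j0 < n" "G i0 j0 > 0" using act i by blast
      obtain j1 where j1: "j1 < n" "G i1 j1 > 0" using act i by blast
      have "\<exists>i<n. \<exists>j<n. i \<in> {i. z i = z i0} \<and> j \<notin> {i. z i = z i0} \<and> G i j > 0"
        by (rule conn[OF i(1) i(3) j0(1) j1(1) j0(2) j1(2)]) (use ne in auto)
      then show False using zz by auto
    qed
    have yz: "?y i = z i * u i" if "i < n" for i
    proof (cases "r i = 0")
      case False
      then have rp: "r i > 0" using r0[OF that] by simp
      have "u i * \<sigma> i = v i" using rp v[OF that] unfolding u_def \<sigma>_def
        by (simp flip: real_sqrt_mult)
      then show ?thesis using v[OF that] by (simp add: z_def field_simps)
    qed (use y0[OF that] in \<open>simp add: u_def\<close>)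
    show ?thesis
    proof (cases "\<exists>i<n. r i \<noteq> 0")
      case True
      then obtain i0 where i0: "i0 < n" "r i0 \<noteq> 0" by auto
      have "?y i = z i0 * u i" if "i < n" for i
        using yz[OF that] zc[OF that _ i0] by (cases "r i = 0") (auto simp: u_def)
      then show ?thesis by blast
    next
      case False
      then show ?thesis using y0 by (intro exI[of _ 0]) auto
    qed
  qed
  have neg: "bform n S y y \<le> 0" if uy: "(\<Sum>i<n. u i * y i) = 0" for y
    unfolding sp
  proof (rule sum_nonpos)
    fix k assume "k \<in> {..<n}"
    then have k: "k < n" by simp
    show "e k * ((\<Sum>i<n. b k i * y i) * (\<Sum>i<n. b k i * y i)) \<le> 0"
    proof (cases "e k > 0")
      case True
      then obtain c where c: "\<forall>i<n. b k i = c * u i" using key[OF k] by blast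
      have "(\<Sum>i<n. b k i * y i) = c * (\<Sum>i<n. u i * y i)"
        unfolding sum_distrib_left using c by (intro sum.cong) auto
      then show ?thesis using uy by simp
    qed (simp add: mult_nonpos_nonneg)
  qed
  show ?thesis
  proof (rule lorentz_formI[OF s, of r])
    fix x assume x: "(\<Sum>i<n. r i * x i) = 0"
    define y where "y i = (if r i = 0 then 0 else x i / \<sigma> i)" for i
    have "(\<Sum>i<n. u i * y i) = (\<Sum>i<n. r i * x i)"
    proof (rule sum.cong)
      fix i assume "i \<in> {..<n}"
      then have i: "i < n" by simp
      show "u i * y i = r i * x i"
      proof (cases "r i = 0")
        case False
        then have rp: "r i > 0" using r0[OF i] by simp
        have "u i = r i * \<sigma> i"
          using v[OF i] rp unfolding u_def \<sigma>_def
          by (simp add: real_sqrt_mult real_sqrt_divide field_simps)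
        then show ?thesis using False \<sigma>pos[OF i] by (simp add: y_def)
      qed (simp add: y_def)
    qed simp
    then have "bform n S y y \<le> 0" using x by (intro neg) simp
    moreover have "bform n G x x = bform n S y y"
      unfolding bform_def S_def
    proof (intro sum.cong refl)
      fix i j assume "i \<in> {..<n}" "j \<in> {..<n}"
      then have ij: "i < n" "j < n" by auto
      show "G i j * x i * x j = \<sigma> i * G i j * \<sigma> j * y i * y j"
      proof (cases "r i = 0 \<or> r j = 0")
        case True
        then have "G i j = 0" using Gr ij s by (metis sym_mat_def)
        then show ?thesis by simp
      next
        case False
        then show ?thesis using \<sigma>pos[OF ij(1)] \<sigma>pos[OF ij(2)] by (simp add: y_def)
      qed
    qed
    ultimately show "bform n G x x \<le> 0" by simp
  qed
qed

text \<open>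
  \<open>T\<close> is the symmetric tensor of third derivatives of a cubic form \<open>g\<close> with nonnegative coefficients,
  and the conclusion concerns the Hessian of the derivative of \<open>g\<close> along a positive vector \<open>v\<close>. The last
  hypothesis expresses that the variables that occur in \<open>g\<close> are connected through its monomials.
\<close>

lemma lorentz_form_cubic:
  assumes sT: "\<And>i j k. i < n \<Longrightarrow> j < n \<Longrightarrow> k < n \<Longrightarrow> T i j k = T i k j"
    and sT': "\<And>i j k. i < n \<Longrightarrow> j < n \<Longrightarrow> k < n \<Longrightarrow> T i j k = T j i k"
    and nn: "\<And>i j k. i < n \<Longrightarrow> j < n \<Longrightarrow> k < n \<Longrightarrow> T i j k \<ge> 0"
    and l: "\<And>i. i < n \<Longrightarrow> lorentz_form n (T i)"
    and v: "\<And>i. i < n \<Longrightarrow> v i > 0"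
    and conn: "\<And>S i0 i1 j0 j1 k0 k1. \<lbrakk>i0 < n; i1 < n; j0 < n; j1 < n; k0 < n; k1 < n;
        T k0 i0 j0 > 0; T k1 i1 j1 > 0; i0 \<in> S; i1 \<notin> S\<rbrakk>
       \<Longrightarrow> \<exists>i<n. \<exists>j<n. \<exists>k<n. i \<in> S \<and> j \<notin> S \<and> T k i j > 0"
  shows "lorentz_form n (\<lambda>i j. \<Sum>k<n. v k * T k i j)"
proof -
  let ?G = "\<lambda>i j. \<Sum>k<n. v k * T k i j"
  have Gpos: "\<exists>k<n. T k i j > 0" if "?G i j > 0" "i < n" "j < n" for i j
  proof (rule ccontr)
    assume "\<not> (\<exists>k<n. T k i j > 0)"
    then have "T k i j \<le> 0" if "k < n" for k using that by (meson not_le)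
    then have "?G i j \<le> 0" using v by (intro sum_nonpos) (auto simp: mult_nonneg_nonpos less_imp_le)
    then show False using that by simp
  qed
  have Gpos': "?G i j > 0" if "T k i j > 0" "i < n" "j < n" "k < n" for i j k
    using that v nn by (intro sum_pos2[of _ k]) (auto simp: less_imp_le)
  have G2: "(\<Sum>k<n. T i j k * v k) = ?G i j" if "i < n" "j < n" for i j
  proof (rule sum.cong)
    fix k assume "k \<in> {..<n}"
    then show "T i j k * v k = v k * T k i j" using sT'[of k i j] sT[of i k j] that by simp
  qed simp
  show ?thesis
  proof (rule lorentz_form_bochner[where v = v])
    show "sym_mat n ?G" unfolding sym_mat_def using sT by (auto intro!: sum.cong)
    show "?G i j \<ge> 0" if "i < n" "j < n" for i j
      using v nn that by (intro sum_nonneg) (auto simp: less_imp_le)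
    show "\<exists>i<n. \<exists>j<n. i \<in> S \<and> j \<notin> S \<and> ?G i j > 0"
      if h: "i0 < n" "i1 < n" "j0 < n" "j1 < n" "?G i0 j0 > 0" "?G i1 j1 > 0" "i0 \<in> S" "i1 \<notin> S" for S i0 i1 j0 j1
    proof -
      obtain k0 where k0: "k0 < n" "T k0 i0 j0 > 0" using Gpos[OF h(5,1,3)] by blast
      obtain k1 where k1: "k1 < n" "T k1 i1 j1 > 0" using Gpos[OF h(6,2,4)] by blast
      obtain i j k where "i < n" "j < n" "k < n" "i \<in> S" "j \<notin> S" "T k i j > 0"
        using conn[OF h(1-4) k0(1) k1(1) k0(2) k1(2) h(7,8)] by blast
      then show ?thesis using Gpos'[of k i j] by blast
    qed
    fix x
    have "bform n ?G x x = (\<Sum>i<n. \<Sum>j<n. \<Sum>k<n. v k * (T k i j * x i * x j))"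
      unfolding bform_def by (simp add: sum_distrib_right mult.assoc)
    also have "\<dots> = (\<Sum>i<n. \<Sum>k<n. \<Sum>j<n. v k * (T k i j * x i * x j))"
      by (intro sum.cong refl sum.swap)
    also have "\<dots> = (\<Sum>k<n. \<Sum>i<n. \<Sum>j<n. v k * (T k i j * x i * x j))"
      by (rule sum.swap)
    also have "\<dots> = (\<Sum>k<n. v k * bform n (T k) x x)"
      unfolding bform_def by (simp add: sum_distrib_left)
    \<comment> \<open>by symmetry of the tensor, \<open>x\<^sup>T T\<^sub>i v\<close> is the
      \<open>i\<close>-th entry of \<open>G x\<close>\<close>
    also have "\<dots> \<le> (\<Sum>i<n. v i * ((\<Sum>j<n. ?G i j * x j)\<^sup>2 / (\<Sum>j<n. ?G i j * v j)))"
    proof (rule sum_mono)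
      fix i assume "i \<in> {..<n}"
      then have i: "i < n" by simp
      have xv: "bform n (T i) x v = (\<Sum>j<n. ?G i j * x j)" for x
        unfolding bform_eq_sum using i by (intro sum.cong) (auto simp: G2)
      have vv0: "bform n (T i) v v \<ge> 0"
        unfolding bform_def using nn v i by (intro sum_nonneg) (auto simp: less_imp_le)
      have "bform n (T i) x x \<le> (bform n (T i) x v)\<^sup>2 / bform n (T i) v v"
      proof (cases "bform n (T i) v v = 0")
        case False
        then have "bform n (T i) v v > 0" using vv0 by simp
        moreover have "bform n (T i) x x * bform n (T i) v v \<le> (bform n (T i) x v)\<^sup>2"
          using l[OF i] calculation unfolding lorentz_form_def by blast
        ultimately show ?thesis by (simp add: pos_le_divide_eq)
      next
        case True
        have "T i j k = 0" if "j < n" "k < n" for j k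
        proof (rule ccontr)
          assume "T i j k \<noteq> 0"
          then have "T i j k * v j * v k > 0" using nn[OF i that] v that by (simp add: less_le)
          then have sp: "(\<Sum>k<n. T i j k * v j * v k) > 0"
            using that nn v i by (intro sum_pos2[of _ k]) (auto simp: less_imp_le)
          have "bform n (T i) v v > 0" unfolding bform_def
            by (rule sum_pos2[of _ j]) (use sp that nn v i in \<open>auto simp: less_imp_le intro!: sum_nonneg\<close>)
          then show False using True by simp
        qed
        then have "bform n (T i) x x = 0" unfolding bform_def by (intro sum.neutral ballI) simp
        then show ?thesis using vv0 by simp
      qed
      then show "v i * bform n (T i) x x \<le> v i * ((\<Sum>j<n. ?G i j * x j)\<^sup>2 / (\<Sum>j<n. ?G i j * v j))"
        unfolding xv using v[OF i] by (intro mult_left_mono) auto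
    qed
    finally show "bform n ?G x x \<le> (\<Sum>i<n. v i * ((\<Sum>j<n. ?G i j * x j)\<^sup>2 / (\<Sum>j<n. ?G i j * v j)))" .
  qed (use v in auto)
qed

section \<open>Small powers of metrics and Ptolemaic matrices\<close>

lemma powr_diff_bound:
  fixes a b m q :: real
  assumes q: "0 < q" "q \<le> 1" and m: "0 \<le> m" "m \<le> a" "m \<le> b" and ab: "\<bar>a - b\<bar> \<le> m"
  shows "\<bar>a powr q - b powr q\<bar> \<le> q * m powr q"
proof -
  have *: "a powr q - b powr q \<le> q * m powr q" if h: "m \<le> b" "b < a" "a \<le> b + m" for a b
  proof -
    have m0: "m > 0" using h by simp
    have "\<exists>z>b. z < a \<and> a powr q - b powr q = (a - b) * (q * z powr (q - 1))"
      using h m0 by (intro MVT2) (auto intro!: derivative_eq_intros)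
    then obtain z where z: "b < z" "z < a" and eq: "a powr q - b powr q = (a - b) * (q * z powr (q - 1))"
      by blast
    have "z powr (q - 1) \<le> m powr (q - 1)" using q z h m0 by (intro powr_mono2') auto
    then have "a powr q - b powr q \<le> m * (q * m powr (q - 1))"
      unfolding eq using h q by (intro mult_mono) auto
    also have "\<dots> = q * m powr q" using m0 by (simp add: powr_diff)
    finally show ?thesis .
  qed
  have mono: "a powr q \<le> b powr q" if "m \<le> a" "a \<le> b" for a b
    using that m q by (intro powr_mono2) auto
  consider "a = b" | "a < b" | "b < a" by linarith
  then show ?thesis
  proof cases
    case 2
    then show ?thesis using *[of a b] mono[of a b] m ab by (simp add: abs_if)
  next
    case 3
    then show ?thesis using *[of b a] mono[of b a] m ab by (simp add: abs_if)
  qed (use q in simp)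
qed

text \<open>
  The quadratic form of a symmetric matrix on \<open>A\<close> with its diagonal replaced by zero.
\<close>

definition edge_form :: "nat set \<Rightarrow> (nat \<Rightarrow> nat \<Rightarrow> real) \<Rightarrow> (nat \<Rightarrow> real) \<Rightarrow> real" where
  "edge_form A D x = (\<Sum>i\<in>A. \<Sum>j\<in>A - {i}. D i j * x i * x j)"

lemma edge_form_insert:
  assumes "finite R" "a \<notin> R" and s: "\<And>k. k \<in> R \<Longrightarrow> D k a = D a k"
  shows "edge_form (insert a R) D x = edge_form R D x + 2 * x a * (\<Sum>k\<in>R. D a k * x k)"
proof -
  have "edge_form (insert a R) D x
      = (\<Sum>j\<in>R. D a j * x a * x j) + (\<Sum>i\<in>R. \<Sum>j\<in>insert a R - {i}. D i j * x i * x j)"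
    unfolding edge_form_def using assms by simp
  also have "(\<Sum>i\<in>R. \<Sum>j\<in>insert a R - {i}. D i j * x i * x j)
      = (\<Sum>i\<in>R. D a i * x a * x i + (\<Sum>j\<in>R - {i}. D i j * x i * x j))"
  proof (rule sum.cong)
    fix i assume i: "i \<in> R"
    then have "insert a R - {i} = insert a (R - {i})" using assms by auto
    then show "(\<Sum>j\<in>insert a R - {i}. D i j * x i * x j)
        = D a i * x a * x i + (\<Sum>j\<in>R - {i}. D i j * x i * x j)"
      using assms i by simp
  qed simp
  also have "\<dots> = (\<Sum>j\<in>R. D a j * x a * x j) + edge_form R D x"
    unfolding edge_form_def by (simp add: sum.distrib)
  finally show ?thesis by (simp add: sum_distrib_left mult_ac)
qed

lemma edge_form_cong:
  "(\<And>i. i \<in> A \<Longrightarrow> x i = y i) \<Longrightarrow> edge_form A D x = edge_form A D y"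
  unfolding edge_form_def by (intro sum.cong) auto

text \<open>
  Let \<open>d\<close> be symmetric with the triangle inequality (also for coinciding arguments, so diagonal
  entries need not vanish), and let \<open>m i\<close> bound the distances from \<open>i\<close> to the other points from below.
  For \<open>q\<close> small in terms of \<open>n\<close> and \<open>\<tau>\<close>, the powers \<open>d\<^sup>q\<close> are of negative type, with a margin that
  ultrametrics have for \<open>\<tau> = 0\<close>. Induction step: let \<open>i\<close>, \<open>j\<close> be a closest pair, at
  distance \<open>\<mu>\<close>, and move the weight of \<open>j\<close> to \<open>i\<close>. For the other points \<open>k\<close> the powers \<open>d\<^sub>j\<^sub>k\<^sup>q\<close> and
  \<open>d\<^sub>i\<^sub>k\<^sup>q\<close> differ by at most \<open>q \<mu>\<^sup>q\<close>, which is negligible against the margin \<open>\<mu>\<^sup>q\<close>.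
\<close>

lemma snowflake_negative_type:
  fixes \<tau> :: real
  assumes "0 < \<tau>" "\<tau> \<le> 1"
  shows "\<exists>q0>0. \<forall>q A d x m. 0 < q \<longrightarrow> q \<le> q0 \<longrightarrow> finite A \<longrightarrow> card A \<le> n \<longrightarrow>
     (\<forall>i\<in>A. \<forall>j\<in>A. d i j = d j i) \<longrightarrow>
     (\<forall>i\<in>A. \<forall>j\<in>A. \<forall>k\<in>A. d j k \<le> d i j + d i k) \<longrightarrow>
     (\<forall>i\<in>A. 0 \<le> m i \<and> (\<forall>k\<in>A - {i}. m i \<le> d i k)) \<longrightarrow>
     (\<Sum>i\<in>A. x i) = 0 \<longrightarrow>
     edge_form A (\<lambda>i j. d i j powr q) x \<le> - (1 - \<tau>) * (\<Sum>i\<in>A. m i powr q * (x i)\<^sup>2)"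
  using assms
proof (induction n arbitrary: \<tau>)
  case 0
  show ?case by (intro exI[of _ 1]) (auto simp: edge_form_def)
next
  case (Suc n)
  from Suc.IH[of "\<tau> / 4"] Suc.prems obtain q1 :: real where q1: "q1 > 0" and
    IH: "\<And>q A d x m. 0 < q \<Longrightarrow> q \<le> q1 \<Longrightarrow> finite A \<Longrightarrow> card A \<le> n \<Longrightarrow>
     (\<forall>i\<in>A. \<forall>j\<in>A. d i j = d j i) \<Longrightarrow>
     (\<forall>i\<in>A. \<forall>j\<in>A. \<forall>k\<in>A. d j k \<le> d i j + d i k) \<Longrightarrow>
     (\<forall>i\<in>A. 0 \<le> m i \<and> (\<forall>k\<in>A - {i}. m i \<le> d i k)) \<Longrightarrow>
     (\<Sum>i\<in>A. x i) = 0 \<Longrightarrow>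
     edge_form A (\<lambda>i j. d i j powr q) x \<le> - (1 - \<tau> / 4) * (\<Sum>i\<in>A. m i powr q * (x i)\<^sup>2)"
    by auto
  define q0 where "q0 = min q1 (min (\<tau> / (2 * (real n + 1))) 1)"
  have q0: "q0 > 0" "q0 \<le> q1" "q0 \<le> 1" "q0 \<le> \<tau> / (2 * (real n + 1))"
  proof -
    have "\<tau> / (2 * (real n + 1)) > 0" using Suc.prems by simp
    then show "q0 > 0" "q0 \<le> q1" "q0 \<le> 1" "q0 \<le> \<tau> / (2 * (real n + 1))"
      using q1 unfolding q0_def by linarith+
  qed
  show ?case
  proof (intro exI[of _ q0] conjI q0 allI impI)
    fix q :: real and A :: "nat set" and d :: "nat \<Rightarrow> nat \<Rightarrow> real" and x m :: "nat \<Rightarrow> real"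
    assume q: "0 < q" "q \<le> q0" and fin: "finite A" and card: "card A \<le> Suc n"
      and sym: "\<forall>i\<in>A. \<forall>j\<in>A. d i j = d j i"
      and tri: "\<forall>i\<in>A. \<forall>j\<in>A. \<forall>k\<in>A. d j k \<le> d i j + d i k"
      and m: "\<forall>i\<in>A. 0 \<le> m i \<and> (\<forall>k\<in>A - {i}. m i \<le> d i k)"
      and x: "(\<Sum>i\<in>A. x i) = 0"
    show "edge_form A (\<lambda>i j. d i j powr q) x \<le> - (1 - \<tau>) * (\<Sum>i\<in>A. m i powr q * (x i)\<^sup>2)"
    proof (cases "card A \<le> 1")
      case True
      then consider "A = {}" | a where "A = {a}"
        using fin by (metis card_0_eq card_1_singletonE le_less_linear less_one order_antisym)
      then show ?thesis using x by cases (auto simp: edge_form_def)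
    next
      case False
      define P where "P = {(i,j). i \<in> A \<and> j \<in> A \<and> i \<noteq> j}"
      have finP: "finite P" unfolding P_def by (rule finite_subset[of _ "A \<times> A"]) (use fin in auto)
      have "P \<noteq> {}"
      proof
        assume "P = {}"
        then have "\<forall>i\<in>A. \<forall>j\<in>A. i = j" unfolding P_def by auto
        then show False using False fin by (metis One_nat_def card_le_Suc0_iff_eq)
      qed
      define \<mu> where "\<mu> = Min ((\<lambda>(i,j). d i j) ` P)"
      have "\<mu> \<in> (\<lambda>(i,j). d i j) ` P" unfolding \<mu>_def using finP \<open>P \<noteq> {}\<close> by (intro Min_in) auto
      then obtain i j where ij: "i \<in> A" "j \<in> A" "i \<noteq> j" and \<mu>: "d i j = \<mu>" unfolding P_def by auto
      have \<mu>le: "\<mu> \<le> d a b" if "a \<in> A" "b \<in> A" "a \<noteq> b" for a b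
        unfolding \<mu>_def using finP that by (intro Min_le) (auto simp: P_def image_iff)
      have \<mu>0: "\<mu> \<ge> 0" using m ij \<mu> by force
      define R where "R = A - {i,j}"
      have A: "A = insert j (insert i R)" and jR: "j \<notin> insert i R" and iR: "i \<notin> R" and finR: "finite R"
        using ij fin by (auto simp: R_def)
      have cR: "card (insert i R) \<le> n" using card jR finR unfolding A by simp
      define D where "D a b = d a b powr q" for a b
      define w where "w = \<mu> powr q"
      \<comment> \<open>still lower bounds for the distances, and at least \<open>\<mu>\<close>\<close>
      define M where "M k = max (m k) \<mu>" for k
      have Mi: "M i = \<mu>" "M j = \<mu>" using m ij \<mu> sym by (auto simp: M_def max_def)
      have Mw: "M k powr q \<ge> w" for k unfolding w_def M_def using q \<mu>0 by (intro powr_mono2) auto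
      \<comment> \<open>the weights after \<open>j\<close> has been merged into \<open>i\<close>\<close>
      define X where "X k = (if k = i then x i + x j else x k)" for k
      define s where "s = x i + x j"
      define T where "T = (\<Sum>k\<in>R. M k powr q * (x k)\<^sup>2)"
      have symD: "D a b = D b a" if "a \<in> A" "b \<in> A" for a b using sym that by (simp add: D_def)
      have XR: "X k = x k" if "k \<in> R" for k using that iR by (auto simp: X_def)
      have X0: "(\<Sum>k\<in>insert i R. X k) = (\<Sum>k\<in>A. x k)"
        unfolding A using jR iR finR XR by (simp add: X_def[of i])
      have "edge_form (insert i R) (\<lambda>i j. d i j powr q) X
         \<le> - (1 - \<tau> / 4) * (\<Sum>k\<in>insert i R. M k powr q * (X k)\<^sup>2)"
      proof (rule IH[where q = q and A = "insert i R" and d = d and x = X and m = M])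
        have sub: "insert i R \<subseteq> A" by (auto simp: A)
        show "\<forall>a\<in>insert i R. \<forall>b\<in>insert i R. d a b = d b a" using sym sub by blast
        show "\<forall>a\<in>insert i R. \<forall>b\<in>insert i R. \<forall>c\<in>insert i R. d b c \<le> d a b + d a c"
          using tri sub by blast
        show "\<forall>a\<in>insert i R. 0 \<le> M a \<and> (\<forall>k\<in>insert i R - {a}. M a \<le> d a k)"
        proof (intro ballI conjI)
          fix a k assume "a \<in> insert i R" "k \<in> insert i R - {a}"
          then have "a \<in> A" "k \<in> A - {a}" using sub by auto
          then show "M a \<le> d a k" using m \<mu>le[of a k] by (auto simp: M_def)
        qed (use \<mu>0 in \<open>auto simp: M_def\<close>)
        show "(\<Sum>k\<in>insert i R. X k) = 0" using X0 x by simp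
      qed (use q q0 cR finR in auto)
      then have IH': "edge_form (insert i R) D X \<le> - (1 - \<tau> / 4) * (T + w * s\<^sup>2)"
        using finR iR XR Mi by (simp add: D_def[abs_def] T_def s_def w_def X_def[of i] add.commute)
      have e1: "edge_form (insert i R) D X = edge_form R D x + 2 * s * (\<Sum>k\<in>R. D i k * x k)"
        using edge_form_insert[OF finR iR, of D X] symD ij XR edge_form_cong[of R X x D]
        by (auto simp: A X_def[of i] s_def)
      have e2: "edge_form (insert i R) D x = edge_form R D x + 2 * x i * (\<Sum>k\<in>R. D i k * x k)"
        using edge_form_insert[OF finR iR, of D x] symD ij by (auto simp: A)
      have e3: "edge_form A D x = edge_form (insert i R) D x + 2 * x j * (\<Sum>k\<in>insert i R. D j k * x k)"
        unfolding A using finR by (intro edge_form_insert jR) (auto intro!: symD simp: A)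
      have Dji: "D j i = w" using \<mu> sym ij by (simp add: D_def w_def)
      have "edge_form A D x = edge_form (insert i R) D X
          + (\<Sum>k\<in>R. 2 * x j * (D j k - D i k) * x k) + 2 * w * x i * x j"
        unfolding e3 e2 e1 using finR iR Dji
        by (simp add: s_def algebra_simps sum.distrib sum_subtractf sum_distrib_left)
      also have "(\<Sum>k\<in>R. 2 * x j * (D j k - D i k) * x k) \<le> (\<Sum>k\<in>R. q * w * (x j)\<^sup>2 + q * (M k powr q * (x k)\<^sup>2))"
      proof (rule sum_mono)
        fix k assume k: "k \<in> R"
        then have kA: "k \<in> A" "k \<noteq> i" "k \<noteq> j" by (auto simp: R_def)
        have "d j k \<le> d i j + d i k" "d i k \<le> d j i + d j k" using tri ij kA by blast+
        then have "\<bar>d j k - d i k\<bar> \<le> \<mu>" using \<mu> sym ij by (simp add: abs_if)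
        then have b: "\<bar>D j k - D i k\<bar> \<le> q * w" unfolding D_def w_def
          using q q0 \<mu>0 \<mu>le ij kA by (intro powr_diff_bound) auto
        have "2 * x j * (D j k - D i k) * x k \<le> \<bar>2 * x j * (D j k - D i k) * x k\<bar>" by simp
        also have "\<dots> = \<bar>D j k - D i k\<bar> * (2 * \<bar>x j\<bar> * \<bar>x k\<bar>)" by (simp add: abs_mult)
        also have "\<dots> \<le> (q * w) * (2 * \<bar>x j\<bar> * \<bar>x k\<bar>)" using b by (intro mult_right_mono) auto
        also have "\<dots> \<le> (q * w) * ((x j)\<^sup>2 + (x k)\<^sup>2)"
        proof (rule mult_left_mono)
          have "0 \<le> (\<bar>x j\<bar> - \<bar>x k\<bar>)\<^sup>2" by simp
          then show "2 * \<bar>x j\<bar> * \<bar>x k\<bar> \<le> (x j)\<^sup>2 + (x k)\<^sup>2" by (simp add: power2_diff)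
        qed (use q in \<open>simp add: w_def\<close>)
        also have "\<dots> \<le> q * w * (x j)\<^sup>2 + q * (M k powr q * (x k)\<^sup>2)"
          using Mw[of k] q by (simp add: distrib_left mult.assoc mult_right_mono)
        finally show "2 * x j * (D j k - D i k) * x k \<le> q * w * (x j)\<^sup>2 + q * (M k powr q * (x k)\<^sup>2)" .
      qed
      also have "\<dots> = (q * real (card R)) * (w * (x j)\<^sup>2) + q * T"
        by (simp add: sum.distrib T_def sum_distrib_left)
      finally have main: "edge_form A D x \<le> - (1 - \<tau> / 4) * (T + w * s\<^sup>2)
          + ((q * real (card R)) * (w * (x j)\<^sup>2) + q * T) + 2 * w * x i * x j" using IH' by simp
      have w0: "w \<ge> 0" by (simp add: w_def)
      have T0: "T \<ge> 0" unfolding T_def by (intro sum_nonneg) auto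
      have "q \<le> \<tau> / (2 * (real n + 1))" using q(2) q0(4) by (rule order_trans)
      then have "q * (2 * (real n + 1)) \<le> \<tau>" by (subst (asm) pos_le_divide_eq) auto
      moreover have "q * real (card R) \<le> q * (real n + 1)" "q * 1 \<le> q * (real n + 1)"
        using cR iR finR q by (intro mult_left_mono; simp)+
      ultimately have qc: "q * real (card R) \<le> \<tau> / 2" and q2: "q \<le> \<tau> / 2" by (simp_all add: algebra_simps)
      have "(q * real (card R)) * (w * (x j)\<^sup>2) \<le> \<tau> / 2 * (w * (x j)\<^sup>2)"
        using qc w0 by (intro mult_right_mono) auto
      moreover have "q * T \<le> \<tau> / 2 * T" using q2 T0 by (intro mult_right_mono) auto
      ultimately have main2: "edge_form A D x \<le> - (1 - \<tau> / 4) * (T + w * s\<^sup>2)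
          + (\<tau> / 2 * (w * (x j)\<^sup>2) + \<tau> / 2 * T) + 2 * w * x i * x j" using main by linarith
      have xi: "x i = s - x j" by (simp add: s_def)
      \<comment> \<open>the choice \<open>\<tau> / 4\<close> in the induction hypothesis leaves a
        positive definite rest in \<open>s\<close> and \<open>x j\<close>\<close>
      have "- (1 - \<tau> / 4) * (T + w * s\<^sup>2) + (\<tau> / 2 * (w * (x j)\<^sup>2) + \<tau> / 2 * T) + 2 * w * x i * x j
         = - (1 - \<tau>) * (T + w * (x i)\<^sup>2 + w * (x j)\<^sup>2)
           - \<tau> / 4 * T - \<tau> * w * (3 / 4 * s\<^sup>2 - 2 * s * x j + 3 / 2 * (x j)\<^sup>2)"
        unfolding xi by (simp add: power2_eq_square field_simps)
      moreover have "\<tau> * w * (3 / 4 * s\<^sup>2 - 2 * s * x j + 3 / 2 * (x j)\<^sup>2) \<ge> 0"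
      proof -
        have "3 / 4 * s\<^sup>2 - 2 * s * x j + 3 / 2 * (x j)\<^sup>2 = 3 / 4 * (s - 4 / 3 * x j)\<^sup>2 + 1 / 6 * (x j)\<^sup>2"
          by (simp add: power2_eq_square field_simps)
        then show ?thesis using Suc.prems w0 by simp
      qed
      moreover have "\<tau> / 4 * T \<ge> 0" using Suc.prems T0 by simp
      ultimately have main3: "edge_form A D x \<le> - (1 - \<tau>) * (T + w * (x i)\<^sup>2 + w * (x j)\<^sup>2)"
        using main2 by linarith
      have "(\<Sum>k\<in>A. m k powr q * (x k)\<^sup>2) \<le> (\<Sum>k\<in>A. M k powr q * (x k)\<^sup>2)"
        using m q by (intro sum_mono mult_right_mono powr_mono2) (auto simp: M_def)
      also have "\<dots> = T + w * (x i)\<^sup>2 + w * (x j)\<^sup>2"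
        unfolding A using jR iR finR Mi by (simp add: T_def w_def)
      finally have "(1 - \<tau>) * (\<Sum>k\<in>A. m k powr q * (x k)\<^sup>2) \<le> (1 - \<tau>) * (T + w * (x i)\<^sup>2 + w * (x j)\<^sup>2)"
        using Suc.prems by (intro mult_left_mono) auto
      then show ?thesis using main3 unfolding D_def[abs_def] by linarith
    qed
  qed
qed


text \<open>
  A nonnegative symmetric matrix whose powers with exponent \<open>1/q\<close> satisfy the Ptolemy inequality becomes
  Lorentz after its diagonal is multiplied by \<open>\<kappa> < 1\<close>, provided that \<open>q\<close> is small in terms of \<open>n\<close> and \<open>\<kappa>\<close>.
\<close>

lemma lorentz_form_of_ptolemy:
  fixes \<kappa> :: real
  assumes \<kappa>: "0 \<le> \<kappa>" "\<kappa> < 1"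
  shows "\<exists>q0>0. \<forall>q M. 0 < q \<longrightarrow> q \<le> q0 \<longrightarrow> sym_mat n M \<longrightarrow>
     (\<forall>i<n. \<forall>j<n. 0 \<le> M i j) \<longrightarrow>
     (\<forall>i<n. \<forall>j<n. \<forall>k<n. \<forall>l<n. (M i j * M k l) powr (1/q)
         \<le> (M i k * M j l) powr (1/q) + (M i l * M j k) powr (1/q)) \<longrightarrow>
     lorentz_form n (\<lambda>i j. if i = j then \<kappa> * M i i else M i j)"
proof -
  define \<tau> where "\<tau> = (1 - \<kappa>) / 2"
  have \<tau>: "0 < \<tau>" "\<tau> \<le> 1" "1 - \<tau> \<ge> 0" using \<kappa> by (auto simp: \<tau>_def)
  obtain q1 :: real where q1: "q1 > 0" and
    neg: "\<And>q A d x m. 0 < q \<Longrightarrow> q \<le> q1 \<Longrightarrow> finite A \<Longrightarrow> card A \<le> n \<Longrightarrow>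
     (\<forall>i\<in>A. \<forall>j\<in>A. d i j = d j i) \<Longrightarrow>
     (\<forall>i\<in>A. \<forall>j\<in>A. \<forall>k\<in>A. d j k \<le> d i j + d i k) \<Longrightarrow>
     (\<forall>i\<in>A. 0 \<le> m i \<and> (\<forall>k\<in>A - {i}. m i \<le> d i k)) \<Longrightarrow>
     (\<Sum>i\<in>A. x i) = 0 \<Longrightarrow>
     edge_form A (\<lambda>i j. d i j powr q) x \<le> - (1 - \<tau>) * (\<Sum>i\<in>A. m i powr q * (x i)\<^sup>2)"
    using snowflake_negative_type[OF \<tau>(1,2), of n] by auto
  define q0 where "q0 = min q1 (min \<tau> 1)"
  have q0: "q0 > 0" "q0 \<le> q1" "q0 \<le> \<tau>" "q0 \<le> 1" using q1 \<tau> by (auto simp: q0_def)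
  show ?thesis
  proof (intro exI[of _ q0] conjI q0 allI impI)
    fix q :: real and M :: "nat \<Rightarrow> nat \<Rightarrow> real"
    assume q: "0 < q" "q \<le> q0" and s: "sym_mat n M" and nn: "\<forall>i<n. \<forall>j<n. 0 \<le> M i j"
      and pt: "\<forall>i<n. \<forall>j<n. \<forall>k<n. \<forall>l<n. (M i j * M k l) powr (1/q)
         \<le> (M i k * M j l) powr (1/q) + (M i l * M j k) powr (1/q)"
    define \<sigma> where "\<sigma> i j = M i j powr (1/q)" for i j
    define u where "u k = (\<Sum>l<n. \<sigma> k l)" for k
    define A where "A = {k. k < n \<and> (\<exists>l<n. M k l > 0)}"
    define d where "d i j = \<sigma> i j / (u i * u j)" for i j
    define C where "C = (\<lambda>i j. if i = j then \<kappa> * M i i else M i j)"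
    have fA: "finite A" "card A \<le> n" and An: "A \<subseteq> {..<n}"
      using card_mono[of "{..<n}" A] by (auto simp: A_def)
    have ss: "\<sigma> i j = \<sigma> j i" if "i < n" "j < n" for i j
      using s that by (simp add: \<sigma>_def sym_mat_def)
    have s0: "\<sigma> i j \<ge> 0" for i j by (simp add: \<sigma>_def)
    have up: "u k > 0" if k: "k \<in> A" for k
    proof -
      obtain l where "l < n" "M k l > 0" using k by (auto simp: A_def)
      then show ?thesis unfolding u_def using s0 by (intro sum_pos2[of _ l]) (auto simp: \<sigma>_def)
    qed
    have d0: "d i j \<ge> 0" if "i \<in> A" "j \<in> A" for i j
      using s0 up that by (simp add: d_def less_imp_le)
    have pt': "\<sigma> i j * \<sigma> k l \<le> \<sigma> i k * \<sigma> j l + \<sigma> i l * \<sigma> j k" if "i < n" "j < n" "k < n" "l < n" for i j k l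
      using pt nn that unfolding \<sigma>_def by (simp add: powr_mult)
    \<comment> \<open>the Ptolemy inequality is linear in the row of each single index, so a row may be
      replaced by a sum of rows; unlike a single row, the sum of all rows is positive at every index with
      a nonzero row\<close>
    have upt: "u i * \<sigma> j k \<le> \<sigma> i j * u k + \<sigma> i k * u j" if "i < n" "j < n" "k < n" for i j k
    proof -
      have "u i * \<sigma> j k = (\<Sum>l<n. \<sigma> i l * \<sigma> j k)" by (simp add: u_def sum_distrib_right)
      also have "\<dots> \<le> (\<Sum>l<n. \<sigma> i j * \<sigma> k l + \<sigma> i k * \<sigma> j l)"
        using pt'[of i _ j k] that ss by (intro sum_mono) (fastforce)
      also have "\<dots> = \<sigma> i j * u k + \<sigma> i k * u j"
        by (simp add: u_def sum.distrib sum_distrib_left)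
      finally show ?thesis .
    qed
    have tri: "d j k \<le> d i j + d i k" if "i \<in> A" "j \<in> A" "k \<in> A" for i j k
    proof -
      have p: "u i > 0" "u j > 0" "u k > 0" using up that by auto
      have "u i * \<sigma> j k / (u i * u j * u k) \<le> (\<sigma> i j * u k + \<sigma> i k * u j) / (u i * u j * u k)"
        using upt[of i j k] An that p by (intro divide_right_mono) auto
      then show ?thesis using p by (simp add: d_def add_divide_distrib mult.commute mult.left_commute)
    qed
    have ds: "d i j = d j i" if "i \<in> A" "j \<in> A" for i j
      using ss[of i j] An that by (auto simp: d_def mult.commute)
    have dq: "M i j = u i powr q * u j powr q * d i j powr q" if "i \<in> A" "j \<in> A" for i j
    proof -
      have "0 \<le> M i j" using nn An that by blast
      then have "\<sigma> i j powr q = M i j" using q by (simp add: \<sigma>_def powr_powr)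
      moreover have "\<sigma> i j = u i * u j * d i j" using up[OF that(1)] up[OF that(2)] by (simp add: d_def)
      ultimately show ?thesis using up[OF that(1)] up[OF that(2)] d0[OF that]
        by (metis mult_pos_pos less_imp_le powr_mult)
    qed
    have "lorentz_form n C"
    proof (rule lorentz_formI[of n _ "\<lambda>i. if i \<in> A then u i powr q else 0"])
      show "sym_mat n C" using s by (auto simp: sym_mat_def C_def)
      fix x assume x: "(\<Sum>i<n. (if i \<in> A then u i powr q else 0) * x i) = 0"
      define y where "y i = u i powr q * x i" for i
      have "(\<Sum>i\<in>A. y i) = (\<Sum>i<n. if i \<in> A then y i else 0)"
        using An by (simp add: sum.If_cases Int_absorb1)
      also have "\<dots> = (\<Sum>i<n. (if i \<in> A then u i powr q else 0) * x i)"
        by (intro sum.cong) (auto simp: y_def)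
      finally have y: "(\<Sum>i\<in>A. y i) = 0" using x by simp
      have C0: "C i j = 0" if "i < n" "j < n" "i \<notin> A \<or> j \<notin> A" for i j
      proof -
        have "\<not> M i j > 0" using that s unfolding A_def sym_mat_def by auto
        then have "M i j = 0" using nn that by (auto simp: less_le)
        then show ?thesis by (auto simp: C_def)
      qed
      have "bform n C x x = (\<Sum>i\<in>A. \<Sum>j<n. C i j * x i * x j)"
        unfolding bform_def using An C0 by (intro sum.mono_neutral_right) auto
      also have "\<dots> = (\<Sum>i\<in>A. \<Sum>j\<in>A. C i j * x i * x j)"
        using An C0 by (intro sum.cong refl sum.mono_neutral_right) auto
      also have "\<dots> = (\<Sum>i\<in>A. \<kappa> * (d i i powr q * (y i)\<^sup>2) + (\<Sum>j\<in>A - {i}. d i j powr q * y i * y j))"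
      proof (rule sum.cong)
        fix i assume i: "i \<in> A"
        have "(\<Sum>j\<in>A. C i j * x i * x j) = C i i * x i * x i + (\<Sum>j\<in>A - {i}. C i j * x i * x j)"
          using fA i by (intro sum.remove) auto
        also have "C i i * x i * x i = \<kappa> * (d i i powr q * (y i)\<^sup>2)"
          using dq[OF i i] by (simp add: y_def C_def power2_eq_square)
        also have "(\<Sum>j\<in>A - {i}. C i j * x i * x j) = (\<Sum>j\<in>A - {i}. d i j powr q * y i * y j)"
          using i by (intro sum.cong refl) (auto simp: y_def C_def dq)
        finally show "(\<Sum>j\<in>A. C i j * x i * x j)
           = \<kappa> * (d i i powr q * (y i)\<^sup>2) + (\<Sum>j\<in>A - {i}. d i j powr q * y i * y j)" .
      qed simp
      also have "\<dots> = \<kappa> * (\<Sum>i\<in>A. d i i powr q * (y i)\<^sup>2) + edge_form A (\<lambda>i j. d i j powr q) y"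
        by (simp add: sum.distrib edge_form_def sum_distrib_left)
      also have "edge_form A (\<lambda>i j. d i j powr q) y \<le> - (1 - \<tau>) * (\<Sum>i\<in>A. (d i i / 2) powr q * (y i)\<^sup>2)"
      proof (rule neg)
        \<comment> \<open>since \<open>d i i \<le> 2 d i k\<close>, half of the diagonal entry bounds the
          distances from \<open>i\<close> from below\<close>
        show "\<forall>i\<in>A. 0 \<le> d i i / 2 \<and> (\<forall>k\<in>A - {i}. d i i / 2 \<le> d i k)"
        proof (intro ballI conjI)
          fix i k assume "i \<in> A" "k \<in> A - {i}"
          then show "d i i / 2 \<le> d i k" using tri[of k i i] ds[of i k] by auto
        qed (use d0 in auto)
      qed (use q q0 fA ds tri y in auto)
      finally have "bform n C x x \<le> \<kappa> * (\<Sum>i\<in>A. d i i powr q * (y i)\<^sup>2)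
          - (1 - \<tau>) * (\<Sum>i\<in>A. (d i i / 2) powr q * (y i)\<^sup>2)" by (simp add: algebra_simps)
      also have "(\<Sum>i\<in>A. d i i powr q * (y i)\<^sup>2) = 2 powr q * (\<Sum>i\<in>A. (d i i / 2) powr q * (y i)\<^sup>2)"
        unfolding sum_distrib_left
      proof (rule sum.cong)
        fix i assume i: "i \<in> A"
        have "d i i powr q = (2 * (d i i / 2)) powr q" by simp
        also have "\<dots> = 2 powr q * (d i i / 2) powr q" using d0[OF i i] by (subst powr_mult) auto
        finally show "d i i powr q * (y i)\<^sup>2 = 2 powr q * ((d i i / 2) powr q * (y i)\<^sup>2)" by simp
      qed simp
      finally have "bform n C x x \<le> (\<kappa> * 2 powr q - (1 - \<tau>)) * (\<Sum>i\<in>A. (d i i / 2) powr q * (y i)\<^sup>2)"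
        by (simp add: algebra_simps)
      also have "\<dots> \<le> 0"
      proof (rule mult_nonpos_nonneg)
        have "\<bar>2 powr q - 1 powr q\<bar> \<le> q * 1 powr q"
          using q q0 by (intro powr_diff_bound) auto
        then have "2 powr q \<le> 1 + \<tau>" using q q0 by simp
        then have "\<kappa> * 2 powr q \<le> \<kappa> * (1 + \<tau>)" using \<kappa> by (intro mult_left_mono) auto
        also have "\<dots> \<le> \<kappa> + \<tau>" using \<kappa> \<tau> mult_right_mono[of \<kappa> 1 \<tau>] by (simp add: algebra_simps)
        also have "\<dots> = 1 - \<tau>" by (simp add: \<tau>_def field_simps)
        finally show "\<kappa> * 2 powr q - (1 - \<tau>) \<le> 0" by simp
      qed (auto intro!: sum_nonneg)
      finally show "bform n C x x \<le> 0" .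
    qed
    then show "lorentz_form n (\<lambda>i j. if i = j then \<kappa> * M i i else M i j)" by (simp add: C_def)
  qed
qed

section \<open>Normalized coefficients of polynomials\<close>

text \<open>
  The exponents \<open>unit_expo i\<close> are given by the numeral \<open>1\<close>, which the simplifier should not rewrite
  to \<open>Suc 0\<close>.
\<close>

declare One_nat_def [simp del]

abbreviation lk :: "expo \<Rightarrow> nat \<Rightarrow> nat" where "lk \<equiv> Poly_Mapping.lookup"

lemma lookup_unit: "lk (unit_expo i) j = (if i = j then 1 else 0)"
  by (simp add: lookup_single when_def)

lemma expo_eqI: "(\<And>i. lk \<alpha> i = lk \<beta> i) \<Longrightarrow> \<alpha> = \<beta>"
  by (rule poly_mapping_eqI)

lemma Simplex_iff: "\<alpha> \<in> Simplex n d \<longleftrightarrow> (\<forall>i\<ge>n. lk \<alpha> i = 0) \<and> (\<Sum>i<n. lk \<alpha> i) = d"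
proof -
  have "Poly_Mapping.keys \<alpha> \<subseteq> {..<n} \<longleftrightarrow> (\<forall>i\<ge>n. lk \<alpha> i = 0)"
    unfolding subset_eq Ball_def in_keys_iff lessThan_iff by (meson not_le)
  then show ?thesis by (simp add: Simplex_def)
qed

lemma sum_unit: "i < n \<Longrightarrow> (\<Sum>k<n. lk (unit_expo i) k) = 1"
  by (simp add: lookup_unit)

lemma Simplex_add_unit:
  assumes "i < n"
  shows "\<beta> + unit_expo i \<in> Simplex n (Suc m) \<longleftrightarrow> \<beta> \<in> Simplex n m"
  using assms unfolding Simplex_iff by (auto simp: lookup_add lookup_unit sum.distrib sum_unit)

lemma Simplex_add_unitD:
  assumes "\<beta> + unit_expo i \<in> Simplex n m"
  shows "i < n" "m > 0" "\<beta> \<in> Simplex n (m - 1)"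
proof -
  show i: "i < n"
  proof (rule ccontr)
    assume "\<not> i < n"
    then have "lk (\<beta> + unit_expo i) i = 0" using assms unfolding Simplex_iff by auto
    then show False by (simp add: lookup_add)
  qed
  have "(\<Sum>k<n. lk (\<beta> + unit_expo i) k) = m" using assms unfolding Simplex_iff by auto
  then have "(\<Sum>k<n. lk \<beta> k) + 1 = m" using i by (simp add: lookup_add sum.distrib sum_unit)
  then show m: "m > 0" by simp
  then have "m = Suc (m - 1)" by simp
  then show "\<beta> \<in> Simplex n (m - 1)" using Simplex_add_unit[OF i, of \<beta> "m - 1"] assms by simp
qed

lemma Simplex_0: "\<beta> \<in> Simplex n 0 \<longleftrightarrow> \<beta> = 0"
proof
  assume b: "\<beta> \<in> Simplex n 0"
  show "\<beta> = 0"
  proof (rule expo_eqI)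
    fix i show "lk \<beta> i = lk 0 i"
      using b unfolding Simplex_iff by (cases "i < n") auto
  qed
qed (simp add: Simplex_iff)

lemma finite_Simplex: "finite (Simplex n d)"
proof -
  have "inj_on (\<lambda>\<alpha>. map (lk \<alpha>) [0..<n]) (Simplex n d)"
  proof (rule inj_onI)
    fix \<alpha> \<beta> assume a: "\<alpha> \<in> Simplex n d" "\<beta> \<in> Simplex n d"
      and eq: "map (lk \<alpha>) [0..<n] = map (lk \<beta>) [0..<n]"
    show "\<alpha> = \<beta>"
    proof (rule expo_eqI)
      fix i show "lk \<alpha> i = lk \<beta> i"
      proof (cases "i < n")
        case True
        then show ?thesis using eq by (auto dest!: map_eq_conv[THEN iffD1])
      qed (use a in \<open>auto simp: Simplex_iff\<close>)
    qed
  qed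
  moreover have "(\<lambda>\<alpha>. map (lk \<alpha>) [0..<n]) ` Simplex n d \<subseteq> {xs. set xs \<subseteq> {..d} \<and> length xs = n}"
  proof clarsimp
    fix \<alpha> i assume a: "\<alpha> \<in> Simplex n d" and i: "i < n"
    have "lk \<alpha> i \<le> (\<Sum>i<n. lk \<alpha> i)" using i by (intro member_le_sum) auto
    then show "lk \<alpha> i \<le> d" using a by (simp add: Simplex_iff)
  qed
  moreover have "finite {xs. set xs \<subseteq> {..d} \<and> length xs = n}"
    by (rule finite_lists_length_eq) simp
  ultimately show ?thesis by (rule inj_on_finite)
qed

lemma expo_fact_superset:
  assumes "finite K" "Poly_Mapping.keys \<alpha> \<subseteq> K"
  shows "expo_fact \<alpha> = (\<Prod>i\<in>K. fact (lk \<alpha> i))"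
  unfolding expo_fact_def using assms
  by (intro prod.mono_neutral_left) (auto simp: in_keys_iff)

lemma expo_fact_pos: "expo_fact \<alpha> > 0"
  unfolding expo_fact_def by (intro prod_pos) auto

lemma expo_fact_0 [simp]: "expo_fact 0 = 1"
  by (simp add: expo_fact_def)

lemma expo_fact_add_unit: "expo_fact (\<alpha> + unit_expo i) = expo_fact \<alpha> * (real (lk \<alpha> i) + 1)"
proof -
  define K where "K = insert i (Poly_Mapping.keys \<alpha>)"
  have K: "finite K" "Poly_Mapping.keys \<alpha> \<subseteq> K" "Poly_Mapping.keys (\<alpha> + unit_expo i) \<subseteq> K"
    using keys_add[of \<alpha> "unit_expo i"] by (auto simp: K_def)
  have "expo_fact (\<alpha> + unit_expo i) = fact (lk \<alpha> i + 1) * (\<Prod>k\<in>K - {i}. fact (lk (\<alpha> + unit_expo i) k))"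
    unfolding expo_fact_superset[OF K(1,3)] using K by (subst prod.remove[of _ i]) (auto simp: K_def lookup_add)
  also have "(\<Prod>k\<in>K - {i}. fact (lk (\<alpha> + unit_expo i) k)) = (\<Prod>k\<in>K - {i}. fact (lk \<alpha> k) :: real)"
    by (intro prod.cong) (auto simp: lookup_add lookup_unit)
  also have "fact (lk \<alpha> i + 1) = (real (lk \<alpha> i) + 1) * fact (lk \<alpha> i)"
    by (simp only: Suc_eq_plus1[symmetric] fact_Suc) simp
  also have "(real (lk \<alpha> i) + 1) * fact (lk \<alpha> i) * (\<Prod>k\<in>K - {i}. fact (lk \<alpha> k))
     = (real (lk \<alpha> i) + 1) * (\<Prod>k\<in>K. fact (lk \<alpha> k))"
    using K by (subst prod.remove[of K i]) (auto simp: K_def)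
  finally show ?thesis unfolding expo_fact_superset[OF K(1,2)] by (simp add: mult.commute)
qed

text \<open>
  Multiplying the coefficients by \<open>(\<beta>!)\<^bsup>-t\<^esup>\<close> rescales rows and columns of a Hessian by the same positive
  factors and shrinks its diagonal entries. This holds for every real \<open>t\<close>; for \<open>t < 0\<close> the diagonal grows.
\<close>

lemma expo_fact_hessian_powr:
  "expo_fact (\<alpha> + unit_expo i + unit_expo j) powr (- t) = expo_fact \<alpha> powr (- t) *
     (real (lk \<alpha> i) + 1) powr (- t) * (real (lk \<alpha> j) + 1) powr (- t) *
     (if i = j then ((real (lk \<alpha> i) + 1) / (real (lk \<alpha> i) + 2)) powr t else 1)"
proof -
  have "expo_fact (\<alpha> + unit_expo i + unit_expo j)
      = expo_fact \<alpha> * (real (lk \<alpha> i) + 1) * (real (lk (\<alpha> + unit_expo i) j) + 1)"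
    by (simp add: expo_fact_add_unit)
  also have "\<dots> powr (- t) = expo_fact \<alpha> powr (- t) * (real (lk \<alpha> i) + 1) powr (- t)
      * (real (lk (\<alpha> + unit_expo i) j) + 1) powr (- t)"
    using expo_fact_pos[of \<alpha>] by (simp add: powr_mult)
  also have "(real (lk (\<alpha> + unit_expo i) j) + 1) powr (- t) = (real (lk \<alpha> j) + 1) powr (- t) *
     (if i = j then ((real (lk \<alpha> i) + 1) / (real (lk \<alpha> i) + 2)) powr t else 1)"
  proof (cases "i = j")
    case True
    have "(real (lk (\<alpha> + unit_expo i) j) + 1) powr (- t) = (real (lk \<alpha> i) + 2) powr (- t)"
      using True by (simp add: lookup_add lookup_unit add.commute)
    also have "\<dots> = (real (lk \<alpha> i) + 1) powr (- t) * ((real (lk \<alpha> i) + 1) / (real (lk \<alpha> i) + 2)) powr t"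
      by (subst powr_divide) (auto simp: powr_minus divide_inverse)
    finally show ?thesis using True by simp
  qed (simp add: lookup_add lookup_unit)
  finally show ?thesis by (simp add: mult_ac)
qed

text \<open>
  Normalized coefficients, so that \<open>f\<close> is the sum of \<open>ncoeff f \<beta> x\<^sup>\<beta> / \<beta>!\<close>; differentiation acts on
  them as a shift.
\<close>

definition ncoeff :: "mpol \<Rightarrow> expo \<Rightarrow> real" where
  "ncoeff f \<beta> = Poly_Mapping.lookup f \<beta> * expo_fact \<beta>"

lemma lookup_pd: "Poly_Mapping.lookup (pd i f) \<beta> = (real (lk \<beta> i) + 1) * Poly_Mapping.lookup f (\<beta> + unit_expo i)"
proof -
  have eq: "\<alpha> = \<beta> + unit_expo i" if "\<alpha> - unit_expo i = \<beta>" "lk \<alpha> i \<noteq> 0" for \<alpha>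
  proof (rule expo_eqI)
    fix k show "lk \<alpha> k = lk (\<beta> + unit_expo i) k"
      using that by (auto simp: lookup_add lookup_minus lookup_unit)
  qed
  have "Poly_Mapping.lookup (pd i f) \<beta> = (\<Sum>\<alpha>\<in>Poly_Mapping.keys f.
      (if \<alpha> = \<beta> + unit_expo i then (real (lk \<beta> i) + 1) * Poly_Mapping.lookup f \<alpha> else 0))"
    unfolding pd_def lookup_sum
  proof (rule sum.cong)
    fix \<alpha> assume "\<alpha> \<in> Poly_Mapping.keys f"
    show "Poly_Mapping.lookup (Poly_Mapping.single (\<alpha> - unit_expo i) (real (lk \<alpha> i) * Poly_Mapping.lookup f \<alpha>)) \<beta>
       = (if \<alpha> = \<beta> + unit_expo i then (real (lk \<beta> i) + 1) * Poly_Mapping.lookup f \<alpha> else 0)"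
    proof (cases "\<alpha> = \<beta> + unit_expo i")
      case True
      then show ?thesis by (simp add: lookup_add)
    next
      case False
      then have "\<alpha> - unit_expo i \<noteq> \<beta> \<or> lk \<alpha> i = 0" using eq by blast
      then show ?thesis using False by (auto simp: lookup_single when_def)
    qed
  qed simp
  also have "\<dots> = (real (lk \<beta> i) + 1) * Poly_Mapping.lookup f (\<beta> + unit_expo i)"
    by (auto simp: in_keys_iff)
  finally show ?thesis .
qed

lemma ncoeff_pd: "ncoeff (pd i f) \<beta> = ncoeff f (\<beta> + unit_expo i)"
  by (simp add: ncoeff_def lookup_pd expo_fact_add_unit)

lemma ncoeff_pd_funpow: "ncoeff ((pd i ^^ k) f) \<beta> = ncoeff f (\<beta> + Poly_Mapping.single i k)"
proof (induction k arbitrary: \<beta>)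
  case (Suc k)
  have "\<beta> + unit_expo i + Poly_Mapping.single i k = \<beta> + Poly_Mapping.single i (Suc k)"
    by (rule expo_eqI) (auto simp: lookup_add lookup_single when_def)
  then show ?case using Suc by (simp add: ncoeff_pd)
qed simp

lemma ncoeff_pd_fold:
  "ncoeff (fold (\<lambda>i. pd i ^^ lk \<alpha> i) [0..<r] f) \<beta> = ncoeff f (\<beta> + (\<Sum>i<r. Poly_Mapping.single i (lk \<alpha> i)))"
proof (induction r arbitrary: \<beta>)
  case (Suc r)
  then show ?case by (simp add: ncoeff_pd_funpow add_ac)
qed simp

lemma sum_single_lookup:
  assumes "\<alpha> \<in> Simplex n m"
  shows "(\<Sum>i<n. Poly_Mapping.single i (lk \<alpha> i)) = \<alpha>"
proof (rule expo_eqI)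
  fix k show "lk (\<Sum>i<n. Poly_Mapping.single i (lk \<alpha> i)) k = lk \<alpha> k"
    using assms by (cases "k < n") (auto simp: lookup_sum lookup_single when_def Simplex_iff)
qed

lemma hessian_pd_expo:
  assumes "\<alpha> \<in> Simplex n m"
  shows "hessian n (pd_expo n \<alpha> f) = mat n n (\<lambda>(i,j). ncoeff f (\<alpha> + unit_expo i + unit_expo j))"
proof -
  have g: "ncoeff (pd_expo n \<alpha> f) \<beta> = ncoeff f (\<beta> + \<alpha>)" for \<beta>
    unfolding pd_expo_def ncoeff_pd_fold sum_single_lookup[OF assms] ..
  have "Poly_Mapping.lookup (pd i (pd j (pd_expo n \<alpha> f))) 0 = ncoeff f (\<alpha> + unit_expo i + unit_expo j)" for i j
  proof -
    have "Poly_Mapping.lookup (pd i (pd j (pd_expo n \<alpha> f))) 0 = ncoeff (pd i (pd j (pd_expo n \<alpha> f))) 0"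
      by (simp add: ncoeff_def)
    also have "\<dots> = ncoeff f (\<alpha> + unit_expo i + unit_expo j)"
      unfolding ncoeff_pd g by (simp add: add_ac)
    finally show ?thesis .
  qed
  then show ?thesis unfolding hessian_def by simp
qed

text \<open>
  The form of degree \<open>d\<close> with normalized coefficients \<open>c\<close>; values of \<open>c\<close> off the simplex are ignored.
\<close>

definition form_of :: "nat \<Rightarrow> nat \<Rightarrow> (expo \<Rightarrow> real) \<Rightarrow> mpol" where
  "form_of n d c = (\<Sum>\<beta>\<in>Simplex n d. Poly_Mapping.single \<beta> (c \<beta> / expo_fact \<beta>))"

lemma lookup_sum_single:
  assumes "finite S"
  shows "Poly_Mapping.lookup (\<Sum>\<beta>\<in>S. Poly_Mapping.single \<beta> (g \<beta>)) \<alpha> = (if \<alpha> \<in> S then g \<alpha> else (0::real))"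
  using assms by (auto simp: lookup_sum lookup_single when_def)

lemma lookup_form_of: "Poly_Mapping.lookup (form_of n d c) \<beta> = (if \<beta> \<in> Simplex n d then c \<beta> / expo_fact \<beta> else 0)"
  unfolding form_of_def by (rule lookup_sum_single[OF finite_Simplex])

lemma lookup_rep_poly:
  "finite J \<Longrightarrow> Poly_Mapping.lookup (rep_poly J \<rho>) \<alpha> = (if \<alpha> \<in> J then \<rho> \<alpha> / expo_fact \<alpha> else 0)"
  unfolding rep_poly_def by (rule lookup_sum_single)

lemma lookup_normalization:
  "Poly_Mapping.lookup (normalization t f) \<alpha> = Poly_Mapping.lookup f \<alpha> / expo_fact \<alpha> powr t"
  unfolding normalization_def by (subst lookup_sum_single) (auto simp: in_keys_iff)

section \<open>Lorentz Hessians and limits of strictly Lorentzian forms\<close>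

text \<open>
  The directional derivative along \<open>v\<close>, on normalized coefficients.
\<close>

definition dderiv :: "nat \<Rightarrow> (nat \<Rightarrow> real) \<Rightarrow> (expo \<Rightarrow> real) \<Rightarrow> expo \<Rightarrow> real" where
  "dderiv n v c \<beta> = (\<Sum>k<n. v k * c (\<beta> + unit_expo k))"

text \<open>
  Normalized coefficients of a nonzero form of degree \<open>m\<close> with nonnegative coefficients.
\<close>

definition effective :: "nat \<Rightarrow> nat \<Rightarrow> (expo \<Rightarrow> real) \<Rightarrow> bool" where
  "effective n m c \<longleftrightarrow> (\<forall>\<beta>. c \<beta> \<ge> 0) \<and> (\<forall>\<beta>. c \<beta> \<noteq> 0 \<longrightarrow> \<beta> \<in> Simplex n m) \<and> (\<exists>\<beta>. c \<beta> \<noteq> 0)"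

text \<open>
  For every \<open>\<alpha>\<close>, the variables that occur in \<open>\<partial>\<^sup>\<alpha> f\<close>, with two of them adjacent if they occur in a common
  monomial, form a connected graph, as long as \<open>\<partial>\<^sup>\<alpha> f\<close> has degree at least \<open>2\<close> (this is what
  \<open>\<gamma>0 \<noteq> 0\<close> expresses). The sets \<open>S\<close> separate the graph. In contrast to connectedness in one fixed
  degree, the property for all \<open>\<alpha>\<close> passes to derivatives along positive vectors at once, since these
  do not change the graphs.
\<close>

definition conn_support :: "(expo \<Rightarrow> real) \<Rightarrow> bool" where
  "conn_support c \<longleftrightarrow> (\<forall>\<alpha> S i0 i1 \<gamma>0 \<gamma>1. i0 \<in> S \<longrightarrow> i1 \<notin> S \<longrightarrow> \<gamma>0 \<noteq> 0 \<longrightarrow>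
      c (\<alpha> + unit_expo i0 + \<gamma>0) \<noteq> 0 \<longrightarrow> c (\<alpha> + unit_expo i1 + \<gamma>1) \<noteq> 0 \<longrightarrow>
      (\<exists>i j \<gamma>. i \<in> S \<and> j \<notin> S \<and> c (\<alpha> + unit_expo i + unit_expo j + \<gamma>) \<noteq> 0))"

text \<open>
  All derivatives of order \<open>m - 2\<close> are Lorentz quadratic forms; meant for \<open>m \<ge> 2\<close>.
\<close>

definition quadrics_lorentz :: "nat \<Rightarrow> nat \<Rightarrow> (expo \<Rightarrow> real) \<Rightarrow> bool" where
  "quadrics_lorentz n m c \<longleftrightarrow>
     (\<forall>\<alpha>\<in>Simplex n (m - 2). lorentz_form n (\<lambda>i j. c (\<alpha> + unit_expo i + unit_expo j)))"

lemma sym_mat_hessian: "sym_mat n (\<lambda>i j. c (\<alpha> + unit_expo i + unit_expo j))"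
  unfolding sym_mat_def by (simp add: add_ac)

lemma dderiv_nonzeroE:
  assumes "dderiv n v c \<beta> \<noteq> 0"
  obtains k where "k < n" "c (\<beta> + unit_expo k) \<noteq> 0"
  using assms unfolding dderiv_def by (metis (no_types, lifting) lessThan_iff mult_zero_right sum.neutral)

lemma dderiv_nonzeroI:
  assumes "\<And>i. i < n \<Longrightarrow> v i > 0" "\<And>\<beta>. c \<beta> \<ge> 0" "k < n" "c (\<beta> + unit_expo k) \<noteq> 0"
  shows "dderiv n v c \<beta> \<noteq> 0"
proof -
  have "c (\<beta> + unit_expo k) > 0" using assms(2)[of "\<beta> + unit_expo k"] assms(4) by simp
  then have "dderiv n v c \<beta> > 0" unfolding dderiv_def
    using assms(1-3) by (intro sum_pos2[of _ k]) (auto simp: less_imp_le)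
  then show ?thesis by simp
qed

lemma expo_has_unit:
  assumes "\<gamma> \<noteq> 0"
  obtains k \<gamma>' where "\<gamma> = \<gamma>' + unit_expo k" "lk \<gamma> k > 0"
proof -
  obtain k where k: "lk \<gamma> k \<noteq> 0" using assms by (metis expo_eqI lookup_zero)
  have "\<gamma> = (\<gamma> - unit_expo k) + unit_expo k"
    using k by (intro expo_eqI) (auto simp: lookup_add lookup_minus lookup_unit)
  then show ?thesis using that k by blast
qed

lemma effective_dderiv:
  assumes e: "effective n (Suc m) c" and v: "\<And>i. i < n \<Longrightarrow> v i > 0"
  shows "effective n m (dderiv n v c)"
  unfolding effective_def
proof (intro conjI allI impI)
  fix \<beta>
  show "dderiv n v c \<beta> \<ge> 0" unfolding dderiv_def
    using e v by (intro sum_nonneg) (auto simp: effective_def less_imp_le)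
  assume "dderiv n v c \<beta> \<noteq> 0"
  then obtain k where "k < n" "c (\<beta> + unit_expo k) \<noteq> 0" by (rule dderiv_nonzeroE)
  then show "\<beta> \<in> Simplex n m" using e Simplex_add_unit by (auto simp: effective_def)
next
  obtain \<beta> where \<beta>: "c \<beta> \<noteq> 0" "\<beta> \<in> Simplex n (Suc m)" using e by (auto simp: effective_def)
  then have "\<beta> \<noteq> 0" by (auto simp: Simplex_iff)
  then obtain k \<beta>' where k: "\<beta> = \<beta>' + unit_expo k" by (rule expo_has_unit)
  then have "k < n" using \<beta> Simplex_add_unitD by blast
  then have "dderiv n v c \<beta>' \<noteq> 0" using e v \<beta> k by (intro dderiv_nonzeroI) (auto simp: effective_def)
  then show "\<exists>\<beta>. dderiv n v c \<beta> \<noteq> 0" by blast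
qed

lemma Simplex_degree_eq:
  assumes "\<beta> + \<gamma> \<in> Simplex n m" "\<beta> + \<gamma>' \<in> Simplex n m"
  shows "(\<Sum>i<n. lk \<gamma> i) = (\<Sum>i<n. lk \<gamma>' i)" "\<gamma> \<in> Simplex n (\<Sum>i<n. lk \<gamma> i)"
  using assms unfolding Simplex_iff by (auto simp: lookup_add sum.distrib)

lemma conn_support_dderiv:
  assumes e: "effective n m c" and c: "conn_support c" and v: "\<And>i. i < n \<Longrightarrow> v i > 0"
  shows "conn_support (dderiv n v c)"
  unfolding conn_support_def
proof (intro allI impI)
  fix \<alpha> S i0 i1 \<gamma>0 \<gamma>1
  assume S: "i0 \<in> S" "i1 \<notin> S" and g0: "\<gamma>0 \<noteq> 0"
    and 0: "dderiv n v c (\<alpha> + unit_expo i0 + \<gamma>0) \<noteq> 0"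
    and 1: "dderiv n v c (\<alpha> + unit_expo i1 + \<gamma>1) \<noteq> 0"
  obtain k0 where k0: "k0 < n" "c (\<alpha> + unit_expo i0 + (\<gamma>0 + unit_expo k0)) \<noteq> 0"
    using dderiv_nonzeroE[OF 0] by (metis add.assoc)
  obtain k1 where k1: "k1 < n" "c (\<alpha> + unit_expo i1 + (\<gamma>1 + unit_expo k1)) \<noteq> 0"
    using dderiv_nonzeroE[OF 1] by (metis add.assoc)
  have ne: "\<gamma>0 + unit_expo k0 \<noteq> 0"
  proof
    assume "\<gamma>0 + unit_expo k0 = 0"
    then have "lk (\<gamma>0 + unit_expo k0) k0 = 0" by simp
    then show False by (simp add: lookup_add)
  qed
  obtain i j \<gamma> where ij: "i \<in> S" "j \<notin> S" "c (\<alpha> + unit_expo i + unit_expo j + \<gamma>) \<noteq> 0"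
    using c[unfolded conn_support_def, rule_format, OF S ne k0(2) k1(2)] by blast
  have s0: "\<alpha> + (unit_expo i0 + (\<gamma>0 + unit_expo k0)) \<in> Simplex n m"
    using e k0 by (auto simp: effective_def add.assoc)
  have s1: "\<alpha> + (unit_expo i + (unit_expo j + \<gamma>)) \<in> Simplex n m"
    using e ij by (auto simp: effective_def add.assoc)
  have lt: "i < n" "j < n" "i0 < n"
    using s0 s1 Simplex_add_unitD(1)[of "\<alpha> + (unit_expo j + \<gamma>)" i n m]
      Simplex_add_unitD(1)[of "\<alpha> + (unit_expo i + \<gamma>)" j n m]
      Simplex_add_unitD(1)[of "\<alpha> + (\<gamma>0 + unit_expo k0)" i0 n m] by (simp_all add: add_ac)
  have "(\<Sum>i<n. lk \<gamma> i) = (\<Sum>i<n. lk \<gamma>0 i)"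
    using Simplex_degree_eq(1)[OF s0 s1] lt k0(1) by (simp add: lookup_add sum.distrib sum_unit)
  moreover have "(\<Sum>i<n. lk \<gamma>0 i) \<noteq> 0"
  proof
    assume z: "(\<Sum>i<n. lk \<gamma>0 i) = 0"
    have "\<gamma>0 \<in> Simplex n (\<Sum>i<n. lk \<gamma>0 i)"
      using Simplex_degree_eq(2)[of "\<alpha> + (unit_expo i0 + unit_expo k0)" \<gamma>0 n m \<gamma>0] s0 by (simp add: add_ac)
    then show False using g0 z Simplex_0 by simp
  qed
  ultimately have "\<gamma> \<noteq> 0" by auto
  then obtain k \<gamma>' where k: "\<gamma> = \<gamma>' + unit_expo k" by (rule expo_has_unit)
  have kn: "k < n"
    using s1 Simplex_add_unitD(1)[of "\<alpha> + (unit_expo i + (unit_expo j + \<gamma>'))" k n m] by (simp add: k add_ac)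
  have "dderiv n v c (\<alpha> + unit_expo i + unit_expo j + \<gamma>') \<noteq> 0"
    using e ij(3) kn v by (intro dderiv_nonzeroI[of _ _ _ k]) (auto simp: effective_def k add.assoc)
  then show "\<exists>i j \<gamma>. i \<in> S \<and> j \<notin> S \<and> dderiv n v c (\<alpha> + unit_expo i + unit_expo j + \<gamma>) \<noteq> 0"
    using ij by blast
qed

lemma quadrics_lorentz_dderiv:
  assumes e: "effective n (Suc m) c" and c: "conn_support c" and q: "quadrics_lorentz n (Suc m) c"
    and v: "\<And>i. i < n \<Longrightarrow> v i > 0" and m: "m \<ge> 2"
  shows "quadrics_lorentz n m (dderiv n v c)"
  unfolding quadrics_lorentz_def
proof
  fix \<alpha> assume a: "\<alpha> \<in> Simplex n (m - 2)"
  let ?T = "\<lambda>k i j. c (\<alpha> + unit_expo i + unit_expo j + unit_expo k)"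
  have "lorentz_form n (\<lambda>i j. \<Sum>k<n. v k * ?T k i j)"
  proof (rule lorentz_form_cubic)
    fix k assume k: "k < n"
    have "Suc m - 2 = Suc (m - 2)" using m by linarith
    then have "\<alpha> + unit_expo k \<in> Simplex n (Suc m - 2)"
      using Simplex_add_unit[OF k, of \<alpha> "m - 2"] a by simp
    then have "lorentz_form n (\<lambda>i j. c (\<alpha> + unit_expo k + unit_expo i + unit_expo j))"
      using q unfolding quadrics_lorentz_def by blast
    then show "lorentz_form n (?T k)" by (simp add: add_ac)
  next
    fix S i0 i1 j0 j1 k0 k1
    assume h: "i0 \<in> S" "i1 \<notin> S" "?T k0 i0 j0 > 0" "?T k1 i1 j1 > 0"
    have ne: "unit_expo j0 + unit_expo k0 \<noteq> 0"
    proof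
      assume "unit_expo j0 + unit_expo k0 = 0"
      then have "lk (unit_expo j0 + unit_expo k0) j0 = 0" by simp
      then show False by (simp add: lookup_add)
    qed
    have h': "c (\<alpha> + unit_expo i0 + (unit_expo j0 + unit_expo k0)) \<noteq> 0"
      "c (\<alpha> + unit_expo i1 + (unit_expo j1 + unit_expo k1)) \<noteq> 0" using h by (simp_all add: add.assoc)
    obtain i j \<gamma> where ij: "i \<in> S" "j \<notin> S" "c (\<alpha> + unit_expo i + unit_expo j + \<gamma>) \<noteq> 0"
      using c[unfolded conn_support_def, rule_format, OF h(1,2) ne h'] by blast
    have s0: "\<alpha> + (unit_expo i0 + (unit_expo j0 + unit_expo k0)) \<in> Simplex n (Suc m)"
      using e h' by (auto simp: effective_def add.assoc)
    have s1: "\<alpha> + (unit_expo i + (unit_expo j + \<gamma>)) \<in> Simplex n (Suc m)"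
      using e ij by (auto simp: effective_def add.assoc)
    have lt: "i < n" "j < n" "i0 < n" "j0 < n" "k0 < n"
      using s0 s1 Simplex_add_unitD(1)[of "\<alpha> + (unit_expo j + \<gamma>)" i n "Suc m"]
        Simplex_add_unitD(1)[of "\<alpha> + (unit_expo i + \<gamma>)" j n "Suc m"]
        Simplex_add_unitD(1)[of "\<alpha> + (unit_expo j0 + unit_expo k0)" i0 n "Suc m"]
        Simplex_add_unitD(1)[of "\<alpha> + (unit_expo i0 + unit_expo k0)" j0 n "Suc m"]
        Simplex_add_unitD(1)[of "\<alpha> + (unit_expo i0 + unit_expo j0)" k0 n "Suc m"] by (simp_all add: add_ac)
    have deg: "(\<Sum>i<n. lk \<gamma> i) = 1"
      using Simplex_degree_eq(1)[OF s0 s1] lt by (simp add: lookup_add sum.distrib sum_unit)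
    then have "\<gamma> \<noteq> 0" by auto
    then obtain k \<gamma>' where k: "\<gamma> = \<gamma>' + unit_expo k" by (rule expo_has_unit)
    have kn: "k < n"
      using s1 Simplex_add_unitD(1)[of "\<alpha> + (unit_expo i + (unit_expo j + \<gamma>'))" k n "Suc m"] by (simp add: k add_ac)
    have "\<gamma> \<in> Simplex n 1"
      using Simplex_degree_eq(2)[of "\<alpha> + (unit_expo i + unit_expo j)" \<gamma> n "Suc m" \<gamma>] s1 deg by (simp add: add_ac)
    then have "\<gamma>' = 0" using Simplex_add_unitD(3)[of \<gamma>' k n 1] Simplex_0 by (simp add: k)
    then have "?T k i j \<noteq> 0" using ij by (simp add: k)
    then have "?T k i j > 0" using e by (simp add: effective_def less_le)
    then show "\<exists>i<n. \<exists>j<n. \<exists>k<n. i \<in> S \<and> j \<notin> S \<and> ?T k i j > 0" using ij lt kn by blast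
  qed (use e v in \<open>auto simp: effective_def add_ac\<close>)
  then show "lorentz_form n (\<lambda>i j. dderiv n v c (\<alpha> + unit_expo i + unit_expo j))"
    by (simp add: dderiv_def)
qed

text \<open>
  The iterated derivative with multiplicity \<open>lk \<beta> i\<close> along \<open>V i\<close>. For \<open>\<beta>\<close> of degree \<open>d\<close> its value at
  \<open>0\<close> is the normalized coefficient at \<open>\<beta>\<close> of the form that arises from a form of degree \<open>d\<close>
  by substituting \<open>\<Sum>\<^sub>i x\<^sub>i V i\<close> for the vector of variables.
\<close>

definition mderiv :: "nat \<Rightarrow> (nat \<Rightarrow> nat \<Rightarrow> real) \<Rightarrow> expo \<Rightarrow> (expo \<Rightarrow> real) \<Rightarrow> expo \<Rightarrow> real" where
  "mderiv n V \<beta> c = fold (\<lambda>i. dderiv n (V i) ^^ lk \<beta> i) [0..<n] c"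

lemma dderiv_commute: "dderiv n v (dderiv n w c) = dderiv n w (dderiv n v c)"
proof
  fix \<beta>
  have "dderiv n v (dderiv n w c) \<beta> = (\<Sum>k<n. \<Sum>l<n. v k * w l * c (\<beta> + unit_expo k + unit_expo l))"
    by (simp add: dderiv_def sum_distrib_left mult.assoc)
  also have "\<dots> = (\<Sum>l<n. \<Sum>k<n. v k * w l * c (\<beta> + unit_expo k + unit_expo l))" by (rule sum.swap)
  also have "\<dots> = dderiv n w (dderiv n v c) \<beta>"
    by (simp add: dderiv_def sum_distrib_left mult_ac add_ac)
  finally show "dderiv n v (dderiv n w c) \<beta> = dderiv n w (dderiv n v c) \<beta>" .
qed

lemma funpow_commute:
  assumes "\<And>x. f (g x) = g (f x)"
  shows "(f ^^ m) (g x) = g ((f ^^ m) x)"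
  by (induction m) (auto simp: assms)

lemma fold_funpow_add_unit:
  assumes comm: "\<And>i j x. T i (T j x) = T j (T i x)" and k: "k < r"
  shows "fold (\<lambda>i. T i ^^ lk (\<beta> + unit_expo k) i) [0..<r] x = T k (fold (\<lambda>i. T i ^^ lk \<beta> i) [0..<r] x)"
  using k
proof (induction r)
  case (Suc r)
  have s: "lk (\<beta> + unit_expo k) i = (if i = k then Suc (lk \<beta> i) else lk \<beta> i)" for i
    by (simp add: lookup_add lookup_unit)
  show ?case
  proof (cases "k = r")
    case True
    have "fold (\<lambda>i. T i ^^ lk (\<beta> + unit_expo k) i) [0..<r] x = fold (\<lambda>i. T i ^^ lk \<beta> i) [0..<r] x"
      by (rule fold_cong) (auto simp: lookup_add lookup_unit True)
    then show ?thesis using True s[of r] by simp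
  next
    case False
    then show ?thesis using Suc by (simp add: s[of r] funpow_commute[where f = "T r" and g = "T k", OF comm])
  qed
qed simp

lemma mderiv_add_unit:
  "k < n \<Longrightarrow> mderiv n V (\<beta> + unit_expo k) c = dderiv n (V k) (mderiv n V \<beta> c)"
  unfolding mderiv_def by (rule fold_funpow_add_unit[where T = "\<lambda>i. dderiv n (V i)"]) (rule dderiv_commute)

lemma fold_funpow_preserves:
  assumes step: "\<And>i m c. i < r \<Longrightarrow> m \<ge> lo \<Longrightarrow> Q (Suc m) c \<Longrightarrow> Q m (T i c)"
    and Q: "Q (m + (\<Sum>i<r. lk \<beta> i)) c" and m: "m \<ge> lo"
  shows "Q m (fold (\<lambda>i. T i ^^ lk \<beta> i) [0..<r] c)"
  using Q m step
proof (induction r arbitrary: m)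
  case (Suc r)
  have pw: "Q (m' + p) c' \<Longrightarrow> m' \<ge> lo \<Longrightarrow> Q m' ((T r ^^ p) c')" for p m' c'
  proof (induction p arbitrary: m')
    case (Suc p)
    have "Q (Suc m') ((T r ^^ p) c')" using Suc by (intro Suc.IH) auto
    then show ?case using Suc.prems \<open>\<And>i m c. i < Suc r \<Longrightarrow> m \<ge> lo \<Longrightarrow> Q (Suc m) c \<Longrightarrow> Q m (T i c)\<close> by simp
  qed simp
  have "Q (m + lk \<beta> r) (fold (\<lambda>i. T i ^^ lk \<beta> i) [0..<r] c)"
    using Suc.prems by (intro Suc.IH) (auto simp: add_ac)
  then show ?case using pw Suc.prems by simp
qed simp

text \<open>
  Derivatives along vectors that converge to the unit vectors converge to shifts, which is why the
  substituted forms converge coefficientwise to the original one.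
\<close>

lemma mderiv_tendsto:
  assumes c: "\<And>\<beta>. (\<lambda>s. c s \<beta>) \<longlonglongrightarrow> c' \<beta>"
    and V: "\<And>i k. i < n \<Longrightarrow> (\<lambda>s. V s i k) \<longlonglongrightarrow> (if k = i then 1 else 0)" and r: "r \<le> n"
  shows "(\<lambda>s. fold (\<lambda>i. dderiv n (V s i) ^^ lk \<alpha> i) [0..<r] (c s) \<beta>)
     \<longlonglongrightarrow> c' (\<beta> + (\<Sum>i<r. Poly_Mapping.single i (lk \<alpha> i)))"
  using r
proof (induction r arbitrary: \<beta>)
  case (Suc r)
  have pw: "(\<lambda>s. (dderiv n (V s r) ^^ p) (g s) \<beta>) \<longlonglongrightarrow> g' (\<beta> + Poly_Mapping.single r p)"
    if g: "\<And>\<beta>. (\<lambda>s. g s \<beta>) \<longlonglongrightarrow> g' \<beta>" for p g g' \<beta>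
  proof (induction p arbitrary: \<beta>)
    case (Suc p)
    have "(\<lambda>s. \<Sum>k<n. V s r k * (dderiv n (V s r) ^^ p) (g s) (\<beta> + unit_expo k))
       \<longlonglongrightarrow> (\<Sum>k<n. (if k = r then 1 else 0) * g' (\<beta> + unit_expo k + Poly_Mapping.single r p))"
      using \<open>Suc r \<le> n\<close> by (intro tendsto_intros V Suc.IH) auto
    also have "(\<Sum>k<n. (if k = r then 1 else 0) * g' (\<beta> + unit_expo k + Poly_Mapping.single r p))
        = (\<Sum>k<n. if k = r then g' (\<beta> + unit_expo k + Poly_Mapping.single r p) else 0)"
      by (intro sum.cong) auto
    also have "\<dots> = g' (\<beta> + unit_expo r + Poly_Mapping.single r p)"
      using \<open>Suc r \<le> n\<close> by simp
    also have "\<beta> + unit_expo r + Poly_Mapping.single r p = \<beta> + Poly_Mapping.single r (Suc p)"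
      by (rule expo_eqI) (auto simp: lookup_add lookup_single when_def)
    finally show ?case by (simp add: dderiv_def)
  qed (use g in simp)
  have "(\<lambda>s. (dderiv n (V s r) ^^ lk \<alpha> r) (fold (\<lambda>i. dderiv n (V s i) ^^ lk \<alpha> i) [0..<r] (c s)) \<beta>)
     \<longlonglongrightarrow> c' (\<beta> + Poly_Mapping.single r (lk \<alpha> r) + (\<Sum>i<r. Poly_Mapping.single i (lk \<alpha> i)))"
    by (rule pw) (use Suc in simp)
  then show ?case by (simp add: add_ac)
qed (use c in simp)

lemma strictly_Lorentzian_iff:
  assumes d: "d \<ge> 2"
  shows "strictly_Lorentzian n d f \<longleftrightarrow> homogeneous n d f \<and> (\<forall>\<alpha>. Poly_Mapping.lookup f \<alpha> \<ge> 0) \<and>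
    (\<forall>\<alpha>\<in>Simplex n (d - 2). let E = eigenvalues_mset (mat n n (\<lambda>(i,j). ncoeff f (\<alpha> + unit_expo i + unit_expo j))) in
          size (filter_mset (\<lambda>x. x > 0) E) = 1 \<and> size (filter_mset (\<lambda>x. x < 0) E) = n - 1)"
  unfolding strictly_Lorentzian_def using d by (auto simp: hessian_pd_expo)

lemma Simplex_hessian:
  assumes "\<alpha> \<in> Simplex n (d - 2)" "d \<ge> 2" "i < n" "j < n"
  shows "\<alpha> + unit_expo i + unit_expo j \<in> Simplex n d"
proof -
  have "d = Suc (Suc (d - 2))" using assms by simp
  then show ?thesis using Simplex_add_unit[OF assms(4), of "\<alpha> + unit_expo i" "Suc (d - 2)"]
    Simplex_add_unit[OF assms(3), of \<alpha> "d - 2"] assms(1) by simp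
qed

text \<open>
  Shrinking the diagonal of a positive Lorentz matrix makes it nondegenerate: on the hyperplane
  orthogonal to \<open>C (1, \<dots>, 1)\<close> the form of \<open>C\<close> is nonpositive, and a negative definite diagonal form is
  added to it.
\<close>

lemma strict_eigenvalue_count:
  assumes n: "n \<ge> 1" and s: "sym_mat n C" and pos: "\<And>i j. i < n \<Longrightarrow> j < n \<Longrightarrow> C i j > 0"
    and l: "lorentz_form n C" and K: "K > 0" and g: "\<And>i. i < n \<Longrightarrow> g i > 0"
    and \<kappa>: "\<And>i. i < n \<Longrightarrow> 0 < \<kappa> i \<and> \<kappa> i < 1"
    and A: "\<And>i j. i < n \<Longrightarrow> j < n \<Longrightarrow> A i j = K * g i * g j * (if i = j then \<kappa> i else 1) * C i j"
  shows "size (filter_mset (\<lambda>x. x > 0) (eigenvalues_mset (mat n n (\<lambda>(i,j). A i j)))) = 1"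
    and "size (filter_mset (\<lambda>x. x < 0) (eigenvalues_mset (mat n n (\<lambda>(i,j). A i j)))) = n - 1"
proof -
  have sA: "sym_mat n A" using s by (auto simp: sym_mat_def A)
  have Af: "bform n A x x = K * (bform n C (\<lambda>i. g i * x i) (\<lambda>i. g i * x i)
       - (\<Sum>i<n. (1 - \<kappa> i) * C i i * (g i * x i)\<^sup>2))" for x
  proof -
    have "bform n A x x = (\<Sum>i<n. \<Sum>j<n. K * (C i j * (g i * x i) * (g j * x j)
        - (if i = j then (1 - \<kappa> i) * C i i * (g i * x i)\<^sup>2 else 0)))"
      unfolding bform_def by (intro sum.cong refl) (auto simp: A power2_eq_square algebra_simps)
    then show ?thesis by (simp add: bform_def sum_subtractf flip: sum_distrib_left)
  qed
  have Apos: "A i j > 0" if "i < n" "j < n" for i j using A pos K g \<kappa> that by simp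
  have p: "bform n B (\<lambda>_. 1) (\<lambda>_. 1) > 0" if "\<And>i j. i < n \<Longrightarrow> j < n \<Longrightarrow> B i j > (0::real)" for B
    unfolding bform_def using n that by (intro sum_pos) (auto simp: lessThan_empty_iff)
  define u where "u i = (\<Sum>j<n. C i j) * g i" for i
  have neg: "bform n A x x < 0" if x: "(\<Sum>i<n. u i * x i) = 0" "\<exists>i<n. x i \<noteq> 0" for x
  proof -
    have "bform n C (\<lambda>i. g i * x i) (\<lambda>_. 1) = (\<Sum>i<n. u i * x i)"
      unfolding bform_eq_sum u_def by (intro sum.cong) (auto simp: mult_ac)
    then have "bform n C (\<lambda>i. g i * x i) (\<lambda>i. g i * x i) \<le> 0"
      using lorentz_formD[OF l p[OF pos]] x by simp
    moreover obtain i where i: "i < n" "x i \<noteq> 0" using x by auto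
    have "(\<Sum>i<n. (1 - \<kappa> i) * C i i * (g i * x i)\<^sup>2) > 0"
    proof (rule sum_pos2[of _ i])
      show "0 < (1 - \<kappa> i) * C i i * (g i * x i)\<^sup>2"
        using i \<kappa>[OF i(1)] pos[OF i(1) i(1)] g[OF i(1)] by simp
      show "0 \<le> (1 - \<kappa> k) * C k k * (g k * x k)\<^sup>2" if "k \<in> {..<n}" for k
        using that \<kappa>[of k] pos[of k k] by simp
    qed (use i in auto)
    ultimately show ?thesis unfolding Af using K by (intro mult_pos_neg) auto
  qed
  show "size (filter_mset (\<lambda>x. x > 0) (eigenvalues_mset (mat n n (\<lambda>(i,j). A i j)))) = 1"
    by (rule negative_definite_imp_eigenvalue_count(1)[OF sA neg p[OF Apos]])
  show "size (filter_mset (\<lambda>x. x < 0) (eigenvalues_mset (mat n n (\<lambda>(i,j). A i j)))) = n - 1"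
    by (rule negative_definite_imp_eigenvalue_count(2)[OF sA neg p[OF Apos]])
qed

text \<open>
  The approximating forms \<open>F s\<close> arise from \<open>f\<close> by the substitution with the columns \<open>e\<^sub>i + \<epsilon> (1, \<dots>, 1)\<close>,
  which makes all coefficients positive and keeps the Hessians Lorentz, followed by division of the
  coefficients by \<open>(\<beta>!)\<^sup>\<epsilon>\<close>, which makes the Hessians nondegenerate.
\<close>

theorem Lorentzian_of_quadrics:
  assumes n: "n \<ge> 1" and d: "d \<ge> 2" and h: "homogeneous n d f"
    and e: "effective n d (ncoeff f)" and c: "conn_support (ncoeff f)" and q: "quadrics_lorentz n d (ncoeff f)"
  shows "Lorentzian n d f"
proof -
  define \<epsilon> :: "nat \<Rightarrow> real" where "\<epsilon> s = 1 / real (Suc s)" for s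
  have \<epsilon>: "\<epsilon> s > 0" for s by (simp add: \<epsilon>_def)
  have \<epsilon>0: "\<epsilon> \<longlonglongrightarrow> 0" unfolding \<epsilon>_def by (rule LIMSEQ_Suc[OF lim_1_over_n])
  define V where "V s i k = (if k = i then 1 else 0) + \<epsilon> s" for s and i k :: nat
  have V: "V s i k > 0" for s i k using \<epsilon>[of s] by (auto simp: V_def add_pos_pos)
  let ?D = "\<lambda>s \<beta>. mderiv n (V s) \<beta> (ncoeff f)"
  define C where "C s \<beta> = ?D s \<beta> 0 * expo_fact \<beta> powr (- \<epsilon> s)" for s \<beta>
  define F where "F s = form_of n d (C s)" for s
  have eff: "effective n (d - m) (?D s \<beta>)" if "\<beta> \<in> Simplex n m" "m \<le> d" for s \<beta> m
    unfolding mderiv_def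
  proof (rule fold_funpow_preserves[where lo = 0 and Q = "effective n" and T = "\<lambda>i. dderiv n (V s i)"])
    show "effective n (d - m + (\<Sum>i<n. lk \<beta> i)) (ncoeff f)" using e that by (simp add: Simplex_iff)
  qed (use V in \<open>auto intro!: effective_dderiv\<close>)
  have Dpos: "?D s \<beta> 0 > 0" if "\<beta> \<in> Simplex n d" for s \<beta>
    using eff[OF that, of s] Simplex_0 by (fastforce simp: effective_def less_le)
  have LF: "lorentz_form n (\<lambda>k l. ?D s \<alpha> (unit_expo k + unit_expo l))" if a: "\<alpha> \<in> Simplex n (d - 2)" for s \<alpha>
  proof -
    let ?Q = "\<lambda>m c. effective n m c \<and> conn_support c \<and> quadrics_lorentz n m c"
    have "?Q 2 (?D s \<alpha>)" unfolding mderiv_def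
    proof (rule fold_funpow_preserves[where lo = 2 and Q = ?Q and T = "\<lambda>i. dderiv n (V s i)"])
      have "2 + (\<Sum>i<n. lk \<alpha> i) = d" using a d by (simp add: Simplex_iff)
      then show "?Q (2 + (\<Sum>i<n. lk \<alpha> i)) (ncoeff f)" using e c q by simp
      show "?Q m (dderiv n (V s i) c)" if "i < n" "2 \<le> m" "?Q (Suc m) c" for i m c
        using that V by (intro conjI effective_dderiv conn_support_dderiv quadrics_lorentz_dderiv) auto
    qed simp
    then have "lorentz_form n (\<lambda>k l. ?D s \<alpha> (0 + unit_expo k + unit_expo l))"
      unfolding quadrics_lorentz_def using Simplex_0[of 0 n] by (simp del: add_0)
    then show ?thesis by simp
  qed
  have strict: "strictly_Lorentzian n d (F s)" for s
    unfolding strictly_Lorentzian_iff[OF d]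
  proof (intro conjI allI ballI)
    show "homogeneous n d (F s)"
      unfolding homogeneous_def F_def by (auto simp: in_keys_iff lookup_form_of split: if_splits)
    fix \<alpha>
    show "Poly_Mapping.lookup (F s) \<alpha> \<ge> 0"
      using Dpos[of \<alpha> s] expo_fact_pos[of \<alpha>] by (simp add: F_def lookup_form_of C_def less_imp_le)
  next
    fix \<alpha> assume a: "\<alpha> \<in> Simplex n (d - 2)"
    define H where "H i j = ?D s (\<alpha> + unit_expo i + unit_expo j) 0" for i j
    have Hcong: "H i j = (\<Sum>k<n. \<Sum>l<n. V s i k * V s j l * ?D s \<alpha> (unit_expo k + unit_expo l))"
      if "i < n" "j < n" for i j
    proof -
      have "H i j = (\<Sum>l<n. \<Sum>k<n. V s i k * V s j l * ?D s \<alpha> (unit_expo k + unit_expo l))"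
        unfolding H_def mderiv_add_unit[OF that(2)] mderiv_add_unit[OF that(1)] dderiv_def
        by (simp add: sum_distrib_left mult_ac add.commute)
      also have "\<dots> = (\<Sum>k<n. \<Sum>l<n. V s i k * V s j l * ?D s \<alpha> (unit_expo k + unit_expo l))"
        by (rule sum.swap)
      finally show ?thesis .
    qed
    have LH: "lorentz_form n H"
    proof -
      have "lorentz_form n H = lorentz_form n (\<lambda>i j. \<Sum>k<n. \<Sum>l<n. V s i k * V s j l * ?D s \<alpha> (unit_expo k + unit_expo l))"
        by (rule lorentz_form_cong) (rule Hcong)
      then show ?thesis using lorentz_form_congruence[OF LF[OF a, of s], of n "V s"] by simp
    qed
    have Hpos: "H i j > 0" if "i < n" "j < n" for i j
      unfolding H_def by (rule Dpos[OF Simplex_hessian[OF a d that]])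
    have sH: "sym_mat n H" by (auto simp: sym_mat_def H_def add_ac)
    have A: "ncoeff (F s) (\<alpha> + unit_expo i + unit_expo j)
       = expo_fact \<alpha> powr (- \<epsilon> s) * (real (lk \<alpha> i) + 1) powr (- \<epsilon> s) * (real (lk \<alpha> j) + 1) powr (- \<epsilon> s) *
         (if i = j then ((real (lk \<alpha> i) + 1) / (real (lk \<alpha> i) + 2)) powr \<epsilon> s else 1) * H i j"
      if "i < n" "j < n" for i j
    proof -
      have "ncoeff (F s) (\<alpha> + unit_expo i + unit_expo j) = C s (\<alpha> + unit_expo i + unit_expo j)"
        using Simplex_hessian[OF a d that] expo_fact_pos[of "\<alpha> + unit_expo i + unit_expo j"]
        by (simp add: ncoeff_def F_def lookup_form_of)
      then show ?thesis unfolding C_def expo_fact_hessian_powr H_def by simp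
    qed
    have \<kappa>: "0 < ((real (lk \<alpha> i) + 1) / (real (lk \<alpha> i) + 2)) powr \<epsilon> s \<and>
        ((real (lk \<alpha> i) + 1) / (real (lk \<alpha> i) + 2)) powr \<epsilon> s < 1" for i
    proof -
      have "((real (lk \<alpha> i) + 1) / (real (lk \<alpha> i) + 2)) powr \<epsilon> s < 1 powr \<epsilon> s"
        using \<epsilon> by (intro powr_less_mono2) auto
      then show ?thesis by auto
    qed
    note cnt = strict_eigenvalue_count[OF n sH Hpos LH _ _ \<kappa> A]
    show "let E = eigenvalues_mset (mat n n (\<lambda>(i,j). ncoeff (F s) (\<alpha> + unit_expo i + unit_expo j))) in
          size (filter_mset (\<lambda>x. x > 0) E) = 1 \<and> size (filter_mset (\<lambda>x. x < 0) E) = n - 1"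
      unfolding Let_def by (intro conjI cnt) (use expo_fact_pos[of \<alpha>] in auto)
  qed
  have lim: "(\<lambda>s. Poly_Mapping.lookup (F s) \<alpha>) \<longlonglongrightarrow> Poly_Mapping.lookup f \<alpha>" if a: "\<alpha> \<in> Simplex n d" for \<alpha>
  proof -
    have "(\<lambda>s. V s i k) \<longlonglongrightarrow> (if k = i then 1 else 0) + 0" for i k
      unfolding V_def by (intro tendsto_intros \<epsilon>0)
    then have "(\<lambda>s. ?D s \<alpha> 0) \<longlonglongrightarrow> ncoeff f (0 + (\<Sum>i<n. Poly_Mapping.single i (lk \<alpha> i)))"
      unfolding mderiv_def by (intro mderiv_tendsto) auto
    then have 1: "(\<lambda>s. ?D s \<alpha> 0) \<longlonglongrightarrow> ncoeff f \<alpha>" unfolding sum_single_lookup[OF a] by simp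
    have "(\<lambda>s. expo_fact \<alpha> powr (- \<epsilon> s)) \<longlonglongrightarrow> expo_fact \<alpha> powr (- 0)"
      using expo_fact_pos[of \<alpha>] by (intro tendsto_intros \<epsilon>0) auto
    then have 2: "(\<lambda>s. expo_fact \<alpha> powr (- \<epsilon> s)) \<longlonglongrightarrow> 1" using expo_fact_pos[of \<alpha>] by simp
    have "(\<lambda>s. ?D s \<alpha> 0 * expo_fact \<alpha> powr (- \<epsilon> s) / expo_fact \<alpha>) \<longlonglongrightarrow> ncoeff f \<alpha> * 1 / expo_fact \<alpha>"
      using expo_fact_pos[of \<alpha>] by (intro tendsto_intros 1 2) auto
    moreover have "ncoeff f \<alpha> * 1 / expo_fact \<alpha> = Poly_Mapping.lookup f \<alpha>"
      using expo_fact_pos[of \<alpha>] by (simp add: ncoeff_def)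
    ultimately show ?thesis using a by (simp add: F_def lookup_form_of C_def)
  qed
  show ?thesis unfolding Lorentzian_def using h strict lim by blast
qed

section \<open>Quadratic inequalities for Lorentz forms\<close>

abbreviation basis_fun :: "nat \<Rightarrow> nat \<Rightarrow> real" where
  "basis_fun a \<equiv> (\<lambda>m. if m = a then 1 else 0)"

lemma sum_basis_fun: "b < n \<Longrightarrow> (\<Sum>j<n. f j * basis_fun b j) = f b"
proof -
  assume b: "b < n"
  have "(\<Sum>j<n. f j * basis_fun b j) = (\<Sum>j<n. if j = b then f j else 0)" by (intro sum.cong) auto
  then show ?thesis using b by simp
qed

lemma bform_basis: "a < n \<Longrightarrow> b < n \<Longrightarrow> bform n A (basis_fun a) (basis_fun b) = A a b"
  unfolding bform_def by (simp add: sum_basis_fun)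

lemma lorentz_form_nonneg:
  assumes l: "lorentz_form n A" and y: "bform n A y y \<ge> 0"
  shows "bform n A x x * bform n A y y \<le> (bform n A x y)\<^sup>2"
  using l y unfolding lorentz_form_def by (cases "bform n A y y = 0") auto

lemma lorentz_diag_diag:
  assumes "lorentz_form n A" "\<And>i j. i < n \<Longrightarrow> j < n \<Longrightarrow> A i j \<ge> 0" "a < n" "k < n"
  shows "A a a * A k k \<le> (A a k)\<^sup>2"
  using lorentz_form_nonneg[OF assms(1), of "basis_fun k" "basis_fun a"] assms by (simp add: bform_basis)

text \<open>
  Test vectors \<open>e\<^sub>a\<close> and \<open>v e\<^sub>k + u e\<^sub>m\<close>; the optimal coefficients \<open>v = A\<^sub>a\<^sub>m\<close> and \<open>u = A\<^sub>a\<^sub>k\<close> are perturbed by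
  \<open>\<epsilon>\<close> because they may vanish.
\<close>

lemma lorentz_diag_off:
  assumes l: "lorentz_form n A" and s: "sym_mat n A"
    and nn: "\<And>i j. i < n \<Longrightarrow> j < n \<Longrightarrow> A i j \<ge> 0" and a: "a < n" "k < n" "m < n"
  shows "A a a * A k m \<le> 2 * A a k * A a m"
proof -
  have eps: "A a a * A k m \<le> 2 * (A a k + \<epsilon>) * (A a m + \<epsilon>)" if e: "\<epsilon> > 0" for \<epsilon>
  proof -
    define u where "u = A a k + \<epsilon>"
    define v where "v = A a m + \<epsilon>"
    have uv: "u > 0" "v > 0" "A a k \<le> u" "A a m \<le> v" using nn a e by (auto simp: u_def v_def add_nonneg_pos)
    let ?x = "\<lambda>i. v * basis_fun k i + u * basis_fun m i"
    have xx: "bform n A ?x ?x = v\<^sup>2 * A k k + 2 * v * u * A k m + u\<^sup>2 * A m m"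
      using a by (subst bform_lincomb[OF s]) (simp add: bform_basis)
    have xa: "bform n A ?x (basis_fun a) = v * A a k + u * A a m"
      using a s by (simp only: bform_add_left bform_scale_left bform_basis) (simp add: sym_mat_def)
    have "(2 * v * u * A k m) * A a a \<le> bform n A ?x ?x * A a a"
      unfolding xx using nn a by (intro mult_right_mono) auto
    also have "\<dots> \<le> (v * A a k + u * A a m)\<^sup>2"
      using lorentz_form_nonneg[OF l, of "basis_fun a" ?x] nn a xa by (simp add: bform_basis)
    also have "\<dots> \<le> (v * u + u * v)\<^sup>2"
      using uv nn a by (intro power_mono add_mono mult_left_mono) (auto intro!: add_nonneg_nonneg)
    finally have "(2 * v * u) * (A a a * A k m) \<le> (2 * v * u) * (2 * u * v)"
      by (simp add: power2_eq_square algebra_simps)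
    then show ?thesis using uv unfolding u_def[symmetric] v_def[symmetric] by simp
  qed
  have "(\<lambda>i. 2 * (A a k + 1 / real (Suc i)) * (A a m + 1 / real (Suc i))) \<longlonglongrightarrow> 2 * (A a k + 0) * (A a m + 0)"
    by (intro tendsto_intros LIMSEQ_Suc[OF lim_1_over_n])
  then have "A a a * A k m \<le> 2 * (A a k + 0) * (A a m + 0)"
    by (rule LIMSEQ_le_const) (intro exI[of _ 0] allI impI eps, simp)
  then show ?thesis by simp
qed

text \<open>
  Test vectors \<open>p e\<^sub>i + q e\<^sub>j\<close> and \<open>r e\<^sub>k + t e\<^sub>m\<close> with positive coefficients. Since the diagonal is
  nonnegative, the reversed Cauchy-Schwarz inequality gives
  \<open>4 p q r t A\<^sub>i\<^sub>j A\<^sub>k\<^sub>m \<le> (p r A\<^sub>i\<^sub>k + q t A\<^sub>j\<^sub>m + p t A\<^sub>i\<^sub>m + q r A\<^sub>j\<^sub>k)\<^sup>2\<close>. The coefficients are chosen such that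
  the first two terms on the right become equal, and so do the last two, up to a perturbation by \<open>\<epsilon>\<close>.
\<close>

lemma lorentz_sqrt_triangle:
  assumes l: "lorentz_form n A" and s: "sym_mat n A"
    and nn: "\<And>i j. i < n \<Longrightarrow> j < n \<Longrightarrow> A i j \<ge> 0" and a: "i < n" "j < n" "k < n" "m < n"
  shows "sqrt (A i j * A k m) \<le> sqrt (A i k * A j m) + sqrt (A i m * A j k)"
proof -
  have eps: "sqrt (A i j * A k m) \<le> sqrt ((A i k + \<epsilon>) * (A j m + \<epsilon>)) + sqrt ((A i m + \<epsilon>) * (A j k + \<epsilon>))"
    if e: "\<epsilon> > 0" for \<epsilon>
  proof -
    define \<alpha> where "\<alpha> = sqrt (A i k + \<epsilon>)"
    define \<beta> where "\<beta> = sqrt (A j m + \<epsilon>)"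
    define \<gamma> where "\<gamma> = sqrt (A i m + \<epsilon>)"
    define \<eta> where "\<eta> = sqrt (A j k + \<epsilon>)"
    have pos: "\<alpha> > 0" "\<beta> > 0" "\<gamma> > 0" "\<eta> > 0" using nn a e
      by (auto simp: \<alpha>_def \<beta>_def \<gamma>_def \<eta>_def add_nonneg_pos)
    have le: "A i k \<le> \<alpha>\<^sup>2" "A j m \<le> \<beta>\<^sup>2" "A i m \<le> \<gamma>\<^sup>2" "A j k \<le> \<eta>\<^sup>2" using nn a e
      by (auto simp: \<alpha>_def \<beta>_def \<gamma>_def \<eta>_def)
    define p where "p = \<beta> * \<eta>"
    define q where "q = \<alpha> * \<gamma>"
    define r where "r = \<beta> * \<gamma>"
    define t where "t = \<alpha> * \<eta>"
    have pq: "p > 0" "q > 0" "r > 0" "t > 0" using pos by (simp_all add: p_def q_def r_def t_def)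
    let ?y = "\<lambda>z. p * basis_fun i z + q * basis_fun j z"
    let ?x = "\<lambda>z. r * basis_fun k z + t * basis_fun m z"
    have yy: "bform n A ?y ?y = p\<^sup>2 * A i i + 2 * p * q * A i j + q\<^sup>2 * A j j"
      using a by (subst bform_lincomb[OF s]) (simp add: bform_basis)
    have xx: "bform n A ?x ?x = r\<^sup>2 * A k k + 2 * r * t * A k m + t\<^sup>2 * A m m"
      using a by (subst bform_lincomb[OF s]) (simp add: bform_basis)
    have sy: "A k i = A i k" "A k j = A j k" "A m i = A i m" "A m j = A j m"
      using s a by (auto simp: sym_mat_def)
    have xy: "bform n A ?x ?y = p * r * A i k + p * t * A i m + q * r * A j k + q * t * A j m"
      using a by (simp only: bform_add_left bform_add_right bform_scale_left bform_scale_right bform_basis sy)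
        (simp add: algebra_simps)
    have yy0: "bform n A ?y ?y \<ge> 2 * p * q * A i j" unfolding yy using nn a by simp
    have xx0: "bform n A ?x ?x \<ge> 2 * r * t * A k m" unfolding xx using nn a by simp
    have p0: "2 * p * q * A i j \<ge> 0" "2 * r * t * A k m \<ge> 0" using pq nn a by auto
    have "(2 * r * t * A k m) * (2 * p * q * A i j) \<le> bform n A ?x ?x * bform n A ?y ?y"
      using yy0 xx0 p0 by (intro mult_mono) auto
    also have "\<dots> \<le> (bform n A ?x ?y)\<^sup>2"
      using yy0 p0 by (intro lorentz_form_nonneg[OF l]) auto
    also have "\<dots> \<le> (p * r * \<alpha>\<^sup>2 + p * t * \<gamma>\<^sup>2 + q * r * \<eta>\<^sup>2 + q * t * \<beta>\<^sup>2)\<^sup>2"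
      unfolding xy using pq nn a le by (intro power_mono add_mono mult_left_mono) auto
    also have "\<dots> = (2 * \<alpha> * \<beta> * \<gamma> * \<eta>)\<^sup>2 * (\<alpha> * \<beta> + \<gamma> * \<eta>)\<^sup>2"
      unfolding p_def q_def r_def t_def by (simp add: power2_eq_square algebra_simps)
    also have "(2 * r * t * A k m) * (2 * p * q * A i j) = (2 * \<alpha> * \<beta> * \<gamma> * \<eta>)\<^sup>2 * (A i j * A k m)"
      unfolding p_def q_def r_def t_def by (simp add: power2_eq_square algebra_simps)
    finally have "A i j * A k m \<le> (\<alpha> * \<beta> + \<gamma> * \<eta>)\<^sup>2" using pos by simp
    then have "sqrt (A i j * A k m) \<le> \<alpha> * \<beta> + \<gamma> * \<eta>" using pos by (intro real_le_lsqrt) (auto simp: nn a)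
    then show ?thesis by (simp add: \<alpha>_def \<beta>_def \<gamma>_def \<eta>_def real_sqrt_mult)
  qed
  have "(\<lambda>z. sqrt ((A i k + 1 / real (Suc z)) * (A j m + 1 / real (Suc z))) + sqrt ((A i m + 1 / real (Suc z)) * (A j k + 1 / real (Suc z))))
      \<longlonglongrightarrow> sqrt ((A i k + 0) * (A j m + 0)) + sqrt ((A i m + 0) * (A j k + 0))"
    by (intro tendsto_intros LIMSEQ_Suc[OF lim_1_over_n])
  then have "sqrt (A i j * A k m) \<le> sqrt ((A i k + 0) * (A j m + 0)) + sqrt ((A i m + 0) * (A j k + 0))"
    by (rule LIMSEQ_le_const) (intro exI[of _ 0] allI impI eps, simp)
  then show ?thesis by simp
qed

text \<open>
  The \<open>T\<^sub>p\<close>-relation becomes weaker as \<open>p\<close> grows, because \<open>x \<mapsto> x\<^sup>r\<close> is subadditive for \<open>r \<le> 1\<close>; here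
  \<open>r = 2/p\<close>.
\<close>

lemma root_triangle_mono:
  fixes x y z p :: real
  assumes "sqrt x \<le> sqrt y + sqrt z" "0 \<le> x" "0 \<le> y" "0 \<le> z" "p \<ge> 2"
  shows "x powr (1/p) \<le> y powr (1/p) + z powr (1/p)"
proof -
  have sub: "(a + b) powr r \<le> a powr r + b powr r" if "0 \<le> a" "0 \<le> b" "0 < r" "r \<le> 1" for a b r :: real
  proof (cases "a + b = 0")
    case False
    then have ab: "a + b > 0" using that by simp
    have f: "u / (a + b) \<le> (u / (a + b)) powr r" if "0 \<le> u" "u \<le> a + b" for u
    proof (cases "u = 0")
      case False
      then have "(u / (a + b)) powr 1 \<le> (u / (a + b)) powr r"
        using that ab \<open>r \<le> 1\<close> by (intro powr_mono') auto
      then show ?thesis using that ab by simp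
    qed simp
    have "1 = a / (a + b) + b / (a + b)" using ab by (simp flip: add_divide_distrib)
    also have "\<dots> \<le> (a / (a + b)) powr r + (b / (a + b)) powr r" using f[of a] f[of b] that by simp
    also have "\<dots> = (a powr r + b powr r) / (a + b) powr r"
      using that ab by (simp add: powr_divide add_divide_distrib)
    finally show ?thesis using ab by (simp add: pos_le_divide_eq)
  qed (use that in \<open>simp add: add_nonneg_eq_0_iff\<close>)
  have sq: "u powr (1/p) = sqrt u powr (2/p)" if "u \<ge> 0" for u
    using that by (simp add: powr_half_sqrt[symmetric] powr_powr)
  have "x powr (1/p) = sqrt x powr (2/p)" using assms by (simp add: sq)
  also have "\<dots> \<le> (sqrt y + sqrt z) powr (2/p)" using assms by (intro powr_mono2) auto
  also have "\<dots> \<le> sqrt y powr (2/p) + sqrt z powr (2/p)" using assms by (intro sub) auto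
  finally show ?thesis using assms by (simp add: sq)
qed

lemma powr_two_le:
  fixes x y p :: real
  assumes "0 \<le> x" "0 \<le> y" "x \<le> 2 powr p * y" "p > 0"
  shows "x powr (1/p) \<le> y powr (1/p) + y powr (1/p)"
proof -
  have "x powr (1/p) \<le> (2 powr p * y) powr (1/p)" using assms by (intro powr_mono2) auto
  also have "\<dots> = 2 * y powr (1/p)" using assms by (simp add: powr_mult powr_powr)
  finally show ?thesis by simp
qed

text \<open>
  The \<open>T\<^sub>p\<close>-relations for a Lorentz matrix whose rows and columns are rescaled and whose diagonal is
  multiplied by positive factors of at most \<open>2\<^sup>t\<close>. If indices coincide, two of the three products are
  equal, and it suffices that the third one exceeds them at most by the factor \<open>2\<^sup>p\<close>.
\<close>

lemma weighted_lorentz_triangle: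
  assumes l: "lorentz_form n C" and s: "sym_mat n C"
    and nn: "\<And>i j. i < n \<Longrightarrow> j < n \<Longrightarrow> C i j \<ge> 0"
    and t: "t > 0" and p: "p \<ge> p_exponent t" and K: "K > 0" and g: "\<And>i. i < n \<Longrightarrow> g i > 0"
    and \<theta>: "\<And>i. i < n \<Longrightarrow> 0 < \<theta> i \<and> \<theta> i \<le> 2 powr t"
    and M: "\<And>i j. i < n \<Longrightarrow> j < n \<Longrightarrow> M i j = K * g i * g j * (if i = j then \<theta> i else 1) * C i j"
    and a: "i < n" "j < n" "k < n" "m < n"
  shows "(M i j * M k m) powr (1/p) \<le> (M i k * M j m) powr (1/p) + (M i m * M j k) powr (1/p)"
proof -
  have p2: "p \<ge> 2" "p \<ge> 2 * t" using p by (auto simp: p_exponent_def)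
  have Cs: "C x y = C y x" if "x < n" "y < n" for x y using s that by (simp add: sym_mat_def)
  have Ms: "M x y = M y x" if "x < n" "y < n" for x y using Cs[OF that] that by (simp add: M)
  have M0: "M x y \<ge> 0" if "x < n" "y < n" for x y
    unfolding M[OF that] using that K g[OF that(1)] g[OF that(2)] nn[OF that] \<theta>[OF that(1)] by (auto intro!: mult_nonneg_nonneg)
  have diag: "M x x * M y z \<le> 2 powr p * (M x y * M x z)" if h: "x < n" "y < n" "z < n" "x \<noteq> y" "x \<noteq> z" for x y z
  proof -
    define G where "G = K * g x * g x * K * g y * g z"
    have G: "G > 0" using K g h by (simp add: G_def)
    have rhs: "M x y * M x z = G * (C x y * C x z)" using h by (simp add: M G_def)
    have pos: "C x y * C x z \<ge> 0" using nn h by simp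
    show ?thesis
    proof (cases "y = z")
      case True
      have "\<theta> x * \<theta> y \<le> 2 powr t * 2 powr t" using \<theta>[OF h(1)] \<theta>[OF h(2)] by (intro mult_mono) auto
      also have "\<dots> = 2 powr (2 * t)" by (simp flip: powr_add)
      also have "\<dots> \<le> 2 powr p" using p2 by simp
      finally have th: "\<theta> x * \<theta> y \<le> 2 powr p" .
      have "M x x * M y z = G * ((\<theta> x * \<theta> y) * (C x x * C y y))" using h True by (simp add: M G_def)
      also have "(\<theta> x * \<theta> y) * (C x x * C y y) \<le> 2 powr p * (C x y * C x y)"
        by (rule mult_mono[OF th])
          (use lorentz_diag_diag[OF l nn h(1,2)] nn h in \<open>auto simp: power2_eq_square\<close>)
      finally show ?thesis unfolding rhs using True G by (simp add: algebra_simps)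
    next
      case False
      have "\<theta> x * 2 \<le> 2 powr t * 2 powr 1" using \<theta>[OF h(1)] by simp
      also have "\<dots> = 2 powr (t + 1)" by (simp only: powr_add)
      also have "\<dots> \<le> 2 powr p" using p2 by simp
      finally have th: "\<theta> x * 2 \<le> 2 powr p" .
      have "M x x * M y z = G * (\<theta> x * (C x x * C y z))" using h False by (simp add: M G_def)
      also have "\<theta> x * (C x x * C y z) \<le> \<theta> x * (2 * C x y * C x z)"
        using lorentz_diag_off[OF l s nn h(1-3)] \<theta>[OF h(1)] by (intro mult_left_mono) auto
      also have "\<dots> = (\<theta> x * 2) * (C x y * C x z)" by simp
      also have "\<dots> \<le> 2 powr p * (C x y * C x z)" using th pos by (intro mult_right_mono) auto
      finally show ?thesis unfolding rhs using G by (simp add: algebra_simps)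
    qed
  qed
  consider (1) "i = k" | (2) "i = m" | (3) "j = k" | (4) "j = m"
    | (5) "i = j" "i \<noteq> k" "i \<noteq> m" | (6) "k = m" "k \<noteq> i" "k \<noteq> j"
    | (7) "i \<noteq> j" "i \<noteq> k" "i \<noteq> m" "j \<noteq> k" "j \<noteq> m" "k \<noteq> m" by blast
  then show ?thesis
  proof cases
    case 1 then show ?thesis using Ms[of i j] a by (simp add: mult.commute)
  next
    case 2 then show ?thesis using Ms[of i j] Ms[of i k] a by (simp add: mult.commute)
  next
    case 3 then show ?thesis using a by simp
  next
    case 4 then show ?thesis using Ms[of j k] a by simp
  next
    case 5
    then show ?thesis using powr_two_le[OF _ _ diag[of i k m]] M0 a p2 by (simp add: mult.commute)
  next
    case 6
    have "(M k k * M i j) powr (1/p) \<le> (M k i * M k j) powr (1/p) + (M k i * M k j) powr (1/p)"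
      using 6 M0 a p2 by (intro powr_two_le diag) auto
    then show ?thesis using 6 Ms[of k i] Ms[of k j] a by (simp add: mult.commute)
  next
    case 7
    define G where "G = K * g i * g j * K * g k * g m"
    have G: "G > 0" using K g a by (simp add: G_def)
    have eq: "M i j * M k m = G * (C i j * C k m)" "M i k * M j m = G * (C i k * C j m)"
      "M i m * M j k = G * (C i m * C j k)" using 7 a by (simp_all add: M G_def)
    have "(C i j * C k m) powr (1/p) \<le> (C i k * C j m) powr (1/p) + (C i m * C j k) powr (1/p)"
      using lorentz_sqrt_triangle[OF l s nn a] nn a p2 by (intro root_triangle_mono) auto
    then have "G powr (1/p) * (C i j * C k m) powr (1/p)
      \<le> G powr (1/p) * ((C i k * C j m) powr (1/p) + (C i m * C j k) powr (1/p))" by (intro mult_left_mono) auto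
    then show ?thesis unfolding eq using G nn a by (simp add: powr_mult distrib_left)
  qed
qed

section \<open>Weak representations and Lorentzian polynomials\<close>

text \<open>
  Suppose that two elements of \<open>J\<close> above \<open>\<alpha>\<close> exceed \<open>\<alpha>\<close> only inside, respectively only outside of \<open>S\<close>.
  Exchanging for an index outside of \<open>S\<close> changes the first one into an element of \<open>J\<close> that exceeds \<open>\<alpha>\<close>
  both inside and outside of \<open>S\<close>; it still does so inside because of \<open>\<gamma>0 \<noteq> 0\<close>.
\<close>

lemma conn_support_of_M_convex:
  assumes J: "M_convex n d J" and c: "\<And>\<beta>. c \<beta> \<noteq> 0 \<longleftrightarrow> \<beta> \<in> J"
  shows "conn_support c"
  unfolding conn_support_def
proof (intro allI impI, rule ccontr)
  fix \<alpha> S i0 i1 \<gamma>0 \<gamma>1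
  assume S: "i0 \<in> S" "i1 \<notin> S" and g0: "\<gamma>0 \<noteq> 0"
    and c0: "c (\<alpha> + unit_expo i0 + \<gamma>0) \<noteq> 0" and c1: "c (\<alpha> + unit_expo i1 + \<gamma>1) \<noteq> 0"
    and no: "\<not> (\<exists>i j \<gamma>. i \<in> S \<and> j \<notin> S \<and> c (\<alpha> + unit_expo i + unit_expo j + \<gamma>) \<noteq> 0)"
  define a where "a = \<alpha> + unit_expo i0 + \<gamma>0"
  define b where "b = \<alpha> + unit_expo i1 + \<gamma>1"
  have aJ: "a \<in> J" and bJ: "b \<in> J" using c0 c1 c by (auto simp: a_def b_def)
  have no': "\<alpha> + unit_expo i + unit_expo j + \<gamma> \<notin> J" if "i \<in> S" "j \<notin> S" for i j \<gamma>
    using no that c by blast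
  have split: "\<gamma> = (\<gamma> - unit_expo k) + unit_expo k" if "lk \<gamma> k \<noteq> 0" for \<gamma> k
    using that by (intro expo_eqI) (auto simp: lookup_add lookup_minus lookup_unit)
  have g0S: "lk \<gamma>0 j = 0" if "j \<notin> S" for j
  proof (rule ccontr)
    assume "lk \<gamma>0 j \<noteq> 0"
    from split[OF this] have "a = \<alpha> + unit_expo i0 + ((\<gamma>0 - unit_expo j) + unit_expo j)"
      unfolding a_def by (rule arg_cong)
    then have "a = \<alpha> + unit_expo i0 + unit_expo j + (\<gamma>0 - unit_expo j)" by (simp only: add_ac)
    then show False using no'[OF S(1) that] aJ by simp
  qed
  have g1S: "lk \<gamma>1 j = 0" if "j \<in> S" for j
  proof (rule ccontr)
    assume "lk \<gamma>1 j \<noteq> 0"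
    from split[OF this] have "b = \<alpha> + unit_expo i1 + ((\<gamma>1 - unit_expo j) + unit_expo j)"
      unfolding b_def by (rule arg_cong)
    then have "b = \<alpha> + unit_expo j + unit_expo i1 + (\<gamma>1 - unit_expo j)" by (simp only: add_ac)
    then show False using no'[OF that S(2)] bJ by simp
  qed
  have i1n: "i1 < n"
  proof (rule ccontr)
    assume "\<not> i1 < n"
    then have "lk b i1 = 0" using bJ J unfolding M_convex_def by (auto simp: Simplex_iff)
    then show False by (simp add: b_def lookup_add)
  qed
  have "lk a i1 < lk b i1"
    using S g0S[OF S(2)] by (auto simp: a_def b_def lookup_add lookup_unit)
  then obtain j where j: "lk a j > lk b j" "a + unit_expo i1 - unit_expo j \<in> J"
    using J aJ bJ i1n unfolding M_convex_def by meson
  have jS: "j \<in> S"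
  proof (rule ccontr)
    assume "j \<notin> S"
    then have "lk a j = lk \<alpha> j" using S g0S[of j] by (auto simp: a_def lookup_add lookup_unit)
    then show False using j(1) by (simp add: b_def lookup_add)
  qed
  define \<delta> where "\<delta> = unit_expo i0 + \<gamma>0 - unit_expo j"
  have jpos: "lk (unit_expo i0 + \<gamma>0) j \<noteq> 0"
    using j(1) by (auto simp: a_def b_def lookup_add)
  have eq: "a + unit_expo i1 - unit_expo j = \<alpha> + unit_expo i1 + \<delta>"
    using jpos by (intro expo_eqI) (auto simp: a_def \<delta>_def lookup_add lookup_minus lookup_unit)
  obtain k where k: "lk \<delta> k \<noteq> 0"
  proof (rule ccontr)
    assume n: "\<not> thesis"
    then have d0: "\<delta> = 0" using that by (intro expo_eqI) auto
    have e: "unit_expo i0 + \<gamma>0 = \<delta> + unit_expo j" unfolding \<delta>_def by (rule split[OF jpos])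
    then have e': "unit_expo i0 + \<gamma>0 = unit_expo j" using d0 by simp
    have "lk (unit_expo i0 + \<gamma>0) i0 = lk (unit_expo j) i0" using e' by simp
    then have "j = i0" by (auto simp: lookup_add lookup_unit split: if_splits)
    then have "\<gamma>0 = 0" using e' by simp
    then show False using g0 by simp
  qed
  have kS: "k \<in> S"
    using k S g0S[of k] by (auto simp: \<delta>_def lookup_add lookup_minus lookup_unit split: if_splits)
  from split[OF k] have "\<alpha> + unit_expo i1 + \<delta> = \<alpha> + unit_expo i1 + ((\<delta> - unit_expo k) + unit_expo k)"
    by (rule arg_cong)
  then have "\<alpha> + unit_expo i1 + \<delta> = \<alpha> + unit_expo k + unit_expo i1 + (\<delta> - unit_expo k)"
    by (simp only: add_ac)
  then show False using no'[OF kS S(2)] j(2) eq by simp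
qed

lemma triangle_rel_perm:
  "triangle_rel q a b c \<longleftrightarrow> triangle_rel q b a c" "triangle_rel q a b c \<longleftrightarrow> triangle_rel q a c b"
  unfolding triangle_rel_def by auto

lemma triangle_rel_all_of_sorted:
  assumes s: "\<And>i j. M i j = M j i"
    and h: "\<And>i j k l. i \<le> j \<Longrightarrow> j \<le> k \<Longrightarrow> k \<le> l \<Longrightarrow> l < (n::nat) \<Longrightarrow>
      triangle_rel q (M j k * M i l) (M i k * M j l) (M i j * M k l)"
    and a: "i < n" "j < n" "k < n" "l < n"
  shows "triangle_rel q (M j k * M i l) (M i k * M j l) (M i j * M k l)"
proof -
  define Tr where "Tr i j k l \<longleftrightarrow> triangle_rel q (M j k * M i l) (M i k * M j l) (M i j * M k l)" for i j k l
  have s12: "Tr i j k l = Tr j i k l" for i j k l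
    unfolding Tr_def using triangle_rel_perm(1) s[of i j] by (metis mult.commute)
  have s23: "Tr i j k l = Tr i k j l" for i j k l
    unfolding Tr_def using triangle_rel_perm(2) s[of j k] by (metis mult.commute)
  have s34: "Tr i j k l = Tr i j l k" for i j k l
    unfolding Tr_def using triangle_rel_perm(1) s[of k l] by (metis mult.commute)
  have h4: "Tr i j k l" if "i \<le> j" "j \<le> k" "k \<le> l" "l < n" for i j k l
    unfolding Tr_def by (rule h[OF that])
  have h3: "Tr i j k l" if "j \<le> k" "k \<le> l" "l < n" "i < n" for i j k l
  proof -
    consider "i \<le> j" | "j \<le> i" "i \<le> k" | "k \<le> i" "i \<le> l" | "l \<le> i" by linarith
    then show ?thesis
    proof cases
      case 1 then show ?thesis using that h4 by blast
    next
      case 2 then show ?thesis using that h4[of j i k l] s12[of i j k l] by blast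
    next
      case 3 then show ?thesis using that h4[of j k i l] s12[of i j k l] s23[of j i k l] by blast
    next
      case 4 then show ?thesis
        using that h4[of j k l i] s12[of i j k l] s23[of j i k l] s34[of j k i l] by blast
    qed
  qed
  have h2: "Tr i j k l" if "k \<le> l" "l < n" "i < n" "j < n" for i j k l
  proof -
    consider "j \<le> k" | "k \<le> j" "j \<le> l" | "l \<le> j" by linarith
    then show ?thesis
    proof cases
      case 1 then show ?thesis using that h3 by blast
    next
      case 2 then show ?thesis using that h3[of k j l i] s23[of i j k l] by blast
    next
      case 3 then show ?thesis using that h3[of k l j i] s23[of i j k l] s34[of i k j l] by blast
    qed
  qed
  have "Tr i j k l"
  proof (cases "k \<le> l")
    case True then show ?thesis using a h2 by blast
  next
    case False then show ?thesis using a h2[of l k i j] s34[of i j k l] by simp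
  qed
  then show ?thesis by (simp add: Tr_def)
qed

text \<open>
  The triangle relations hold for all indices, not only for sorted ones with \<open>\<delta>\<^sub>J\<^sup>- \<le> \<alpha>\<close> and
  \<open>\<alpha> + e\<^sub>i + e\<^sub>j + e\<^sub>k + e\<^sub>l \<le> \<delta>\<^sub>J\<^sup>+\<close>. If a bound is violated at \<open>m\<close>, then so many values vanish that two
  of the three products are equal and the third one is zero or equal to them.
\<close>

lemma weak_rep_triangle_all:
  assumes J: "finite J" and w: "weak_rep (ereal q) n d J \<rho>" and d: "d \<ge> 2"
    and a: "\<alpha> \<in> Simplex n (d - 2)" and ij: "i < n" "j < n" "k < n" "l < n"
  defines "M \<equiv> \<lambda>i j. \<rho> (\<alpha> + unit_expo i + unit_expo j)"
  shows "triangle_rel q (M j k * M i l) (M i k * M j l) (M i j * M k l)"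
proof -
  have s: "M i j = M j i" for i j by (simp add: M_def add_ac)
  have supp: "\<alpha> + unit_expo i + unit_expo j \<in> J" if "M i j \<noteq> 0" "i < n" "j < n" for i j
    using w Simplex_hessian[OF a d that(2,3)] that(1) unfolding weak_rep_def M_def by blast
  have mn: "delta_min J m \<le> lk \<alpha> m + lk (unit_expo i) m + lk (unit_expo j) m"
    if "M i j \<noteq> 0" "i < n" "j < n" for i j m
    unfolding delta_min_def using J supp[OF that] by (auto intro!: Min_le image_eqI simp: lookup_add)
  have mx: "lk \<alpha> m + lk (unit_expo i) m + lk (unit_expo j) m \<le> delta_max J m"
    if "M i j \<noteq> 0" "i < n" "j < n" for i j m
    unfolding delta_max_def using J supp[OF that] by (auto intro!: Max_ge image_eqI simp: lookup_add)
  show ?thesis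
  proof (rule triangle_rel_all_of_sorted[OF s _ ij])
    fix i j k l assume o: "i \<le> j" "j \<le> k" "k \<le> l" "l < n"
    then have lt: "i < n" "j < n" "k < n" "l < n" by auto
    consider (mid) "\<forall>m<n. delta_min J m \<le> lk \<alpha> m"
        "\<forall>m<n. lk (\<alpha> + unit_expo i + unit_expo j + unit_expo k + unit_expo l) m \<le> delta_max J m"
      | (low) m where "lk \<alpha> m < delta_min J m"
      | (high) m where "delta_max J m < lk (\<alpha> + unit_expo i + unit_expo j + unit_expo k + unit_expo l) m"
      by (meson not_le)
    then show "triangle_rel q (M j k * M i l) (M i k * M j l) (M i j * M k l)"
    proof cases
      case mid
      then have "T_rel (ereal q) (M j k * M i l) (M i k * M j l) (M i j * M k l)"
        using w o a unfolding weak_rep_def M_def by blast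
      then show ?thesis by (simp add: T_rel_def)
    next
      case low
      have z: "M x y = 0" if "x \<noteq> m" "y \<noteq> m" "x < n" "y < n" for x y
        using mn[of x y m] low that by (auto simp: lookup_unit)
      show ?thesis
        using z lt s[of m] unfolding triangle_rel_def
        by (cases "i = m"; cases "j = m"; cases "k = m"; cases "l = m") (simp_all add: s mult.commute)
    next
      case high
      have z: "delta_max J m < lk \<alpha> m + (if x = m then 1 else 0) + (if y = m then 1 else 0) \<longrightarrow> M x y = 0"
        if "x < n" "y < n" for x y
        using mx[of x y m] that by (cases "M x y = 0") (auto simp: lookup_unit)
      have hh: "delta_max J m < lk \<alpha> m + (if i = m then 1 else 0) + (if j = m then 1 else 0)
          + (if k = m then 1 else 0) + (if l = m then 1 else 0)"
        using high by (simp add: lookup_add lookup_unit)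
      show ?thesis
        using hh z[OF lt(1,2)] z[OF lt(1,3)] z[OF lt(1,4)] z[OF lt(2,3)] z[OF lt(2,4)] z[OF lt(3,4)]
        unfolding triangle_rel_def
        by (cases "i = m"; cases "j = m"; cases "k = m"; cases "l = m") (simp_all add: s mult.commute)
    qed
  qed
qed

lemma lorentz_form_rescale:
  assumes l: "lorentz_form n B" and K: "K > 0"
    and A: "\<And>i j. i < n \<Longrightarrow> j < n \<Longrightarrow> A i j = K * g i * g j * B i j"
  shows "lorentz_form n A"
proof -
  have Af: "bform n A x y = K * bform n B (\<lambda>i. g i * x i) (\<lambda>i. g i * y i)" for x y
    unfolding bform_def sum_distrib_left by (intro sum.cong) (auto simp: A)
  show ?thesis unfolding lorentz_form_def
  proof (intro allI impI)
    fix x y assume y: "bform n A y y > 0"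
    let ?x = "\<lambda>i. g i * x i" and ?y = "\<lambda>i. g i * y i"
    have "bform n B ?y ?y > 0" using y K unfolding Af by (simp add: zero_less_mult_iff)
    then have "bform n B ?x ?x * bform n B ?y ?y \<le> (bform n B ?x ?y)\<^sup>2"
      using l unfolding lorentz_form_def by blast
    then have "K\<^sup>2 * (bform n B ?x ?x * bform n B ?y ?y) \<le> K\<^sup>2 * (bform n B ?x ?y)\<^sup>2"
      by (intro mult_left_mono) auto
    then show "bform n A x x * bform n A y y \<le> (bform n A x y)\<^sup>2"
      unfolding Af by (simp add: power2_eq_square algebra_simps)
  qed
qed

lemma M_convex_finite: "M_convex n d J \<Longrightarrow> finite J"
  unfolding M_convex_def using finite_Simplex finite_subset by blast

text \<open>
  The constant \<open>\<kappa>\<close> bounds the factors \<open>((\<alpha>\<^sub>i + 1) / (\<alpha>\<^sub>i + 2))\<^sup>t\<close> that \<open>N\<^sub>t\<close> puts on the diagonals of the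
  Hessians, as \<open>\<alpha>\<^sub>i \<le> d - 2\<close>.
\<close>

theorem weak_reps_subset_Lorentzian:
  assumes n: "n \<ge> 1" and d: "d \<ge> 2" and J: "M_convex n d J" and t: "t > 0"
  shows "\<exists>q0>0. \<forall>q. 0 < q \<longrightarrow> q \<le> q0 \<longrightarrow>
     normalization t ` weak_reps (ereal q) n d J \<subseteq> Lorentzian_set n d J"
proof -
  define \<kappa> where "\<kappa> = ((real d - 1) / real d) powr t"
  have \<kappa>: "0 \<le> \<kappa>" "\<kappa> < 1"
  proof -
    have "((real d - 1) / real d) powr t < 1 powr t" using d t by (intro powr_less_mono2) auto
    then show "\<kappa> < 1" by (simp add: \<kappa>_def)
  qed (simp add: \<kappa>_def)
  obtain q0 :: real where q0: "q0 > 0" and pt: "\<And>q M. 0 < q \<Longrightarrow> q \<le> q0 \<Longrightarrow> sym_mat n M \<Longrightarrow>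
     (\<forall>i<n. \<forall>j<n. 0 \<le> M i j) \<Longrightarrow>
     (\<forall>i<n. \<forall>j<n. \<forall>k<n. \<forall>l<n. (M i j * M k l) powr (1/q)
         \<le> (M i k * M j l) powr (1/q) + (M i l * M j k) powr (1/q)) \<Longrightarrow>
     lorentz_form n (\<lambda>i j. if i = j then \<kappa> * M i i else M i j)"
    using lorentz_form_of_ptolemy[OF \<kappa>, of n] by blast
  have fJ: "finite J" using J by (rule M_convex_finite)
  have JS: "J \<subseteq> Simplex n d" "J \<noteq> {}" using J by (auto simp: M_convex_def)
  have "normalization t (rep_poly J \<rho>) \<in> Lorentzian_set n d J"
    if q: "0 < q" "q \<le> q0" and w: "weak_rep (ereal q) n d J \<rho>" for q \<rho>
  proof -
    define f where "f = normalization t (rep_poly J \<rho>)"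
    have lf: "Poly_Mapping.lookup f \<beta> = (if \<beta> \<in> J then \<rho> \<beta> / expo_fact \<beta> / expo_fact \<beta> powr t else 0)" for \<beta>
      unfolding f_def lookup_normalization by (simp add: lookup_rep_poly[OF fJ])
    have \<rho>0: "\<rho> \<beta> \<ge> 0" if "\<beta> \<in> Simplex n d" for \<beta> using w that by (simp add: weak_rep_def)
    have \<rho>J: "\<rho> \<beta> \<noteq> 0 \<longleftrightarrow> \<beta> \<in> J" if "\<beta> \<in> Simplex n d" for \<beta> using w that by (auto simp: weak_rep_def)
    have nf: "ncoeff f \<beta> = (if \<beta> \<in> J then \<rho> \<beta> * expo_fact \<beta> powr (- t) else 0)" for \<beta>
      using expo_fact_pos[of \<beta>] by (simp add: ncoeff_def lf powr_minus field_simps)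
    have nf': "ncoeff f \<beta> = \<rho> \<beta> * expo_fact \<beta> powr (- t)" if "\<beta> \<in> Simplex n d" for \<beta>
      using \<rho>J[OF that] by (auto simp: nf)
    have nz: "ncoeff f \<beta> \<noteq> 0 \<longleftrightarrow> \<beta> \<in> J" for \<beta>
      using \<rho>J[of \<beta>] JS expo_fact_pos[of \<beta>] by (auto simp: nf)
    have keys: "Poly_Mapping.keys f = J"
    proof -
      have "Poly_Mapping.lookup f \<beta> \<noteq> 0 \<longleftrightarrow> \<beta> \<in> J" for \<beta>
        using nz[of \<beta>] expo_fact_pos[of \<beta>] by (simp add: ncoeff_def)
      then show ?thesis by (auto simp: in_keys_iff)
    qed
    have eff: "effective n d (ncoeff f)"
      unfolding effective_def using nz JS \<rho>0 by (auto simp: nf)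
    have quad: "quadrics_lorentz n d (ncoeff f)"
      unfolding quadrics_lorentz_def
    proof
      fix \<alpha> assume a: "\<alpha> \<in> Simplex n (d - 2)"
      define M where "M = (\<lambda>i j. \<rho> (\<alpha> + unit_expo i + unit_expo j))"
      have sM: "sym_mat n M" unfolding M_def by (rule sym_mat_hessian)
      have M0: "\<forall>i<n. \<forall>j<n. 0 \<le> M i j" using \<rho>0 Simplex_hessian[OF a d] by (auto simp: M_def)
      have l1: "lorentz_form n (\<lambda>i j. if i = j then \<kappa> * M i i else M i j)"
      proof (rule pt[OF q sM M0], intro allI impI)
        fix i j k l assume "i < n" "j < n" "k < n" "l < n"
        then have "triangle_rel q (M j k * M i l) (M i k * M j l) (M i j * M k l)"
          unfolding M_def by (rule weak_rep_triangle_all[OF fJ w d a])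
        then show "(M i j * M k l) powr (1/q) \<le> (M i k * M j l) powr (1/q) + (M i l * M j k) powr (1/q)"
          unfolding triangle_rel_def by (simp add: mult.commute add.commute)
      qed
      define \<kappa>' where "\<kappa>' i = ((real (lk \<alpha> i) + 1) / (real (lk \<alpha> i) + 2)) powr t" for i
      have \<kappa>': "\<kappa>' i \<le> \<kappa>" if "i < n" for i
      proof -
        have "lk \<alpha> i \<le> (\<Sum>i<n. lk \<alpha> i)" using that by (intro member_le_sum) auto
        then have "lk \<alpha> i \<le> d - 2" using a by (simp add: Simplex_iff)
        then have "real (lk \<alpha> i) + 2 \<le> real d" using d by linarith
        then have "(real (lk \<alpha> i) + 1) / (real (lk \<alpha> i) + 2) \<le> (real d - 1) / real d"
          by (simp add: divide_simps) (simp add: algebra_simps)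
        then show ?thesis unfolding \<kappa>_def \<kappa>'_def using t by (intro powr_mono2) auto
      qed
      have "lorentz_form n (\<lambda>i j. (if i = j then \<kappa>' i else 1) * M i j)"
      proof (rule lorentz_form_minus_diag[OF _ l1, of "\<lambda>i. (\<kappa> - \<kappa>' i) * M i i"])
        show "sym_mat n (\<lambda>i j. if i = j then \<kappa> * M i i else M i j)" using sM by (auto simp: sym_mat_def)
        show "0 \<le> (\<kappa> - \<kappa>' i) * M i i" if "i < n" for i using \<kappa>'[OF that] M0 that by simp
      qed (auto simp: algebra_simps)
      then show "lorentz_form n (\<lambda>i j. ncoeff f (\<alpha> + unit_expo i + unit_expo j))"
      proof (rule lorentz_form_rescale[where K = "expo_fact \<alpha> powr (- t)"
            and g = "\<lambda>i. (real (lk \<alpha> i) + 1) powr (- t)"])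
        fix i j assume ij: "i < n" "j < n"
        show "ncoeff f (\<alpha> + unit_expo i + unit_expo j) = expo_fact \<alpha> powr (- t) *
           (real (lk \<alpha> i) + 1) powr (- t) * (real (lk \<alpha> j) + 1) powr (- t) *
           ((if i = j then \<kappa>' i else 1) * M i j)"
          unfolding nf'[OF Simplex_hessian[OF a d ij]] expo_fact_hessian_powr M_def \<kappa>'_def by simp
      qed (use expo_fact_pos[of \<alpha>] in simp)
    qed
    have "homogeneous n d f" using keys JS by (simp add: homogeneous_def)
    then have "Lorentzian n d f"
      using Lorentzian_of_quadrics[OF n d _ eff conn_support_of_M_convex[OF J nz] quad] by blast
    then show ?thesis using keys by (simp add: Lorentzian_set_def f_def)
  qed
  then show ?thesis using q0 unfolding weak_reps_def by (intro exI[of _ q0]) blast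
qed

theorem Lorentzian_subset_weak_reps:
  assumes d: "d \<ge> 2" and t: "t > 0" and p: "ereal (p_exponent t) \<le> p"
  shows "Lorentzian_set n d J \<subseteq> normalization t ` weak_reps p n d J"
proof
  fix f assume "f \<in> Lorentzian_set n d J"
  then have Lf: "Lorentzian n d f" and keys: "Poly_Mapping.keys f = J" by (auto simp: Lorentzian_set_def)
  obtain F where F: "\<And>k. strictly_Lorentzian n d (F k)" and hf: "homogeneous n d f"
    and lim: "\<And>\<alpha>. \<alpha> \<in> Simplex n d \<Longrightarrow> (\<lambda>k. Poly_Mapping.lookup (F k) \<alpha>) \<longlonglongrightarrow> Poly_Mapping.lookup f \<alpha>"
    using Lf unfolding Lorentzian_def by blast
  have fJ: "finite J" using keys by auto
  have f0: "Poly_Mapping.lookup f \<alpha> \<ge> 0" if "\<alpha> \<in> Simplex n d" for \<alpha>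
    by (rule LIMSEQ_le_const[OF lim[OF that]]) (use F in \<open>auto simp: strictly_Lorentzian_def\<close>)
  define \<rho> where "\<rho> \<beta> = ncoeff f \<beta> * expo_fact \<beta> powr t" for \<beta>
  have nf0: "ncoeff f \<alpha> \<ge> 0" if "\<alpha> \<in> Simplex n d" for \<alpha>
    using f0[OF that] expo_fact_pos[of \<alpha>] by (simp add: ncoeff_def less_imp_le)
  have LF: "lorentz_form n (\<lambda>i j. ncoeff f (\<alpha> + unit_expo i + unit_expo j))" if a: "\<alpha> \<in> Simplex n (d - 2)" for \<alpha>
  proof (rule lorentz_form_limit)
    fix k
    show "lorentz_form n (\<lambda>i j. ncoeff (F k) (\<alpha> + unit_expo i + unit_expo j))"
      using F[of k] a unfolding strictly_Lorentzian_iff[OF d] Let_def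
      by (intro eigenvalue_count_imp_lorentz_form sym_mat_hessian) blast
  next
    fix i j assume "i < n" "j < n"
    then show "(\<lambda>k. ncoeff (F k) (\<alpha> + unit_expo i + unit_expo j)) \<longlonglongrightarrow> ncoeff f (\<alpha> + unit_expo i + unit_expo j)"
      unfolding ncoeff_def by (intro tendsto_intros lim Simplex_hessian[OF a d])
  qed
  have pe: "p_exponent t > 0" by (simp add: p_exponent_def)
  have tri: "triangle_rel r (\<rho> (\<alpha> + unit_expo j + unit_expo k) * \<rho> (\<alpha> + unit_expo i + unit_expo l))
          (\<rho> (\<alpha> + unit_expo i + unit_expo k) * \<rho> (\<alpha> + unit_expo j + unit_expo l))
          (\<rho> (\<alpha> + unit_expo i + unit_expo j) * \<rho> (\<alpha> + unit_expo k + unit_expo l))"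
    if a: "\<alpha> \<in> Simplex n (d - 2)" and ij: "i < n" "j < n" "k < n" "l < n" and r: "r \<ge> p_exponent t"
    for \<alpha> i j k l r
  proof -
    define M where "M = (\<lambda>i j. \<rho> (\<alpha> + unit_expo i + unit_expo j))"
    have M: "M i j = expo_fact \<alpha> powr t * (real (lk \<alpha> i) + 1) powr t * (real (lk \<alpha> j) + 1) powr t *
        (if i = j then ((real (lk \<alpha> i) + 1) / (real (lk \<alpha> i) + 2)) powr (- t) else 1) *
        ncoeff f (\<alpha> + unit_expo i + unit_expo j)" for i j
      unfolding M_def \<rho>_def using expo_fact_hessian_powr[of \<alpha> i j "- t"] by simp
    have th: "0 < ((real (lk \<alpha> i) + 1) / (real (lk \<alpha> i) + 2)) powr (- t) \<and>
        ((real (lk \<alpha> i) + 1) / (real (lk \<alpha> i) + 2)) powr (- t) \<le> 2 powr t" for i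
    proof -
      have "((real (lk \<alpha> i) + 1) / (real (lk \<alpha> i) + 2)) powr (- t) = ((real (lk \<alpha> i) + 2) / (real (lk \<alpha> i) + 1)) powr t"
        by (simp add: powr_minus powr_divide)
      also have "\<dots> \<le> 2 powr t" using t by (intro powr_mono2) (auto simp: divide_simps)
      finally show ?thesis by simp
    qed
    have T: "(M i j * M k l) powr (1/r) \<le> (M i k * M j l) powr (1/r) + (M i l * M j k) powr (1/r)"
      if "i < n" "j < n" "k < n" "l < n" for i j k l
      by (rule weighted_lorentz_triangle[OF LF[OF a] sym_mat_hessian _ t r _ _ th M that])
        (use nf0 Simplex_hessian[OF a d] expo_fact_pos[of \<alpha>] in auto)
    have s: "M i j = M j i" for i j by (simp add: M_def add_ac)
    have "triangle_rel r (M j k * M i l) (M i k * M j l) (M i j * M k l)"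
      unfolding triangle_rel_def
      using T[of i j k l] T[of i k j l] T[of j k i l] ij s[of k j] s[of j i] s[of k i] s[of l k]
      by (simp add: mult.commute add.commute)
    then show ?thesis by (simp add: M_def)
  qed
  have "weak_rep p n d J \<rho>"
    unfolding weak_rep_def
  proof (intro conjI ballI allI impI)
    show "\<rho> \<alpha> \<ge> 0" if "\<alpha> \<in> Simplex n d" for \<alpha> using nf0[OF that] by (simp add: \<rho>_def)
    have "\<rho> \<alpha> \<noteq> 0 \<longleftrightarrow> \<alpha> \<in> J" for \<alpha>
      using expo_fact_pos[of \<alpha>] by (simp add: \<rho>_def ncoeff_def flip: keys) (simp add: in_keys_iff)
    then show "{\<alpha> \<in> Simplex n d. \<rho> \<alpha> \<noteq> 0} = J" using hf keys by (auto simp: homogeneous_def)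
    fix \<alpha> i j k l assume a: "\<alpha> \<in> Simplex n (d - 2)" and ij: "i \<le> j \<and> j \<le> k \<and> k \<le> l \<and> l < n"
    have lt: "i < n" "j < n" "k < n" "l < n" using ij by auto
    show "T_rel p (\<rho> (\<alpha> + unit_expo j + unit_expo k) * \<rho> (\<alpha> + unit_expo i + unit_expo l))
          (\<rho> (\<alpha> + unit_expo i + unit_expo k) * \<rho> (\<alpha> + unit_expo j + unit_expo l))
          (\<rho> (\<alpha> + unit_expo i + unit_expo j) * \<rho> (\<alpha> + unit_expo k + unit_expo l))"
    proof (cases p)
      case (real r)
      then show ?thesis using tri[OF a lt, of r] p by (simp add: T_rel_def)
    next
      case PInf
      then show ?thesis using tri[OF a lt, of "p_exponent t"] pe by (auto simp: T_rel_def)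
    qed (use p in auto)
  qed
  moreover have "normalization t (rep_poly J \<rho>) = f"
  proof (rule poly_mapping_eqI)
    fix \<beta> show "Poly_Mapping.lookup (normalization t (rep_poly J \<rho>)) \<beta> = Poly_Mapping.lookup f \<beta>"
      using expo_fact_pos[of \<beta>] keys
      by (auto simp: lookup_normalization lookup_rep_poly[OF fJ] \<rho>_def ncoeff_def in_keys_iff)
  qed
  ultimately show "f \<in> normalization t ` weak_reps p n d J"
    unfolding weak_reps_def by blast
qed

theorem theorem5p1:
  fixes n d :: nat and J :: "expo set" and t :: real
  assumes "n \<ge> 1" and "d \<ge> 2" and "M_convex n d J" and "t > 0"
  shows "(\<exists>q0::real. q0 > 0 \<and>
            (\<forall>q p :: ereal. 0 < q \<longrightarrow> q \<le> ereal q0 \<longrightarrow> ereal (p_exponent t) \<le> p \<longrightarrow>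
               normalization t ` weak_reps q n d J \<subseteq> Lorentzian_set n d J \<and>
               Lorentzian_set n d J \<subseteq> normalization t ` weak_reps p n d J))
       \<and> p_exponent 1 = 2
       \<and> (\<forall>\<^sub>F q in at_right (0::real).
            normalization 1 ` weak_reps (ereal q) n d J \<subseteq> Lorentzian_set n d J \<and>
            Lorentzian_set n d J \<subseteq> normalization 1 ` weak_reps 2 n d J)"
proof (intro conjI)
  obtain q0 where q0: "q0 > 0" "\<And>q. 0 < q \<Longrightarrow> q \<le> q0 \<Longrightarrow>
     normalization t ` weak_reps (ereal q) n d J \<subseteq> Lorentzian_set n d J"
    using weak_reps_subset_Lorentzian[OF assms] by blast
  show "\<exists>q0::real. q0 > 0 \<and>
            (\<forall>q p :: ereal. 0 < q \<longrightarrow> q \<le> ereal q0 \<longrightarrow> ereal (p_exponent t) \<le> p \<longrightarrow>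
               normalization t ` weak_reps q n d J \<subseteq> Lorentzian_set n d J \<and>
               Lorentzian_set n d J \<subseteq> normalization t ` weak_reps p n d J)"
  proof (intro exI[of _ q0] conjI allI impI q0(1))
    fix q p :: ereal assume q: "0 < q" "q \<le> ereal q0" and p: "ereal (p_exponent t) \<le> p"
    then obtain r where r: "q = ereal r" by (cases q) auto
    show "normalization t ` weak_reps q n d J \<subseteq> Lorentzian_set n d J"
      using q0(2)[of r] q unfolding r by simp
    show "Lorentzian_set n d J \<subseteq> normalization t ` weak_reps p n d J"
      by (rule Lorentzian_subset_weak_reps[OF assms(2,4) p])
  qed
  show p1: "p_exponent 1 = 2" by (simp add: p_exponent_def)
  obtain q1 where q1: "q1 > 0" "\<And>q. 0 < q \<Longrightarrow> q \<le> q1 \<Longrightarrow>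
     normalization 1 ` weak_reps (ereal q) n d J \<subseteq> Lorentzian_set n d J"
    using weak_reps_subset_Lorentzian[OF assms(1-3), of 1] by auto
  have "Lorentzian_set n d J \<subseteq> normalization 1 ` weak_reps 2 n d J"
    by (rule Lorentzian_subset_weak_reps[OF assms(2)]) (simp_all add: p1)
  then show "\<forall>\<^sub>F q in at_right (0::real).
            normalization 1 ` weak_reps (ereal q) n d J \<subseteq> Lorentzian_set n d J \<and>
            Lorentzian_set n d J \<subseteq> normalization 1 ` weak_reps 2 n d J"
    using q1 by (intro eventually_at_rightI[of 0 q1]) (auto simp: less_imp_le)
qed

end
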